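(* Let $r\geq 1$ and $\ell,s\geq 2$ be integers. Let $T_{r,1,1}$ be the tree obtained from $T_{r,1}$ by adding one new leaf adjacent to its central vertex, let $R$ be the set of leaves of $T_{r,1,1}$, and let $H=[T_{r,1,1}]^\ell_R$. Then $\mathrm{ex}^*_{\mathrm{bip}}(n,H,s)=O\big(n^{2-\frac{r+1}{2r+1}}\big)$.
   Context: $T_{r,1}$ is the tree obtained from a star with $r$ leaves (center called the central vertex) by attaching one new leaf to each leaf of the star (a spider with $r$ legs of length two). For a graph $F$ and proper subset $R\subseteq V(F)$, $F^\ell_R$ is the graph consisting of $\ell$ labeled copies $F_1,\dots,F_\ell$ of $F$ such that for each $v\in R$ the images of $v$ in all $F_i$ coincide, and the $F_i$ are pairwise vertex-disjoint outside the common image of $R$. For a bipartite graph $H$ and positive integers $n,s$, $\mathrm{ex}^*_{\mathrm{bip}}(n,H,s)$ is the minimum $M$ such that for every $K_{s,s}$-free $n$-vertex graph $G$ and every partition of $V(G)$ into $X,Y$, if the bipartite graph $G[X,Y]$ of edges of $G$ between $X$ and $Y$ has more than $M$ edges, then $G[X,Y]$ contains a copy of $H$ that is an induced subgraph of $G$. *)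

theory Defs
  imports Complex_Main "HOL-Library.Landau_Symbols"
begin

type_synonym 'a graph = "'a set \<times> 'a set set"

abbreviation verts :: "'a graph \<Rightarrow> 'a set" where "verts G \<equiv> fst G"
abbreviation edges :: "'a graph \<Rightarrow> 'a set set" where "edges G \<equiv> snd G"

definition simple_graph :: "'a graph \<Rightarrow> bool" where
  "simple_graph G \<longleftrightarrow> finite (verts G) \<and> (\<forall>e\<in>edges G. e \<subseteq> verts G \<and> card e = 2)"

definition subgraph :: "'a graph \<Rightarrow> 'a graph \<Rightarrow> bool" where
  "subgraph S G \<longleftrightarrow> simple_graph S \<and> verts S \<subseteq> verts G \<and> edges S \<subseteq> edges G"

definition induced_subgraph :: "'a graph \<Rightarrow> 'a graph \<Rightarrow> bool" where
  "induced_subgraph S G \<longleftrightarrow> verts S \<subseteq> verts G \<and> edges S = {e \<in> edges G. e \<subseteq> verts S}"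

definition isomorphic :: "'a graph \<Rightarrow> 'b graph \<Rightarrow> bool" where
  "isomorphic G H \<longleftrightarrow> (\<exists>f. bij_betw f (verts G) (verts H) \<and> (\<lambda>e. f ` e) ` edges G = edges H)"

definition degree :: "'a graph \<Rightarrow> 'a \<Rightarrow> nat" where
  "degree G v = card {e \<in> edges G. v \<in> e}"

definition leaves :: "'a graph \<Rightarrow> 'a set" where
  "leaves G = {v \<in> verts G. degree G v = 1}"

definition complete_bipartite :: "nat \<Rightarrow> nat \<Rightarrow> (nat + nat) graph" where
  "complete_bipartite s t =
     (Inl ` {..<s} \<union> Inr ` {..<t}, {{Inl i, Inr j} | i j. i < s \<and> j < t})"

definition Kss_free :: "nat \<Rightarrow> 'a graph \<Rightarrow> bool" where
  "Kss_free s G \<longleftrightarrow> \<not> (\<exists>S. subgraph S G \<and> isomorphic S (complete_bipartite s s))"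

definition between :: "'a graph \<Rightarrow> 'a set \<Rightarrow> 'a set \<Rightarrow> 'a graph" where
  "between G X Y = (X \<union> Y, {e \<in> edges G. \<exists>x\<in>X. \<exists>y\<in>Y. e = {x, y}})"

text \<open>Every finite graph is isomorphic to one with natural-number vertices, so quantifying
  over the latter loses nothing.  An empty part is harmless in a partition, since then
  there are no edges between the two parts.\<close>

definition ex_bip_bound :: "nat \<Rightarrow> 'a graph \<Rightarrow> nat \<Rightarrow> nat \<Rightarrow> bool" where
  "ex_bip_bound n H s M \<longleftrightarrow>
     (\<forall>(G :: nat graph) X Y.
        simple_graph G \<and> card (verts G) = n \<and> Kss_free s G \<and>
        X \<union> Y = verts G \<and> X \<inter> Y = {} \<and> card (edges (between G X Y)) > M \<longrightarrow>
        (\<exists>S. subgraph S (between G X Y) \<and> isomorphic S H \<and> induced_subgraph S G))"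

definition ex_bip_star :: "nat \<Rightarrow> 'a graph \<Rightarrow> nat \<Rightarrow> nat" where
  "ex_bip_star n H s = (LEAST M. ex_bip_bound n H s M)"

lemma ex_bip_bound_ex_bip_star: "ex_bip_bound n H s (ex_bip_star n H s)"
proof -
  have bound: "card (edges (between G X Y)) \<le> 2 ^ n"
    if "simple_graph G" "card (verts G) = n" for G :: "nat graph" and X Y
  proof -
    have "edges (between G X Y) \<subseteq> Pow (verts G)" "finite (verts G)"
      using that(1) by (auto simp: between_def simple_graph_def)
    then have "card (edges (between G X Y)) \<le> card (Pow (verts G))"
      by (intro card_mono) auto
    then show ?thesis
      using that \<open>finite (verts G)\<close> by (simp add: card_Pow)
  qed
  have "ex_bip_bound n H s (2 ^ n)"
    unfolding ex_bip_bound_def using bound leD by metis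
  then show ?thesis
    unfolding ex_bip_star_def by (rule LeastI)
qed

text \<open>In the \<open>i\<close>-th copy, a vertex \<open>v \<in> R\<close> becomes \<open>Inl v\<close>, independently of \<open>i\<close>,
  and a vertex \<open>v \<notin> R\<close> becomes \<open>Inr (i, v)\<close>.\<close>

definition copy_vertex :: "'a set \<Rightarrow> nat \<Rightarrow> 'a \<Rightarrow> 'a + nat \<times> 'a" where
  "copy_vertex R i v = (if v \<in> R then Inl v else Inr (i, v))"

definition rooted_power :: "'a graph \<Rightarrow> 'a set \<Rightarrow> nat \<Rightarrow> ('a + nat \<times> 'a) graph" where
  "rooted_power F R l =
     (\<Union>i<l. copy_vertex R i ` verts F, \<Union>i<l. (\<lambda>e. copy_vertex R i ` e) ` edges F)"

datatype spider_vertex = Centre | Inner nat | Outer nat | Pendant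

definition star :: "nat \<Rightarrow> spider_vertex graph" where
  "star r = (insert Centre (Inner ` {..<r}), {{Centre, Inner i} | i. i < r})"

definition spider :: "nat \<Rightarrow> spider_vertex graph" where
  "spider r = (verts (star r) \<union> Outer ` {..<r},
               edges (star r) \<union> {{Inner i, Outer i} | i. i < r})"

definition spider_plus :: "nat \<Rightarrow> spider_vertex graph" where
  "spider_plus r = (insert Pendant (verts (spider r)),
                    insert {Centre, Pendant} (edges (spider r)))"

lemma leaves_spider_plus:
  assumes "r \<ge> 1"
  shows "leaves (spider_plus r) = insert Pendant (Outer ` {..<r})"
proof -
  note defs = spider_plus_def spider_def star_def
  have P: "{e \<in> edges (spider_plus r). Pendant \<in> e} = {{Centre, Pendant}}"
    by (auto simp: defs)
  have O: "{e \<in> edges (spider_plus r). Outer i \<in> e} = {{Inner i, Outer i}}" if "i < r" for i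
    using that by (auto simp: defs)
  have I: "{e \<in> edges (spider_plus r). Inner i \<in> e} = {{Inner i, Outer i}, {Centre, Inner i}}"
    if "i < r" for i
    using that by (auto simp: defs)
  have I2: "card {{Inner i, Outer i}, {Centre, Inner i}} = 2" for i
    by (auto simp: card_2_iff doubleton_eq_iff)
  have "finite {e \<in> edges (spider_plus r). Centre \<in> e}"
    by (auto simp: defs)
  moreover have "{{Centre, Pendant}, {Centre, Inner 0}} \<subseteq> {e \<in> edges (spider_plus r). Centre \<in> e}"
    using assms by (auto simp: defs)
  ultimately have "card {{Centre, Pendant}, {Centre, Inner 0}} \<le> degree (spider_plus r) Centre"
    unfolding degree_def by (rule card_mono)
  then have C: "degree (spider_plus r) Centre \<ge> 2"
    by (simp add: doubleton_eq_iff)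
  have D: "degree (spider_plus r) Pendant = 1" "\<And>i. i < r \<Longrightarrow> degree (spider_plus r) (Outer i) = 1"
    "\<And>i. i < r \<Longrightarrow> degree (spider_plus r) (Inner i) = 2" "degree (spider_plus r) Centre \<noteq> 1"
    using C unfolding degree_def P by (simp_all only: O I I2) simp_all
  have V: "verts (spider_plus r) =
      {Centre, Pendant} \<union> Inner ` {..<r} \<union> Outer ` {..<r}"
    by (auto simp: defs)
  show ?thesis
    unfolding leaves_def V using D by auto
qed

end

theory Submission
  imports Defs "HOL-Library.Ramsey"
begin

text \<open>
  Let \<open>B\<close> be the bipartite graph between \<open>X\<close> and \<open>Y\<close>. By choosing a vertex set of maximal
  density we may assume that all degrees of \<open>B\<close> are at most a constant times the average degree
  \<open>D \<ge> C n\<^bsup>r/(2r+1)\<^esup>\<close>. Sets of at most \<open>D\<close> vertices span few edges in a \<open>K\<^bsub>s,s\<^esub>\<close>-free graph, so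
  almost all spiders in \<open>B\<close> are induced; and by Ramsey's theorem a large family of disjoint induced
  spiders with the same leaves contains \<open>l\<close> of them with no edges in between.

  Call two vertices on the same side light if they have boundedly many common neighbours. If a
  positive proportion of the paths \<open>p c a q\<close> of \<open>B\<close> have both \<open>(p, a)\<close> and \<open>(c, q)\<close> light, there are
  at least a large constant times \<open>n\<^bsup>r+1\<^esup>\<close> spiders built from such paths, hence some tuple of leaves
  carries many of them, and each meets boundedly many others.

  Otherwise, a positive proportion of the edges \<open>x y\<close> are such that \<open>x\<close> has many common neighbours
  with a positive proportion of the neighbours of \<open>y\<close> (or the same with the sides exchanged). If two
  vertices \<open>y \<noteq> y'\<close> had many common neighbours along such edges, the power of the spider could be
  found with pendant vertex \<open>y'\<close>, centres in \<open>N(y) \<inter> N(y')\<close> and the other leaves in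
  \<open>N(y) - N(y')\<close>. So the graph of these edges has few 4-cycles, and therefore most of its paths are
  light on both sides.
\<close>

section \<open>Dense relations\<close>

text \<open>A spider is determined by the edge between its centre and its pendant vertex together
  with \<open>r\<close> legs, so an almost regular graph has about n D^(2r+1) of them, against at
  most n^(r+1) tuples of leaves; this is where the threshold D^(2r+1) >= C n^r comes from. Many
  spiders on the same leaves are useless if they all pass through one vertex, and lightness excludes
  this: that of \<open>(c, q)\<close> bounds the inner vertices once the centre and the leaves are
  fixed, that of \<open>(p, a)\<close> bounds the centres once \<open>p\<close> and one inner vertex
  are fixed.

  Counting takes place in a set of edges between the two sides, while inducedness is tested against
  all edges of the graph, including those inside a side. Edges can therefore be discarded from the
  counting without affecting what is an induced copy. This matters when heavy pairs are frequent:
  the whole graph may contain far too many 4-cycles, and only the subgraph of the heavy edges is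
  shown to have few, so the light paths are found inside that subgraph, with the same
  \<open>n\<close> and \<open>D\<close>.\<close>

lemma card_Sigma_le_real:
  fixes b :: real
  assumes "finite A" "\<And>x. x \<in> A \<Longrightarrow> finite (B x)" "\<And>x. x \<in> A \<Longrightarrow> real (card (B x)) \<le> b"
  shows "real (card (Sigma A B)) \<le> real (card A) * b"
proof -
  have "real (card (Sigma A B)) = (\<Sum>x\<in>A. real (card (B x)))"
    using assms by simp
  also have "\<dots> \<le> (\<Sum>x\<in>A. b)"
    using assms by (intro sum_mono)
  finally show ?thesis by simp
qed

lemma card_Sigma_ge_real:
  fixes b :: real
  assumes "finite A" "\<And>x. x \<in> A \<Longrightarrow> finite (B x)" "\<And>x. x \<in> A \<Longrightarrow> b \<le> real (card (B x))"
  shows "real (card A) * b \<le> real (card (Sigma A B))"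
proof -
  have "real (card A) * b = (\<Sum>x\<in>A. b)"
    by simp
  also have "\<dots> \<le> (\<Sum>x\<in>A. real (card (B x)))"
    using assms by (intro sum_mono)
  finally show ?thesis using assms by simp
qed

lemma card_le_of_image:
  assumes "finite A" "B \<subseteq> f ` A" "real (card A) \<le> b"
  shows "finite B \<and> real (card B) \<le> b"
  using assms surj_card_le[of A B f] finite_subset[of B "f ` A"] by auto

text \<open>A reverse Markov inequality: the small fibres account for at most
  \<open>card A * a\<close> of the total and each large one for at most \<open>b\<close>, so the
  remaining \<open>m * b\<close> requires \<open>m\<close> large fibres.\<close>

lemma many_large_fibres:
  fixes a b :: real
  assumes A: "finite A" "\<And>x. x \<in> A \<Longrightarrow> finite (B x)"
    and le: "\<And>x. x \<in> A \<Longrightarrow> real (card (B x)) \<le> b"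
    and ge: "real (card A) * a + m * b \<le> real (card (Sigma A B))" and "0 < b" "0 \<le> a"
  shows "m \<le> real (card {x \<in> A. a \<le> real (card (B x))})"
proof -
  let ?G = "{x \<in> A. a \<le> real (card (B x))}"
  have "real (card (Sigma A B)) = (\<Sum>x\<in>A. real (card (B x)))"
    using A by simp
  also have "\<dots> = (\<Sum>x\<in>?G. real (card (B x))) + (\<Sum>x\<in>A - ?G. real (card (B x)))"
    using A by (subst add.commute, subst sum.subset_diff[of ?G A]) auto
  also have "\<dots> \<le> (\<Sum>x\<in>?G. b) + (\<Sum>x\<in>A - ?G. a)"
    using le by (intro add_mono sum_mono) auto
  also have "\<dots> \<le> real (card ?G) * b + real (card A) * a"
    using A \<open>0 \<le> a\<close> by (auto intro!: mult_right_mono card_mono)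
  finally have "m * b \<le> real (card ?G) * b"
    using ge by linarith
  then show ?thesis using \<open>0 < b\<close> by simp
qed

lemma pigeonhole_fibre:
  assumes "finite A" "finite B" "f ` A \<subseteq> B" "card B * m < card A"
  obtains y where "y \<in> B" "m < card {x \<in> A. f x = y}"
proof -
  have "B \<noteq> {}" using assms by auto
  moreover have "f \<in> A \<rightarrow> B" using assms by auto
  ultimately obtain y where y: "y \<in> B" "card A \<le> card (f -` {y} \<inter> A) * card B"
    using pigeonhole_card[of f A B] assms by blast
  have eq: "f -` {y} \<inter> A = {x \<in> A. f x = y}" by auto
  have "m * card B < card {x \<in> A. f x = y} * card B"
    using y(2) assms(4) mult.commute[of "card B" m] unfolding eq by linarith
  then show ?thesis using that y(1) by simp
qed

text \<open>Among \<open>k\<close> dense rows an average column meets at least \<open>2 * a\<close>,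
  so a positive proportion of the columns meet at least \<open>a\<close>. Each of these selects an
  \<open>a\<close>-subset of the \<open>k\<close> rows, and since there are at most
  \<open>2 ^ k\<close> subsets, \<open>b\<close> columns agree. The number \<open>k\<close> depends
  on \<open>d\<close> and \<open>a\<close> but not on \<open>D\<close>; this asymmetry is what later
  bounds exceptional sets by constants.\<close>

lemma dense_rows_biclique:
  fixes d :: real and a b :: nat
  assumes "0 < d"
  shows "\<exists>(k :: nat) (D0 :: real). \<forall>(R :: 'a \<Rightarrow> 'b \<Rightarrow> bool) I Q D.
       finite I \<longrightarrow> finite Q \<longrightarrow> k \<le> card I \<longrightarrow> real (card Q) \<le> D \<longrightarrow> D0 \<le> D \<longrightarrow>
       (\<forall>x\<in>I. d * D \<le> real (card {q \<in> Q. R x q})) \<longrightarrow>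
       (\<exists>I' Q'. I' \<subseteq> I \<and> Q' \<subseteq> Q \<and> card I' = a \<and> card Q' = b \<and> (\<forall>x\<in>I'. \<forall>q\<in>Q'. R x q))"
proof -
  define k where "k = nat \<lceil>2 * real a / d\<rceil> + 1"
  define D0 where "D0 = 2 / d * (2 ^ k * real b + 1)"
  have "2 * real a / d \<le> real k" unfolding k_def by linarith
  then have kd: "2 * real a \<le> real k * d" using assms by (simp add: field_simps)
  have k1: "k \<ge> 1" unfolding k_def by simp
  have main: "\<exists>I' Q'. I' \<subseteq> I \<and> Q' \<subseteq> Q \<and> card I' = a \<and> card Q' = b \<and> (\<forall>x\<in>I'. \<forall>q\<in>Q'. R x q)"
    if fin: "finite I" "finite Q" and cI: "k \<le> card I" and cQ: "real (card Q) \<le> D" and D: "D0 \<le> D"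
      and row: "\<forall>x\<in>I. d * D \<le> real (card {q \<in> Q. R x q})"
    for R :: "'a \<Rightarrow> 'b \<Rightarrow> bool" and I Q D
  proof -
    obtain J where J: "J \<subseteq> I" "card J = k" "finite J"
      using cI obtain_subset_with_card_n by metis
    have D0: "D > 0"
    proof -
      have "D0 > 0" unfolding D0_def using assms by (intro mult_pos_pos add_nonneg_pos) auto
      then show ?thesis using D by simp
    qed
    define Qg where "Qg = {q \<in> Q. a \<le> card {x \<in> J. R x q}}"
    have "real k * (d * D) \<le> real (card (SIGMA x:J. {q \<in> Q. R x q}))"
      using card_Sigma_ge_real[of J "\<lambda>x. {q \<in> Q. R x q}" "d * D"] J fin row by auto
    also have "(SIGMA x:J. {q \<in> Q. R x q}) = prod.swap ` (SIGMA q:Q. {x \<in> J. R x q})"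
      by (auto simp: image_iff)
    also have "card \<dots> = card (SIGMA q:Q. {x \<in> J. R x q})"
      by (intro card_image) (auto simp: inj_on_def)
    finally have S: "real k * (d * D) \<le> real (card (SIGMA q:Q. {x \<in> J. R x q}))" .
    have "d * D / 2 \<le> real (card {q \<in> Q. real a \<le> real (card {x \<in> J. R x q})})"
    proof (rule many_large_fibres[where b = "real k"])
      have "real (card Q) * real a \<le> D * real a" using cQ by (intro mult_right_mono) auto
      also have "\<dots> \<le> real k * (d * D) / 2" using mult_right_mono[OF kd, of D] D0 by (simp add: algebra_simps)
      finally show "real (card Q) * real a + d * D / 2 * real k \<le> real (card (SIGMA q:Q. {x \<in> J. R x q}))"
        using S by (simp add: mult.commute mult.left_commute)
      show "real (card {x \<in> J. R x q}) \<le> real k" for q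
        using J card_mono[of J "{x \<in> J. R x q}"] by auto
    qed (use fin J k1 in auto)
    then have Qg: "d * D / 2 \<le> real (card Qg)" unfolding Qg_def by simp
    have "\<exists>K. K \<subseteq> {x \<in> J. R x q} \<and> card K = a" if "q \<in> Qg" for q
      using obtain_subset_with_card_n[of a "{x \<in> J. R x q}"] that unfolding Qg_def by blast
    then obtain f where f: "\<And>q. q \<in> Qg \<Longrightarrow> f q \<subseteq> {x \<in> J. R x q} \<and> card (f q) = a"
      by metis
    have "2 ^ k * real b + 1 \<le> d * D / 2"
      using D assms unfolding D0_def by (simp add: field_simps)
    then have "real (2 ^ k * b) < real (card Qg)" using Qg by simp
    then have "card (Pow J) * b < card Qg"
      using J by (simp add: card_Pow del: of_nat_mult of_nat_power)
    moreover have "finite Qg" "f ` Qg \<subseteq> Pow J" unfolding Qg_def using fin f[unfolded Qg_def] by auto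
    ultimately obtain K where K: "b < card {q \<in> Qg. f q = K}"
      using pigeonhole_fibre[of Qg "Pow J" f b] J(3) by blast
    then have "{q \<in> Qg. f q = K} \<noteq> {}" by (intro notI) simp
    then obtain q0 where "q0 \<in> Qg" "f q0 = K" by blast
    obtain Q' where Q': "Q' \<subseteq> {q \<in> Qg. f q = K}" "card Q' = b"
      using obtain_subset_with_card_n[OF less_imp_le[OF K]] by blast
    have "K \<subseteq> I" "card K = a" using f[OF \<open>q0 \<in> Qg\<close>] \<open>f q0 = K\<close> J by auto
    moreover have "Q' \<subseteq> Q" using Q' Qg_def by auto
    moreover have "\<forall>x\<in>K. \<forall>q\<in>Q'. R x q" using Q' f by blast
    ultimately show ?thesis using Q' by blast
  qed
  show ?thesis by (intro exI[of _ k] exI[of _ D0] allI impI) (rule main)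
qed

text \<open>A qualitative form of the Kovari-Sos-Turan theorem: at least \<open>e / 2 * D\<close>
  rows have at least \<open>e / 2 * D\<close> entries each, which for large \<open>D\<close> is more
  than the constant number of dense rows that forces a biclique.\<close>

lemma dense_biclique:
  fixes e :: real and a b :: nat
  assumes "0 < e"
  shows "\<exists>D0 :: real. \<forall>(R :: 'a \<Rightarrow> 'b \<Rightarrow> bool) P Q D. finite P \<longrightarrow> finite Q \<longrightarrow>
       real (card P) \<le> D \<longrightarrow> real (card Q) \<le> D \<longrightarrow> D0 \<le> D \<longrightarrow>
       e * D\<^sup>2 \<le> real (card {(x, q). x \<in> P \<and> q \<in> Q \<and> R x q}) \<longrightarrow>
       (\<exists>P' Q'. P' \<subseteq> P \<and> Q' \<subseteq> Q \<and> card P' = a \<and> card Q' = b \<and> (\<forall>x\<in>P'. \<forall>q\<in>Q'. R x q))"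
proof -
  have half: "0 < e / 2" using assms by simp
  obtain k :: nat and D1 :: real where kD:
    "\<forall>(R :: 'a \<Rightarrow> 'b \<Rightarrow> bool) I Q D.
       finite I \<longrightarrow> finite Q \<longrightarrow> k \<le> card I \<longrightarrow> real (card Q) \<le> D \<longrightarrow> D1 \<le> D \<longrightarrow>
       (\<forall>x\<in>I. e / 2 * D \<le> real (card {q \<in> Q. R x q})) \<longrightarrow>
       (\<exists>I' Q'. I' \<subseteq> I \<and> Q' \<subseteq> Q \<and> card I' = a \<and> card Q' = b \<and> (\<forall>x\<in>I'. \<forall>q\<in>Q'. R x q))"
    using dense_rows_biclique[OF half, of a b] by (elim exE) (rule that)
  define D0 where "D0 = max 1 (max D1 (2 * real k / e))"
  have main: "\<exists>P' Q'. P' \<subseteq> P \<and> Q' \<subseteq> Q \<and> card P' = a \<and> card Q' = b \<and> (\<forall>x\<in>P'. \<forall>q\<in>Q'. R x q)"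
    if fin: "finite P" "finite Q" and cP: "real (card P) \<le> D" and cQ: "real (card Q) \<le> D" and D: "D0 \<le> D"
      and ed: "e * D\<^sup>2 \<le> real (card {(x, q). x \<in> P \<and> q \<in> Q \<and> R x q})"
    for R :: "'a \<Rightarrow> 'b \<Rightarrow> bool" and P Q D
  proof -
    have D1: "D \<ge> 1" "D1 \<le> D" "2 * real k / e \<le> D" using D unfolding D0_def by auto
    let ?I = "{x \<in> P. e / 2 * D \<le> real (card {q \<in> Q. R x q})}"
    have S: "{(x, q). x \<in> P \<and> q \<in> Q \<and> R x q} = (SIGMA x:P. {q \<in> Q. R x q})" by auto
    have "e / 2 * D \<le> real (card ?I)"
    proof (rule many_large_fibres[where b = D])
      have "real (card P) * (e / 2 * D) \<le> D * (e / 2 * D)"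
        using cP D1 assms by (intro mult_right_mono) auto
      then show "real (card P) * (e / 2 * D) + e / 2 * D * D \<le> real (card (SIGMA x:P. {q \<in> Q. R x q}))"
        using ed unfolding S by (simp add: power2_eq_square field_simps)
      show "real (card {q \<in> Q. R x q}) \<le> D" for x
        using cQ fin card_mono[of Q "{q \<in> Q. R x q}"] by (auto intro: order_trans[rotated])
    qed (use fin D1 assms in auto)
    moreover have "real k \<le> e / 2 * D" using D1(3) assms by (simp add: field_simps)
    ultimately have "k \<le> card ?I" by linarith
    then obtain I' Q' where "I' \<subseteq> ?I \<and> Q' \<subseteq> Q \<and> card I' = a \<and> card Q' = b \<and> (\<forall>x\<in>I'. \<forall>q\<in>Q'. R x q)"
      using kD[rule_format, of ?I Q D R] fin cQ D1 by auto
    then show ?thesis by blast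
  qed
  show ?thesis by (intro exI[of _ D0] allI impI) (rule main)
qed

text \<open>Greedy choice: each picked element discards at most \<open>D\<close> elements.
  Reflexivity of \<open>K\<close> on \<open>Z\<close> puts the picked element among the discarded
  ones, so it cannot be picked again.\<close>

lemma independent_subset:
  assumes "finite Z" "\<And>z. z \<in> Z \<Longrightarrow> K z z" "\<And>z z'. K z z' \<Longrightarrow> K z' z"
    and "\<And>z. z \<in> Z \<Longrightarrow> card {z' \<in> Z. K z z'} \<le> D" "m * D \<le> card Z" "0 < D"
  obtains Z' where "Z' \<subseteq> Z" "card Z' = m" "\<And>z z'. \<lbrakk>z \<in> Z'; z' \<in> Z'; z \<noteq> z'\<rbrakk> \<Longrightarrow> \<not> K z z'"
proof -
  have "\<exists>Z'. Z' \<subseteq> Z \<and> card Z' = m \<and> (\<forall>z\<in>Z'. \<forall>z'\<in>Z'. z \<noteq> z' \<longrightarrow> \<not> K z z')"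
    using assms
  proof (induction m arbitrary: Z)
    case 0
    then show ?case by (intro exI[of _ "{}"]) auto
  next
    case (Suc m)
    have "0 < card Z" using Suc.prems(5,6) by (cases "card Z") auto
    then obtain z where z: "z \<in> Z" by (metis card.empty equals0I less_irrefl)
    let ?Y = "{z' \<in> Z. \<not> K z z'}"
    have Y: "?Y = Z - {z' \<in> Z. K z z'}" by auto
    have "card ?Y = card Z - card {z' \<in> Z. K z z'}"
      unfolding Y using Suc.prems(1) by (intro card_Diff_subset) auto
    then have "m * D \<le> card ?Y" using Suc.prems(4)[OF z] Suc.prems(5) by auto
    moreover have "card {z' \<in> ?Y. K y z'} \<le> D" if "y \<in> ?Y" for y
    proof -
      have "card {z' \<in> ?Y. K y z'} \<le> card {z' \<in> Z. K y z'}"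
        using Suc.prems(1) by (intro card_mono) auto
      then show ?thesis using Suc.prems(4)[of y] that by auto
    qed
    ultimately obtain Z' where Z': "Z' \<subseteq> ?Y" "card Z' = m" "\<forall>z\<in>Z'. \<forall>z'\<in>Z'. z \<noteq> z' \<longrightarrow> \<not> K z z'"
      using Suc.IH[of ?Y] Suc.prems(1-3,6) by auto
    have "finite Z'" using Z'(1) Suc.prems(1) finite_subset[of Z' Z] by auto
    moreover have "z \<notin> Z'" using Z'(1) Suc.prems(2)[OF z] by auto
    ultimately have "card (insert z Z') = Suc m" using Z'(2) by simp
    moreover have "insert z Z' \<subseteq> Z" using Z'(1) z by auto
    moreover have "\<not> K z z'" "\<not> K z' z" if "z' \<in> Z'" for z'
      using Z'(1) that Suc.prems(3)[of z' z] by auto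
    ultimately show ?case
      using Z'(3) by (intro exI[of _ "insert z Z'"]) simp
  qed
  then show ?thesis using that by blast
qed

section \<open>Biclique-free graphs\<close>

text \<open>Disjointness of \<open>P\<close> and \<open>Q\<close> is automatic for an irreflexive
  relation. The relation is the adjacency of the whole graph, so edges inside a side count as
  well.\<close>

definition biclique_free :: "nat \<Rightarrow> ('a \<Rightarrow> 'a \<Rightarrow> bool) \<Rightarrow> bool" where
  "biclique_free s adj \<longleftrightarrow> symp adj \<and> irreflp adj \<and>
     \<not> (\<exists>P Q. card P = s \<and> card Q = s \<and> (\<forall>p\<in>P. \<forall>q\<in>Q. adj p q))"

text \<open>Equality and adjacency are the two ways in which a pair that should be a non-edge of the
  copy can be spoiled. Excluding both at once yields injectivity and inducedness together.\<close>

definition conflict :: "('a \<Rightarrow> 'a \<Rightarrow> bool) \<Rightarrow> 'a \<Rightarrow> 'a \<Rightarrow> bool" where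
  "conflict adj u v \<longleftrightarrow> u = v \<or> adj u v"

definition conflict_pairs :: "('a \<Rightarrow> 'a \<Rightarrow> bool) \<Rightarrow> 'a set \<Rightarrow> 'a set \<Rightarrow> ('a \<times> 'a) set" where
  "conflict_pairs adj P Q = {(u, v). u \<in> P \<and> v \<in> Q \<and> conflict adj u v}"

lemma conflict_pairs_iff [simp]:
  "(u, v) \<in> conflict_pairs adj P Q \<longleftrightarrow> u \<in> P \<and> v \<in> Q \<and> conflict adj u v"
  by (simp add: conflict_pairs_def)

lemma finite_conflict_pairs [simp]:
  assumes "finite P" "finite Q"
  shows "finite (conflict_pairs adj P Q)"
proof (rule finite_subset)
  show "conflict_pairs adj P Q \<subseteq> P \<times> Q" by auto
qed (use assms in auto)

lemma biclique_freeD: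
  assumes "biclique_free s adj"
  shows "adj u v \<Longrightarrow> adj v u" "\<not> adj u u"
    "card P = s \<Longrightarrow> card Q = s \<Longrightarrow> (\<And>p q. p \<in> P \<Longrightarrow> q \<in> Q \<Longrightarrow> adj p q) \<Longrightarrow> False"
proof -
  have "symp adj" "irreflp adj" using assms unfolding biclique_free_def by simp_all
  then show "adj u v \<Longrightarrow> adj v u" "\<not> adj u u"
    unfolding symp_def irreflp_def by simp_all
  assume "card P = s" "card Q = s" "\<And>p q. p \<in> P \<Longrightarrow> q \<in> Q \<Longrightarrow> adj p q"
  then have "\<exists>P Q. card P = s \<and> card Q = s \<and> (\<forall>p\<in>P. \<forall>q\<in>Q. adj p q)"
    by (intro exI[of _ P] exI[of _ Q]) simp
  then show False using assms unfolding biclique_free_def by simp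
qed

text \<open>The adjacent pairs are fewer than \<open>e / 2 * D\<^sup>2\<close>, as otherwise they
  would contain a biclique. The equal pairs number at most \<open>D\<close>, which is absorbed once
  \<open>D \<ge> 2 / e\<close>.\<close>

lemma few_conflicts:
  fixes e :: real
  assumes "0 < e"
  shows "\<exists>D0 :: real. \<forall>(adj :: 'a \<Rightarrow> 'a \<Rightarrow> bool) P Q D. biclique_free s adj \<longrightarrow> finite P \<longrightarrow> finite Q \<longrightarrow>
       real (card P) \<le> D \<longrightarrow> real (card Q) \<le> D \<longrightarrow> D0 \<le> D \<longrightarrow>
       real (card (conflict_pairs adj P Q)) \<le> e * D\<^sup>2"
proof -
  have half: "0 < e / 2" using assms by simp
  obtain D1 :: real where D1:
    "\<forall>(R :: 'a \<Rightarrow> 'a \<Rightarrow> bool) P Q D. finite P \<longrightarrow> finite Q \<longrightarrow>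
       real (card P) \<le> D \<longrightarrow> real (card Q) \<le> D \<longrightarrow> D1 \<le> D \<longrightarrow>
       e / 2 * D\<^sup>2 \<le> real (card {(x, q). x \<in> P \<and> q \<in> Q \<and> R x q}) \<longrightarrow>
       (\<exists>P' Q'. P' \<subseteq> P \<and> Q' \<subseteq> Q \<and> card P' = s \<and> card Q' = s \<and> (\<forall>x\<in>P'. \<forall>q\<in>Q'. R x q))"
    using dense_biclique[OF half, of s s] by (elim exE) (rule that)
  define D0 where "D0 = max 1 (max D1 (2 / e))"
  have main: "real (card (conflict_pairs adj P Q)) \<le> e * D\<^sup>2"
    if "biclique_free s adj" "finite P" "finite Q" "real (card P) \<le> D" "real (card Q) \<le> D" "D0 \<le> D"
    for adj :: "'a \<Rightarrow> 'a \<Rightarrow> bool" and P Q D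
  proof -
    note hyps = that
    have D: "1 \<le> D" "D1 \<le> D" "2 / e \<le> D" using that D0_def by auto
    let ?A = "{(u, v). u \<in> P \<and> v \<in> Q \<and> adj u v}"
    have "real (card ?A) < e / 2 * D\<^sup>2"
    proof (rule ccontr)
      assume "\<not> ?thesis"
      then obtain P' Q' where "card P' = s" "card Q' = s" "\<forall>x\<in>P'. \<forall>q\<in>Q'. adj x q"
        using D1[rule_format, of P Q D adj] hyps D by auto
      then show False using biclique_freeD(3)[OF that(1)] by blast
    qed
    moreover have "conflict_pairs adj P Q \<subseteq> (\<lambda>u. (u, u)) ` P \<union> ?A"
      unfolding conflict_pairs_def conflict_def by auto
    then have "card (conflict_pairs adj P Q) \<le> card ((\<lambda>u. (u, u)) ` P \<union> ?A)"
      using that by (intro card_mono) (auto intro: finite_subset[of _ "P \<times> Q"])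
    then have "card (conflict_pairs adj P Q) \<le> card P + card ?A"
      using card_Un_le[of "(\<lambda>u. (u, u)) ` P" ?A] card_image_le[of P "\<lambda>u. (u, u)"] that by linarith
    moreover have "D \<le> e / 2 * D\<^sup>2"
    proof -
      have "1 \<le> e / 2 * D" using D(3) assms by (simp add: field_simps)
      from mult_right_mono[OF this, of D] show ?thesis using D(1) by (simp add: power2_eq_square algebra_simps)
    qed
    ultimately show ?thesis using that by linarith
  qed
  show ?thesis by (intro exI[of _ D0] allI impI) (rule main)
qed

text \<open>In a Ramsey clique of indices any two tuples would be joined by an edge, so for some pair of
  positions the adjacency relation would be dense, producing a biclique.\<close>

lemma nonadjacent_tuples:
  fixes K s m :: nat
  shows "\<exists>M :: nat. \<forall>(adj :: 'a \<Rightarrow> 'a \<Rightarrow> bool) (v :: 'b \<Rightarrow> nat \<Rightarrow> 'a) T. biclique_free s adj \<longrightarrow>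
      finite T \<longrightarrow> M \<le> card T \<longrightarrow> (\<forall>k<K. inj_on (\<lambda>t. v t k) T) \<longrightarrow>
      (\<exists>T'\<subseteq>T. card T' = m \<and>
         (\<forall>t\<in>T'. \<forall>t'\<in>T'. t \<noteq> t' \<longrightarrow> (\<forall>k<K. \<forall>k'<K. \<not> adj (v t k) (v t' k'))))"
proof -
  \<comment> \<open>A clique of \<open>c\<close> indices would give
    \<open>c\<^sup>2 \<le> c + K\<^sup>2 * e * c\<^sup>2\<close>: the diagonal, plus fewer than
    \<open>e * c\<^sup>2\<close> pairs for each pair of positions. The choice of \<open>e\<close>
    keeps \<open>K\<^sup>2 * e\<close> below one half, and \<open>c\<close> is then taken large
    enough to violate this inequality.\<close>
  define e where "e = 1 / (2 * (real K)\<^sup>2 + 2)"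
  have e: "e > 0" unfolding e_def by (simp add: add_nonneg_pos)
  have eK: "(real K)\<^sup>2 * e < 1 / 2" unfolding e_def by (simp add: divide_simps) (smt (verit) zero_le_power2)
  obtain D0 :: real where D0:
    "\<forall>(R :: 'b \<Rightarrow> 'b \<Rightarrow> bool) P Q D. finite P \<longrightarrow> finite Q \<longrightarrow>
       real (card P) \<le> D \<longrightarrow> real (card Q) \<le> D \<longrightarrow> D0 \<le> D \<longrightarrow>
       e * D\<^sup>2 \<le> real (card {(x, q). x \<in> P \<and> q \<in> Q \<and> R x q}) \<longrightarrow>
       (\<exists>P' Q'. P' \<subseteq> P \<and> Q' \<subseteq> Q \<and> card P' = s \<and> card Q' = s \<and> (\<forall>x\<in>P'. \<forall>q\<in>Q'. R x q))"
    using dense_biclique[OF e, of s s] by (elim exE) (rule that)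
  define c where "c = nat \<lceil>max D0 (1 / (1 / 2 - (real K)\<^sup>2 * e))\<rceil> + 1"
  have c: "D0 \<le> real c" "1 / (1/2 - (real K)\<^sup>2 * e) < real c"
    unfolding c_def by linarith+
  obtain M where M: "\<forall>(V::'b set) (E::'b set set). finite V \<and> card V \<ge> M \<longrightarrow>
    (\<exists>R \<subseteq> V. card R = c \<and> clique R E \<or> card R = m \<and> indep R E)"
    using ramsey2[of c m] by metis
  have main: "\<exists>T'\<subseteq>T. card T' = m \<and> (\<forall>t\<in>T'. \<forall>t'\<in>T'. t \<noteq> t' \<longrightarrow> (\<forall>k<K. \<forall>k'<K. \<not> adj (v t k) (v t' k')))"
    if free: "biclique_free s adj" and T: "finite T" "M \<le> card T"
      and inj: "\<forall>k<K. inj_on (\<lambda>t. v t k) T"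
    for adj :: "'a \<Rightarrow> 'a \<Rightarrow> bool" and v :: "'b \<Rightarrow> nat \<Rightarrow> 'a" and T
  proof -
    note sym = biclique_freeD(1)[OF free]
    define E where "E = {{t, t'} | t t'. \<exists>k<K. \<exists>k'<K. adj (v t k) (v t' k')}"
    have E: "{t, t'} \<in> E \<longleftrightarrow> (\<exists>k<K. \<exists>k'<K. adj (v t k) (v t' k'))" for t t'
      unfolding E_def using sym by (fastforce simp: doubleton_eq_iff)
    obtain R where R: "R \<subseteq> T" "card R = c \<and> clique R E \<or> card R = m \<and> indep R E"
      using M T by blast
    have "\<not> (card R = c \<and> clique R E)"
    proof
      assume cl: "card R = c \<and> clique R E"
      have fR: "finite R" using R T finite_subset by blast
      let ?S = "\<lambda>k k'. {(t, t'). t \<in> R \<and> t' \<in> R \<and> adj (v t k) (v t' k')}"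
      have small: "real (card (?S k k')) < e * (real c)\<^sup>2" if "k < K" "k' < K" for k k'
      proof (rule ccontr)
        assume "\<not> ?thesis"
        then obtain P Q where PQ: "P \<subseteq> R" "Q \<subseteq> R" "card P = s" "card Q = s" "\<forall>x\<in>P. \<forall>q\<in>Q. adj (v x k) (v q k')"
          using D0[rule_format, of R R "real c" "\<lambda>t t'. adj (v t k) (v t' k')"] fR c cl by auto
        have "card ((\<lambda>t. v t k) ` P) = s" "card ((\<lambda>t. v t k') ` Q) = s"
          using PQ(1-4) R(1) inj that inj_on_subset[of "\<lambda>t. v t k" T P] inj_on_subset[of "\<lambda>t. v t k'" T Q]
          by (auto simp: card_image)
        then show False
          using biclique_freeD(3)[OF free, of "(\<lambda>t. v t k) ` P" "(\<lambda>t. v t k') ` Q"] PQ by auto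
      qed
      have "R \<times> R \<subseteq> (\<lambda>t. (t, t)) ` R \<union> (\<Union>(k, k')\<in>{..<K} \<times> {..<K}. ?S k k')"
      proof clarify
        fix t t' assume t: "t \<in> R" "t' \<in> R" "(t, t') \<notin> (\<Union>(k, k')\<in>{..<K} \<times> {..<K}. ?S k k')"
        then have "\<not> (\<exists>k<K. \<exists>k'<K. adj (v t k) (v t' k'))" by auto
        then have "t = t'" using cl t E unfolding clique_def by metis
        then show "(t, t') \<in> (\<lambda>t. (t, t)) ` R" using t by simp
      qed
      then have "card (R \<times> R) \<le> card ((\<lambda>t. (t, t)) ` R \<union> (\<Union>(k, k')\<in>{..<K} \<times> {..<K}. ?S k k'))"
        using fR by (intro card_mono) (auto intro: finite_subset[of _ "R \<times> R"])
      also have "\<dots> \<le> card ((\<lambda>t. (t, t)) ` R) + card (\<Union>(k, k')\<in>{..<K} \<times> {..<K}. ?S k k')"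
        by (rule card_Un_le)
      also have "\<dots> \<le> c + (\<Sum>(k, k')\<in>{..<K} \<times> {..<K}. card (?S k k'))"
        using card_image_le[OF fR, of "\<lambda>t. (t, t)"] cl
          card_UN_le[of "{..<K} \<times> {..<K}" "\<lambda>(k, k'). ?S k k'"] by (auto simp: case_prod_unfold)
      finally have "c * c \<le> c + (\<Sum>(k, k')\<in>{..<K} \<times> {..<K}. card (?S k k'))"
        using cl by (simp add: card_cartesian_product)
      then have "real (c * c) \<le> real (c + (\<Sum>(k, k')\<in>{..<K} \<times> {..<K}. card (?S k k')))"
        by (rule of_nat_mono)
      also have "\<dots> = real c + (\<Sum>(k, k')\<in>{..<K} \<times> {..<K}. real (card (?S k k')))"
        by (simp add: case_prod_unfold)
      also have "\<dots> \<le> real c + (\<Sum>(k, k')\<in>{..<K} \<times> {..<K}. e * (real c)\<^sup>2)"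
        using small by (intro add_left_mono sum_mono) (auto intro: less_imp_le)
      also have "\<dots> = real c + (real K)\<^sup>2 * e * (real c)\<^sup>2"
        by (simp add: case_prod_unfold power2_eq_square)
      finally have "real c * real c \<le> real c + (real K)\<^sup>2 * e * (real c)\<^sup>2" by simp
      then have "real c * real c \<le> real c * (1 + (real K)\<^sup>2 * e * real c)"
        by (simp add: power2_eq_square algebra_simps)
      moreover have c0: "real c > 0" unfolding c_def by simp
      ultimately have "real c \<le> 1 + (real K)\<^sup>2 * e * real c" by simp
      then have "real c * (1 - (real K)\<^sup>2 * e) \<le> 1" by (simp add: algebra_simps)
      moreover have "1 < real c * (1 / 2 - (real K)\<^sup>2 * e)" using c(2) eK by (simp add: field_simps)
      moreover have "real c * (1 / 2 - (real K)\<^sup>2 * e) \<le> real c * (1 - (real K)\<^sup>2 * e)"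
        using c0 by (intro mult_left_mono) auto
      ultimately show False by linarith
    qed
    then have "card R = m" "\<And>t t'. t \<in> R \<Longrightarrow> t' \<in> R \<Longrightarrow> t \<noteq> t' \<Longrightarrow> {t, t'} \<notin> E"
      using R(2) unfolding indep_def by auto
    then show ?thesis using R(1) unfolding E by (intro exI[of _ R]) simp
  qed
  show ?thesis by (intro exI[of _ M] allI impI) (rule main)
qed

section \<open>Induced powers of spiders\<close>

text \<open>In the notation of the spider graph, \<open>p\<close> is the pendant vertex, \<open>ob\<close> the outer vertices, \<open>c\<close> the
  centre and \<open>a\<close> the inner vertices.\<close>

definition induced_spider ::
  "('a \<Rightarrow> 'a \<Rightarrow> bool) \<Rightarrow> nat \<Rightarrow> 'a \<Rightarrow> (nat \<Rightarrow> 'a) \<Rightarrow> 'a \<Rightarrow> (nat \<Rightarrow> 'a) \<Rightarrow> bool" where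
  "induced_spider adj r p ob c a \<longleftrightarrow> adj p c \<and>
     (\<forall>j<r. adj c (a j) \<and> adj (a j) (ob j) \<and>
        \<not> conflict adj p (a j) \<and> \<not> conflict adj p (ob j) \<and> \<not> conflict adj c (ob j)) \<and>
     (\<forall>i<r. \<forall>j<r. i \<noteq> j \<longrightarrow>
        \<not> conflict adj (a i) (a j) \<and> \<not> conflict adj (a i) (ob j) \<and> \<not> conflict adj (ob i) (ob j))"

text \<open>The sides are part of the notion: the pendant and the inner vertices lie in
  \<open>Y\<close>, the outer vertices and the centres in \<open>X\<close>. The roots
  \<open>p\<close> and \<open>ob\<close> are shared by all copies, and their conflicts are excluded
  within each spider; the last clause separates the remaining vertices of different copies.\<close>

definition induced_power :: "('a \<Rightarrow> 'a \<Rightarrow> bool) \<Rightarrow> nat \<Rightarrow> nat \<Rightarrow> 'a set \<Rightarrow> 'a set \<Rightarrow> bool" where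
  "induced_power adj r l X Y \<longleftrightarrow> (\<exists>p ob c a. p \<in> Y \<and> (\<forall>j<r. ob j \<in> X) \<and>
     (\<forall>i<l. c i \<in> X \<and> (\<forall>j<r. a i j \<in> Y) \<and> induced_spider adj r p ob (c i) (a i)) \<and>
     (\<forall>i<l. \<forall>i'<l. i \<noteq> i' \<longrightarrow> \<not> conflict adj (c i) (c i') \<and>
        (\<forall>j<r. \<not> conflict adj (c i) (a i' j)) \<and>
        (\<forall>j<r. \<forall>j'<r. \<not> conflict adj (a i j) (a i' j'))))"

text \<open>As the leaves are common to all spiders, only the centre and the \<open>r\<close> inner
  vertices have to be separated between copies. They form a tuple of length \<open>r + 1\<close>,
  injective in every position by disjointness, so Ramsey provides \<open>l\<close> tuples without
  edges between them. A centre and an inner vertex of different copies are distinct because they lie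
  on different sides.\<close>

lemma induced_power_of_disjoint_spiders:
  shows "\<exists>M :: nat. \<forall>(adj :: 'a \<Rightarrow> 'a \<Rightarrow> bool) X Y p ob T. biclique_free s adj \<longrightarrow> X \<inter> Y = {} \<longrightarrow>
      p \<in> Y \<longrightarrow> (\<forall>j<r. ob j \<in> X) \<longrightarrow> finite T \<longrightarrow> M \<le> card T \<longrightarrow>
      (\<forall>(c, a)\<in>T. c \<in> X \<and> (\<forall>j<r. a j \<in> Y) \<and> induced_spider adj r p ob c a) \<longrightarrow>
      (\<forall>t\<in>T. \<forall>t'\<in>T. t \<noteq> t' \<longrightarrow> fst t \<noteq> fst t' \<and> (\<forall>i<r. \<forall>j<r. snd t i \<noteq> snd t' j)) \<longrightarrow>
      induced_power adj r l X Y"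
proof -
  obtain M :: nat where M: "\<forall>(adj :: 'a \<Rightarrow> 'a \<Rightarrow> bool) (v :: 'a \<times> (nat \<Rightarrow> 'a) \<Rightarrow> nat \<Rightarrow> 'a) T. biclique_free s adj \<longrightarrow>
      finite T \<longrightarrow> M \<le> card T \<longrightarrow> (\<forall>k<Suc r. inj_on (\<lambda>t. v t k) T) \<longrightarrow>
      (\<exists>T'\<subseteq>T. card T' = l \<and>
         (\<forall>t\<in>T'. \<forall>t'\<in>T'. t \<noteq> t' \<longrightarrow> (\<forall>k<Suc r. \<forall>k'<Suc r. \<not> adj (v t k) (v t' k'))))"
    using nonadjacent_tuples[of s "Suc r" l] by (elim exE) (rule that)
  have main: "induced_power adj r l X Y"
    if free: "biclique_free s adj" and XY: "X \<inter> Y = {}" and p: "p \<in> Y" and ob: "\<forall>j<r. ob j \<in> X"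
      and T: "finite T" "M \<le> card T"
      and spider: "\<forall>(c, a)\<in>T. c \<in> X \<and> (\<forall>j<r. a j \<in> Y) \<and> induced_spider adj r p ob c a"
      and disj: "\<forall>t\<in>T. \<forall>t'\<in>T. t \<noteq> t' \<longrightarrow> fst t \<noteq> fst t' \<and> (\<forall>i<r. \<forall>j<r. snd t i \<noteq> snd t' j)"
    for adj :: "'a \<Rightarrow> 'a \<Rightarrow> bool" and X Y p ob T
  proof -
    \<comment> \<open>Position \<open>r\<close> holds the centre, the positions below
      \<open>r\<close> the inner vertices.\<close>
    define v where "v = (\<lambda>(t :: 'a \<times> (nat \<Rightarrow> 'a)) k. if k = r then fst t else snd t k)"
    have "inj_on (\<lambda>t. v t k) T" if "k < Suc r" for k
    proof (rule inj_onI, rule ccontr)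
      fix t t' assume t: "t \<in> T" "t' \<in> T" "v t k = v t' k" "t \<noteq> t'"
      from disj[rule_format, OF t(1,2,4)] t(3) that show False
        unfolding v_def by (cases "k = r") auto
    qed
    then obtain T' where T': "T' \<subseteq> T" "card T' = l"
      and non: "\<And>t t' k k'. \<lbrakk>t \<in> T'; t' \<in> T'; t \<noteq> t'; k < Suc r; k' < Suc r\<rbrakk> \<Longrightarrow> \<not> adj (v t k) (v t' k')"
      using M[rule_format, of adj T v] free T by metis
    have "finite T'" using T' T finite_subset by blast
    then obtain h where h: "bij_betw h {0..<l} T'"
      using ex_bij_betw_nat_finite T' by metis
    have hT: "h i \<in> T'" "h i \<in> T" if "i < l" for i
      using h that T' unfolding bij_betw_def by auto
    have hne: "h i \<noteq> h i'" if "i < l" "i' < l" "i \<noteq> i'" for i i'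
      using h that unfolding bij_betw_def inj_on_def by auto
    have sp: "fst (h i) \<in> X" "\<forall>j<r. snd (h i) j \<in> Y" "induced_spider adj r p ob (fst (h i)) (snd (h i))"
      if "i < l" for i
      using spider hT(2)[OF that] by (auto simp: case_prod_unfold)
    have nc: "\<not> conflict adj (fst (h i)) (fst (h i'))"
      "\<And>j. j < r \<Longrightarrow> \<not> conflict adj (fst (h i)) (snd (h i') j)"
      "\<And>j j'. j < r \<Longrightarrow> j' < r \<Longrightarrow> \<not> conflict adj (snd (h i) j) (snd (h i') j')"
      if "i < l" "i' < l" "i \<noteq> i'" for i i'
    proof -
      note n = non[OF hT(1)[OF that(1)] hT(1)[OF that(2)] hne[OF that]]
      note d = disj[rule_format, OF hT(2)[OF that(1)] hT(2)[OF that(2)] hne[OF that]]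
      show "\<not> conflict adj (fst (h i)) (fst (h i'))"
        using n[of r r] d unfolding conflict_def v_def by simp
      show "\<not> conflict adj (fst (h i)) (snd (h i') j)" if "j < r" for j
        using n[of r j] that sp(1)[OF \<open>i < l\<close>] sp(2)[OF \<open>i' < l\<close>] XY unfolding conflict_def v_def by auto
      show "\<not> conflict adj (snd (h i) j) (snd (h i') j')" if "j < r" "j' < r" for j j'
        using n[of j j'] d that unfolding conflict_def v_def by auto
    qed
    show ?thesis
      unfolding induced_power_def
      by (intro exI[of _ p] exI[of _ ob] exI[of _ "\<lambda>i. fst (h i)"] exI[of _ "\<lambda>i. snd (h i)"] conjI allI impI)
        (simp_all add: p ob sp nc)
  qed
  show ?thesis by (intro exI[of _ M] allI impI) (rule main)
qed

section \<open>The power of the spider as an explicit graph, and its induced copies\<close>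

lemma edges_rooted_power_spider_plus:
  assumes "r \<ge> 1"
  shows "edges (rooted_power (spider_plus r) (leaves (spider_plus r)) l) =
    (\<Union>i<l. insert {Inr (i, Centre), Inl Pendant}
       ((\<lambda>j. {Inr (i, Centre), Inr (i, Inner j)}) ` {..<r} \<union> (\<lambda>j. {Inr (i, Inner j), Inl (Outer j)}) ` {..<r}))"
proof -
  have "edges (spider_plus r) = insert {Centre, Pendant}
      ((\<lambda>j. {Centre, Inner j}) ` {..<r} \<union> (\<lambda>j. {Inner j, Outer j}) ` {..<r})"
    by (auto simp: spider_plus_def spider_def star_def)
  then show ?thesis
    unfolding rooted_power_def leaves_spider_plus[OF assms]
    by (simp add: image_Un image_image copy_vertex_def image_iff)
qed

lemma verts_rooted_power_spider_plus:
  assumes "r \<ge> 1" "l \<ge> 1"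
  shows "verts (rooted_power (spider_plus r) (leaves (spider_plus r)) l) =
    insert (Inl Pendant) ((\<lambda>j. Inl (Outer j)) ` {..<r} \<union> (\<lambda>i. Inr (i, Centre)) ` {..<l} \<union>
      (\<lambda>(i, j). Inr (i, Inner j)) ` ({..<l} \<times> {..<r}))"
proof -
  have "verts (spider_plus r) = insert Pendant (insert Centre (Inner ` {..<r} \<union> Outer ` {..<r}))"
    by (auto simp: spider_plus_def spider_def star_def)
  then have "copy_vertex (insert Pendant (Outer ` {..<r})) i ` verts (spider_plus r) =
      insert (Inl Pendant) (insert (Inr (i, Centre))
        ((\<lambda>j. Inr (i, Inner j)) ` {..<r} \<union> (\<lambda>j. Inl (Outer j)) ` {..<r}))" for i
    by (auto simp: copy_vertex_def image_iff)
  then have "verts (rooted_power (spider_plus r) (leaves (spider_plus r)) l) =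
     (\<Union>i<l. insert (Inl Pendant) (insert (Inr (i, Centre))
        ((\<lambda>j. Inr (i, Inner j)) ` {..<r} \<union> (\<lambda>j. Inl (Outer j)) ` {..<r})))"
    unfolding rooted_power_def leaves_spider_plus[OF assms(1)] by simp
  also have "\<dots> = insert (Inl Pendant) ((\<lambda>j. Inl (Outer j)) ` {..<r} \<union> (\<lambda>i. Inr (i, Centre)) ` {..<l} \<union>
      (\<lambda>(i, j). Inr (i, Inner j)) ` ({..<l} \<times> {..<r}))"
    using assms(2) by (auto simp: Suc_le_eq)
  finally show ?thesis .
qed

lemma isomorphic_image:
  assumes "inj_on g (verts H)" "\<And>e. e \<in> edges H \<Longrightarrow> e \<subseteq> verts H"
  shows "isomorphic (g ` verts H, (\<lambda>e. g ` e) ` edges H) H"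
proof -
  let ?f = "inv_into (verts H) g"
  have "bij_betw ?f (g ` verts H) (verts H)"
    using assms(1) by (simp add: bij_betw_inv_into inj_on_imp_bij_betw)
  moreover have "?f ` (g ` e) = e" if "e \<in> edges H" for e
    using assms that by (simp add: inv_into_image_cancel)
  then have "(\<lambda>e. ?f ` e) ` (\<lambda>e. g ` e) ` edges H = edges H"
    by (simp add: image_image)
  ultimately show ?thesis unfolding isomorphic_def by auto
qed

text \<open>Everything rests on the claim \<open>key\<close>: vertices of the power with conflicting
  images are equal or adjacent. For equal images this gives injectivity, since an edge would be
  mapped to a loop; for adjacent images it gives inducedness.\<close>

lemma induced_power_copy:
  assumes G: "simple_graph G" and XY: "X \<union> Y = verts G" "X \<inter> Y = {}" and r: "r \<ge> 1" and l: "l \<ge> 1"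
    and pow: "induced_power (\<lambda>u v. {u, v} \<in> edges G) r l X Y"
  shows "\<exists>S. subgraph S (between G X Y) \<and>
    isomorphic S (rooted_power (spider_plus r) (leaves (spider_plus r)) l) \<and> induced_subgraph S G"
proof -
  define adj where "adj = (\<lambda>u v. {u, v} \<in> edges G)"
  have sym: "adj u v \<longleftrightarrow> adj v u" for u v unfolding adj_def by (simp add: insert_commute)
  obtain p ob c a where p: "p \<in> Y" and ob: "\<forall>j<r. ob j \<in> X"
    and ca0: "\<forall>i<l. c i \<in> X \<and> (\<forall>j<r. a i j \<in> Y) \<and> induced_spider adj r p ob (c i) (a i)"
    and non: "\<forall>i<l. \<forall>i'<l. i \<noteq> i' \<longrightarrow> \<not> conflict adj (c i) (c i') \<and>
        (\<forall>j<r. \<not> conflict adj (c i) (a i' j)) \<and>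
        (\<forall>j<r. \<forall>j'<r. \<not> conflict adj (a i j) (a i' j'))"
    using pow unfolding induced_power_def adj_def[symmetric] by (elim exE conjE) (rule that)
  have c: "c i \<in> X" and a: "j < r \<Longrightarrow> a i j \<in> Y" and sp: "induced_spider adj r p ob (c i) (a i)"
    if "i < l" for i j
    using ca0 that by auto
  have cc: "\<not> conflict adj (c i) (c i')" and ca: "j < r \<Longrightarrow> \<not> conflict adj (c i) (a i' j)"
    and aa: "j < r \<Longrightarrow> j' < r \<Longrightarrow> \<not> conflict adj (a i j) (a i' j')"
    if "i < l" "i' < l" "i \<noteq> i'" for i i' j j'
    using non that by auto
  have pc: "adj p (c i)" if "i < l" for i using sp[OF that] unfolding induced_spider_def by blast
  have e: "adj (c i) (a i j)" "adj (a i j) (ob j)" "\<not> conflict adj p (a i j)" "\<not> conflict adj p (ob j)"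
    "\<not> conflict adj (c i) (ob j)" if "i < l" "j < r" for i j
    using sp[OF that(1)] that(2) unfolding induced_spider_def by blast+
  have n: "\<not> conflict adj (a i j) (a i j')" "\<not> conflict adj (a i j) (ob j')" "\<not> conflict adj (ob j) (ob j')"
    if "i < l" "j < r" "j' < r" "j \<noteq> j'" for i j j'
    using sp[OF that(1)] that(2-) unfolding induced_spider_def by blast+
  define H where "H = rooted_power (spider_plus r) (leaves (spider_plus r)) l"
  note vH = verts_rooted_power_spider_plus[OF r l, folded H_def]
  note eH = edges_rooted_power_spider_plus[OF r, of l, folded H_def]
  \<comment> \<open>On the vertices of \<open>H\<close> the default branches are reached only by
    \<open>Pendant\<close> and by \<open>Centre\<close>.\<close>
  define g :: "spider_vertex + nat \<times> spider_vertex \<Rightarrow> 'a" where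
    "g = (\<lambda>x. case x of Inl w \<Rightarrow> (case w of Outer j \<Rightarrow> ob j | _ \<Rightarrow> p)
            | Inr (i, w) \<Rightarrow> (case w of Inner j \<Rightarrow> a i j | _ \<Rightarrow> c i))"
  have g: "g (Inl Pendant) = p" "g (Inl (Outer j)) = ob j" "g (Inr (i, Centre)) = c i" "g (Inr (i, Inner j)) = a i j"
    for i j unfolding g_def by auto
  have gX: "g x \<in> verts G" if "x \<in> verts H" for x
    using that p ob c a XY unfolding vH by (auto simp: g)
  have self: "\<not> adj u u" for u
  proof
    assume "adj u u"
    then have "card {u, u} = 2" using G unfolding simple_graph_def adj_def by blast
    then show False by simp
  qed
  have csym: "conflict adj u v \<longleftrightarrow> conflict adj v u" for u v unfolding conflict_def using sym by auto
  have l0: "0 < l" using l by simp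
  have E: "{Inr (i, Centre), Inl Pendant} \<in> edges H" "{Inl Pendant, Inr (i, Centre)} \<in> edges H"
    "j < r \<Longrightarrow> {Inr (i, Centre), Inr (i, Inner j)} \<in> edges H"
    "j < r \<Longrightarrow> {Inr (i, Inner j), Inr (i, Centre)} \<in> edges H"
    "j < r \<Longrightarrow> {Inr (i, Inner j), Inl (Outer j)} \<in> edges H"
    "j < r \<Longrightarrow> {Inl (Outer j), Inr (i, Inner j)} \<in> edges H" if "i < l" for i j
    using that unfolding eH by (auto simp: doubleton_eq_iff)
  have no: "\<not> conflict adj p (a i j)" "\<not> conflict adj (c i) (ob j)"
      "\<not> conflict adj (a i j) p" "\<not> conflict adj (ob j) (c i)"
    if "i < l" "j < r" for i j
    using e(3-5)[OF that] csym by blast+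
  \<comment> \<open>Relations among the roots alone are recorded inside the individual spiders; they
    are read off from copy \<open>0\<close>, which exists because \<open>l \<ge> 1\<close>.\<close>
  have no': "\<not> conflict adj p (ob j)" "\<not> conflict adj (ob j) p" if "j < r" for j
    using e(4)[OF l0 that] csym by blast+
  have obob: "j = j'" if "conflict adj (ob j) (ob j')" "j < r" "j' < r" for j j'
    using n(3)[OF l0 that(2,3)] that(1) by blast
  have aob: "j = j'" if "conflict adj (a i j) (ob j')" "i < l" "j < r" "j' < r" for i j j'
    using n(2)[OF that(2-4)] that(1) by blast
  have oba: "j = j'" if "conflict adj (ob j') (a i j)" "i < l" "j < r" "j' < r" for i j j'
    using n(2)[OF that(2-4)] that(1) csym by blast
  have cc': "i = i'" if "conflict adj (c i) (c i')" "i < l" "i' < l" for i i'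
    using cc that by blast
  have ca': "i = i'" if "conflict adj (c i) (a i' j)" "i < l" "i' < l" "j < r" for i i' j
    using ca that by blast
  have ac': "i = i'" if "conflict adj (a i' j) (c i)" "i < l" "i' < l" "j < r" for i i' j
    using ca that csym by blast
  have aa': "i = i' \<and> j = j'" if "conflict adj (a i j) (a i' j')" "i < l" "i' < l" "j < r" "j' < r" for i i' j j'
    using aa n(1) that by blast
  have key: "x = y \<or> {x, y} \<in> edges H" if "x \<in> verts H" "y \<in> verts H" "conflict adj (g x) (g y)" for x y
  proof -
    have V: "z = Inl Pendant \<or> (\<exists>j<r. z = Inl (Outer j)) \<or> (\<exists>i<l. z = Inr (i, Centre)) \<or> (\<exists>i<l. \<exists>j<r. z = Inr (i, Inner j))"
      if "z \<in> verts H" for z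
      using that unfolding vH by auto
    show ?thesis
      using V[OF that(1)] V[OF that(2)] that(3)
      by (elim disjE exE conjE; auto simp: g no no' E dest: obob aob oba cc' ca' ac' aa')
  qed
  have edge: "adj (g x) (g y)" if "{x, y} \<in> edges H" for x y
    using that pc e(1,2) sym unfolding eH by (auto simp: doubleton_eq_iff g)
  have eHv: "e \<subseteq> verts H" if "e \<in> edges H" for e
    using that unfolding eH vH by auto
  have card2: "\<exists>x y. e = {x, y} \<and> x \<noteq> y \<and> x \<in> verts H \<and> y \<in> verts H" if "e \<in> edges H" for e
    using that eHv[OF that] unfolding eH by auto
  have "inj_on g (verts H)"
  proof (rule inj_onI)
    fix x y assume xy: "x \<in> verts H" "y \<in> verts H" "g x = g y"
    then have "x = y \<or> {x, y} \<in> edges H" using key unfolding conflict_def by blast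
    then show "x = y" using edge[of x y] self xy by auto
  qed
  define S where "S = (g ` verts H, (\<lambda>e. g ` e) ` edges H)"
  have "isomorphic S H" unfolding S_def using \<open>inj_on g (verts H)\<close> eHv by (rule isomorphic_image)
  moreover have fS: "finite (verts S)" unfolding S_def vH by simp
  have eS: "edges S = {e \<in> edges G. e \<subseteq> verts S}"
  proof (intro equalityI subsetI)
    fix f assume "f \<in> edges S"
    then obtain x y where "{x, y} \<in> edges H" "f = g ` {x, y}" "x \<in> verts H" "y \<in> verts H"
      unfolding S_def using card2 by fastforce
    then show "f \<in> {e \<in> edges G. e \<subseteq> verts S}"
      using edge[of x y] unfolding S_def adj_def by auto
  next
    fix f assume f: "f \<in> {e \<in> edges G. e \<subseteq> verts S}"
    then have "card f = 2" using G unfolding simple_graph_def by auto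
    then obtain u v where uv: "f = {u, v}" "u \<noteq> v" by (auto simp: card_2_iff)
    then obtain x y where xy: "x \<in> verts H" "y \<in> verts H" "u = g x" "v = g y"
      using f unfolding S_def by auto
    then have "{x, y} \<in> edges H" using key[of x y] f uv unfolding conflict_def adj_def by auto
    moreover have "f = g ` {x, y}" using uv xy by simp
    ultimately show "f \<in> edges S" unfolding S_def snd_conv by blast
  qed
  moreover have vS: "verts S \<subseteq> verts G" unfolding S_def using gX by auto
  moreover have "edges S \<subseteq> edges (between G X Y)"
  proof
    fix f assume f: "f \<in> edges S"
    then obtain e0 where e0: "e0 \<in> edges H" "f = g ` e0" unfolding S_def by auto
    then have "\<exists>x\<in>X. \<exists>y\<in>Y. f = {x, y}"
      unfolding eH
    proof (elim UN_E insertE UnE imageE)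
      fix i assume "i \<in> {..<l}" "e0 = {Inr (i, Centre), Inl Pendant}" "f = g ` e0"
      then show ?thesis using p c by (intro bexI[of _ "c i"] bexI[of _ p]) (auto simp: g)
    next
      fix i j assume "i \<in> {..<l}" "j \<in> {..<r}" "e0 = {Inr (i, Centre), Inr (i, Inner j)}" "f = g ` e0"
      then show ?thesis using a c by (intro bexI[of _ "c i"] bexI[of _ "a i j"]) (auto simp: g)
    next
      fix i j assume "i \<in> {..<l}" "j \<in> {..<r}" "e0 = {Inr (i, Inner j), Inl (Outer j)}" "f = g ` e0"
      then show ?thesis using a ob by (intro bexI[of _ "ob j"] bexI[of _ "a i j"]) (auto simp: g)
    qed
    then show "f \<in> edges (between G X Y)" using f eS unfolding between_def by auto
  qed
  moreover have "simple_graph S"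
    using fS eS G unfolding simple_graph_def by auto
  ultimately have "subgraph S (between G X Y)" "induced_subgraph S G" "isomorphic S H"
    using XY unfolding subgraph_def induced_subgraph_def between_def by auto
  then show ?thesis unfolding H_def by blast
qed

lemma biclique_free_of_Kss_free:
  assumes G: "simple_graph G" and K: "Kss_free s G"
  shows "biclique_free s (\<lambda>u v. {u, v} \<in> edges G)"
proof -
  have irr: "{u, v} \<in> edges G \<Longrightarrow> u \<noteq> v \<and> u \<in> verts G \<and> v \<in> verts G" for u v
    using G unfolding simple_graph_def by force
  have False if PQ: "card P = s" "card Q = s" "\<forall>p\<in>P. \<forall>q\<in>Q. {p, q} \<in> edges G" for P Q
  proof (cases "s = 0")
    case True
    \<comment> \<open>The complete bipartite graph with empty sides is contained in every graph, so
      \<open>Kss_free 0 G\<close> is contradictory.\<close>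
    have "subgraph ({}, {}) G" unfolding subgraph_def simple_graph_def by auto
    moreover have "isomorphic ({}, {}) (complete_bipartite s s)"
      unfolding isomorphic_def complete_bipartite_def using True by (auto simp: bij_betw_def)
    ultimately show False using K unfolding Kss_free_def by blast
  next
    case False
    then have "finite P" "finite Q" using PQ card.infinite by fastforce+
    then obtain f h where f: "bij_betw f {0..<s} P" and h: "bij_betw h {0..<s} Q"
      using ex_bij_betw_nat_finite PQ by metis
    define g where "g = (\<lambda>x. case x of Inl i \<Rightarrow> f i | Inr i \<Rightarrow> h i)"
    let ?K = "complete_bipartite s s"
    have fP: "i < s \<Longrightarrow> f i \<in> P" and hQ: "i < s \<Longrightarrow> h i \<in> Q" for i
      using f h unfolding bij_betw_def by auto
    have "f i \<noteq> h j" if "i < s" "j < s" for i j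
      using fP[OF that(1)] hQ[OF that(2)] PQ(3) irr[of "f i" "h j"] by auto
    then have "inj_on g (verts ?K)"
      using inj_onD[OF bij_betw_imp_inj_on[OF f]] inj_onD[OF bij_betw_imp_inj_on[OF h]]
      unfolding complete_bipartite_def g_def
      by (intro inj_onI) (fastforce split: sum.splits)
    then have "isomorphic (g ` verts ?K, (\<lambda>e. g ` e) ` edges ?K) ?K"
      by (rule isomorphic_image) (auto simp: complete_bipartite_def)
    moreover have "subgraph (g ` verts ?K, (\<lambda>e. g ` e) ` edges ?K) G"
    proof -
      have "e \<in> edges G" if "e \<in> (\<lambda>e. g ` e) ` edges ?K" for e
        using that fP hQ PQ unfolding complete_bipartite_def g_def by auto
      moreover have "e \<subseteq> g ` verts ?K" if "e \<in> (\<lambda>e. g ` e) ` edges ?K" for e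
        using that unfolding complete_bipartite_def by auto
      moreover have "g ` verts ?K \<subseteq> verts G"
        using fP hQ PQ(3) irr False unfolding complete_bipartite_def g_def by (auto) (metis not_gr_zero)+
      moreover have "finite (g ` verts ?K)" unfolding complete_bipartite_def by auto
      ultimately show ?thesis using G unfolding subgraph_def simple_graph_def by auto
    qed
    ultimately show False using K unfolding Kss_free_def by blast
  qed
  moreover have "symp (\<lambda>u v. {u, v} \<in> edges G)" by (auto simp: symp_def insert_commute)
  moreover have "irreflp (\<lambda>u v. {u, v} \<in> edges G)" using irr by (intro irreflpI) blast
  ultimately show ?thesis unfolding biclique_free_def by blast
qed

section \<open>Counting spiders\<close>

text \<open>The numbers \<open>n\<close> and \<open>D\<close> are mere upper bounds and
  \<open>E\<close> is any set of adjacent pairs across the two sides. The locale therefore survives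
  passing to a subset of \<open>E\<close> with the same parameters; how dense \<open>E\<close> is
  appears as a separate hypothesis where it matters. Pairs are oriented from \<open>X\<close> to
  \<open>Y\<close>, so that the converse relation exchanges the sides.\<close>

locale bipartite_host =
  fixes adj :: "'a \<Rightarrow> 'a \<Rightarrow> bool" and X Y :: "'a set" and E :: "('a \<times> 'a) set" and n D :: real
  assumes finite_parts: "finite X" "finite Y" and disjoint_parts: "X \<inter> Y = {}"
    and edges_parts: "E \<subseteq> X \<times> Y" and edges_adj: "\<And>x y. (x, y) \<in> E \<Longrightarrow> adj x y"
    and card_parts: "real (card X) \<le> n" "real (card Y) \<le> n" and n_pos: "0 < n" and D_pos: "0 < D"
    and degree_left: "\<And>x. real (card (E `` {x})) \<le> D"
    and degree_right: "\<And>y. real (card (E\<inverse> `` {y})) \<le> D"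
begin

lemma finite_edges: "finite E"
  using edges_parts finite_parts finite_subset by blast

lemma finite_nbrs [simp]: "finite (E `` {x})" "finite (E\<inverse> `` {y})"
  using finite_edges by (auto intro: finite_Image)

lemma card_edges: "real (card E) \<le> n * D"
proof -
  have "E = Sigma X (\<lambda>x. E `` {x})" using edges_parts by auto
  then have "real (card E) = real (card (Sigma X (\<lambda>x. E `` {x})))" by simp
  also have "\<dots> \<le> real (card X) * D"
    using finite_parts degree_left by (intro card_Sigma_le_real) auto
  also have "\<dots> \<le> n * D" using card_parts D_pos by (intro mult_right_mono) auto
  finally show ?thesis .
qed

end

lemma bipartite_host_converse:
  assumes "bipartite_host adj X Y E n D" "biclique_free s adj"
  shows "bipartite_host adj Y X (E\<inverse>) n D"
  using assms biclique_freeD(1)[OF assms(2)] unfolding bipartite_host_def by auto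

lemma bipartite_host_subset:
  assumes "bipartite_host adj X Y E n D" "E' \<subseteq> E"
  shows "bipartite_host adj X Y E' n D"
proof -
  interpret bipartite_host adj X Y E n D by fact
  have "real (card (E' `` {x})) \<le> D" for x
    using assms(2) card_mono[of "E `` {x}" "E' `` {x}"] degree_left[of x] by (force intro: order_trans)
  moreover have "real (card (E'\<inverse> `` {x})) \<le> D" for x
    using assms(2) card_mono[of "E\<inverse> `` {x}" "E'\<inverse> `` {x}"] degree_right[of x] by (force intro: order_trans)
  ultimately show ?thesis
    using assms(2) edges_parts edges_adj finite_parts disjoint_parts card_parts n_pos D_pos
    by unfold_locales auto
qed

text \<open>The ends \<open>p\<close> and \<open>q\<close> will be leaves of a spider,
  \<open>c\<close> its centre and \<open>a\<close> an inner vertex. Common neighbours are counted in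
  \<open>E\<close> and not in the whole graph, so lightness depends on the chosen edge set.\<close>

definition light_paths :: "('a \<times> 'a) set \<Rightarrow> nat \<Rightarrow> ('a \<times> 'a \<times> 'a \<times> 'a) set" where
  "light_paths E N = {(p, c, a, q). (c, p) \<in> E \<and> (c, a) \<in> E \<and> (q, a) \<in> E \<and>
     card (E `` {c} \<inter> E `` {q}) < N \<and> card (E\<inverse> `` {p} \<inter> E\<inverse> `` {a}) < N}"

text \<open>A function is determined by its values at \<open>i\<close> and \<open>j\<close> together
  with its restriction to the other \<open>r - 2\<close> indices.\<close>

lemma card_PiE_pair_le:
  assumes "finite W" "finite B" "i < r" "j < r" "i \<noteq> j"
  shows "card {f \<in> {..<r} \<rightarrow>\<^sub>E W. (f i, f j) \<in> B} \<le> card B * card W ^ (r - 2)"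
proof -
  let ?I = "{..<r} - {i, j}"
  let ?h = "\<lambda>f. ((f i, f j), restrict f ?I)"
  have "inj_on ?h {f \<in> {..<r} \<rightarrow>\<^sub>E W. (f i, f j) \<in> B}"
  proof (rule inj_onI, rule ext)
    fix f g x assume f: "f \<in> {f \<in> {..<r} \<rightarrow>\<^sub>E W. (f i, f j) \<in> B}" and g: "g \<in> {f \<in> {..<r} \<rightarrow>\<^sub>E W. (f i, f j) \<in> B}"
      and eq: "?h f = ?h g"
    consider "x = i" | "x = j" | "x \<in> ?I" | "x \<notin> {..<r}" by auto
    then show "f x = g x"
    proof cases
      case 3
      from eq have "restrict f ?I = restrict g ?I" by simp
      from fun_cong[OF this, of x] 3 show ?thesis by simp
    next
      case 4
      then show ?thesis using f g by (auto simp: PiE_def extensional_def)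
    qed (use eq in auto)
  qed
  moreover have "?h ` {f \<in> {..<r} \<rightarrow>\<^sub>E W. (f i, f j) \<in> B} \<subseteq> B \<times> (?I \<rightarrow>\<^sub>E W)"
    by (auto simp: PiE_def Pi_def)
  ultimately have "card {f \<in> {..<r} \<rightarrow>\<^sub>E W. (f i, f j) \<in> B} \<le> card (B \<times> (?I \<rightarrow>\<^sub>E W))"
    using assms by (intro card_inj_on_le) (auto intro!: finite_PiE)
  also have "\<dots> = card B * card W ^ card ?I"
    by (simp add: card_cartesian_product card_PiE)
  also have "card ?I = r - 2"
    using assms by (subst card_Diff_subset) auto
  finally show ?thesis .
qed

text \<open>Union bound: there are at least \<open>w ^ r\<close> functions, and each of at most
  \<open>r\<^sup>2\<close> ordered pairs of positions excludes at most \<open>b * u ^ r\<close> of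
  them.\<close>

lemma card_compatible_PiE_ge:
  fixes u b w :: real
  assumes W: "finite W" "real (card W) \<le> u" "w \<le> real (card W)" "0 \<le> w"
    and B: "finite B" "real (card B) \<le> b * u\<^sup>2" "0 \<le> b"
  shows "w ^ r - (real r)\<^sup>2 * b * u ^ r
    \<le> real (card {f \<in> {..<r} \<rightarrow>\<^sub>E W. \<forall>i<r. \<forall>j<r. i \<noteq> j \<longrightarrow> (f i, f j) \<notin> B})"
proof -
  let ?P = "{..<r} \<rightarrow>\<^sub>E W"
  let ?G = "{f \<in> ?P. \<forall>i<r. \<forall>j<r. i \<noteq> j \<longrightarrow> (f i, f j) \<notin> B}"
  let ?J = "{(i, j). i < r \<and> j < r \<and> i \<noteq> j}"
  let ?bad = "\<lambda>(i, j). {f \<in> ?P. (f i, f j) \<in> B}"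
  have u: "0 \<le> u" using W(2) by linarith
  have J: "?J \<subseteq> {..<r} \<times> {..<r}" by auto
  then have fJ: "finite ?J" using finite_subset by blast
  have cJ: "real (card ?J) \<le> (real r)\<^sup>2"
    using card_mono[OF _ J] by (simp add: card_cartesian_product power2_eq_square flip: of_nat_mult)
  have fP: "finite ?P" using W by (auto intro: finite_PiE)
  have one: "real (card (?bad t)) \<le> b * u ^ r" if "t \<in> ?J" for t
  proof -
    obtain i j where t: "t = (i, j)" "i < r" "j < r" "i \<noteq> j" using \<open>t \<in> ?J\<close> by auto
    have "real (card (?bad t)) \<le> real (card B * card W ^ (r - 2))"
      using card_PiE_pair_le[OF W(1) B(1) t(2-)] t(1) by (simp del: of_nat_mult)
    also have "\<dots> \<le> (b * u\<^sup>2) * u ^ (r - 2)"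
      using B W u by (auto intro!: mult_mono power_mono)
    also have "\<dots> = b * u ^ (2 + (r - 2))" by (simp add: power_add power2_eq_square)
    also have "2 + (r - 2) = r" using t by linarith
    finally show ?thesis .
  qed
  have "card ?P \<le> card (?G \<union> (\<Union>t\<in>?J. ?bad t))"
    using fP fJ by (intro card_mono) auto
  also have "\<dots> \<le> card ?G + (\<Sum>t\<in>?J. card (?bad t))"
    using card_Un_le[of ?G "\<Union>t\<in>?J. ?bad t"] card_UN_le[OF fJ, of ?bad] by linarith
  finally have "real (card ?P) \<le> real (card ?G) + (\<Sum>t\<in>?J. real (card (?bad t)))"
    by (simp flip: of_nat_sum of_nat_add)
  also have "(\<Sum>t\<in>?J. real (card (?bad t))) \<le> (\<Sum>t\<in>?J. b * u ^ r)"
    by (intro sum_mono one)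
  also have "\<dots> = real (card ?J) * (b * u ^ r)" by simp
  also have "\<dots> \<le> (real r)\<^sup>2 * (b * u ^ r)"
    using cJ B u by (intro mult_right_mono) auto
  finally have "real (card ?P) \<le> real (card ?G) + (real r)\<^sup>2 * (b * u ^ r)" by simp
  moreover have "w ^ r \<le> real (card ?P)"
    using W by (simp add: card_PiE power_mono)
  ultimately show ?thesis by (simp add: mult.assoc)
qed

context bipartite_host
begin

text \<open>Each conflicting pair lies in neighbourhoods of vertices that can be fixed beforehand:
  \<open>p, a\<close> in that of \<open>c\<close>, \<open>p, q\<close> in those of \<open>c\<close>
  and \<open>a\<close>, and \<open>c, q\<close> in that of \<open>a\<close>. In all three cases the
  remaining choices bring the count to \<open>e * n * D ^ 3\<close>.\<close>

lemma card_conflict_paths: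
  fixes e :: real
  assumes few: "\<And>P Q. \<lbrakk>finite P; finite Q; real (card P) \<le> D; real (card Q) \<le> D\<rbrakk> \<Longrightarrow>
      real (card (conflict_pairs adj P Q)) \<le> e * D\<^sup>2"
    and "0 \<le> e"
  shows "real (card {(p, c, a, q). (c, p) \<in> E \<and> (c, a) \<in> E \<and> (q, a) \<in> E \<and>
      (conflict adj p a \<or> conflict adj p q \<or> conflict adj c q)}) \<le> 3 * e * n * D ^ 3" (is "real (card ?A) \<le> _")
proof -
  let ?C = "conflict_pairs adj"
  define S1 where "S1 = Sigma X (\<lambda>c. Sigma (?C (E `` {c}) (E `` {c})) (\<lambda>(p, a). E\<inverse> `` {a}))"
  define S2 where "S2 = Sigma E (\<lambda>(c, a). ?C (E `` {c}) (E\<inverse> `` {a}))"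
  define S3 where "S3 = Sigma Y (\<lambda>a. Sigma (?C (E\<inverse> `` {a}) (E\<inverse> `` {a})) (\<lambda>(c, q). E `` {c}))"
  have fin: "finite S1" "finite S2" "finite S3"
    unfolding S1_def S2_def S3_def using finite_parts finite_edges by (auto intro!: finite_SigmaI)
  have eD: "0 \<le> e * D\<^sup>2" "0 \<le> e * D\<^sup>2 * D" using assms D_pos by auto
  have 1: "real (card S1) \<le> n * (e * D\<^sup>2 * D)"
  proof -
    have "real (card (Sigma (?C (E `` {c}) (E `` {c})) (\<lambda>(p, a). E\<inverse> `` {a}))) \<le> e * D\<^sup>2 * D" for c
    proof -
      have "real (card (Sigma (?C (E `` {c}) (E `` {c})) (\<lambda>(p, a). E\<inverse> `` {a}))) \<le> real (card (?C (E `` {c}) (E `` {c}))) * D"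
        using degree_right by (intro card_Sigma_le_real) auto
      also have "\<dots> \<le> e * D\<^sup>2 * D" using few degree_left D_pos by (intro mult_right_mono) auto
      finally show ?thesis .
    qed
    then have "real (card S1) \<le> real (card X) * (e * D\<^sup>2 * D)"
      unfolding S1_def using finite_parts by (intro card_Sigma_le_real) (auto intro!: finite_SigmaI)
    also have "\<dots> \<le> n * (e * D\<^sup>2 * D)" using card_parts eD by (intro mult_right_mono) auto
    finally show ?thesis .
  qed
  have 2: "real (card S2) \<le> n * D * (e * D\<^sup>2)"
  proof -
    have "real (card S2) \<le> real (card E) * (e * D\<^sup>2)"
      unfolding S2_def using finite_edges few degree_left degree_right by (intro card_Sigma_le_real) auto
    also have "\<dots> \<le> n * D * (e * D\<^sup>2)" using card_edges eD by (intro mult_right_mono) auto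
    finally show ?thesis .
  qed
  have 3: "real (card S3) \<le> n * (e * D\<^sup>2 * D)"
  proof -
    have "real (card (Sigma (?C (E\<inverse> `` {a}) (E\<inverse> `` {a})) (\<lambda>(c, q). E `` {c}))) \<le> e * D\<^sup>2 * D" for a
    proof -
      have "real (card (Sigma (?C (E\<inverse> `` {a}) (E\<inverse> `` {a})) (\<lambda>(c, q). E `` {c}))) \<le> real (card (?C (E\<inverse> `` {a}) (E\<inverse> `` {a}))) * D"
        using degree_left by (intro card_Sigma_le_real) auto
      also have "\<dots> \<le> e * D\<^sup>2 * D" using few degree_right D_pos by (intro mult_right_mono) auto
      finally show ?thesis .
    qed
    then have "real (card S3) \<le> real (card Y) * (e * D\<^sup>2 * D)"
      unfolding S3_def using finite_parts by (intro card_Sigma_le_real) (auto intro!: finite_SigmaI)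
    also have "\<dots> \<le> n * (e * D\<^sup>2 * D)" using card_parts eD by (intro mult_right_mono) auto
    finally show ?thesis .
  qed
  let ?f1 = "\<lambda>(c, (p, a), q). (p, c, a, q)"
  let ?f2 = "\<lambda>((c, a), (p, q)). (p, c, a, q)"
  let ?f3 = "\<lambda>(a, (c, q), p). (p, c, a, q)"
  have "?A \<subseteq> ?f1 ` S1 \<union> ?f2 ` S2 \<union> ?f3 ` S3"
  proof
    fix t assume "t \<in> ?A"
    then obtain p c a q where t: "t = (p, c, a, q)" "(c, p) \<in> E" "(c, a) \<in> E" "(q, a) \<in> E"
      and "conflict adj p a \<or> conflict adj p q \<or> conflict adj c q" by auto
    then consider "conflict adj p a" | "conflict adj p q" | "conflict adj c q" by blast
    then show "t \<in> ?f1 ` S1 \<union> ?f2 ` S2 \<union> ?f3 ` S3"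
    proof cases
      case 1
      then have "(c, (p, a), q) \<in> S1" unfolding S1_def using t edges_parts by auto
      then show ?thesis using t(1) by force
    next
      case 2
      then have "((c, a), (p, q)) \<in> S2" unfolding S2_def using t by auto
      then show ?thesis using t(1) by force
    next
      case 3
      then have "(a, (c, q), p) \<in> S3" unfolding S3_def using t edges_parts by auto
      then show ?thesis using t(1) by force
    qed
  qed
  then have "card ?A \<le> card (?f1 ` S1 \<union> ?f2 ` S2 \<union> ?f3 ` S3)"
    using fin by (intro card_mono) auto
  also have "\<dots> \<le> card (?f1 ` S1) + card (?f2 ` S2) + card (?f3 ` S3)"
    using card_Un_le[of "?f1 ` S1 \<union> ?f2 ` S2" "?f3 ` S3"] card_Un_le[of "?f1 ` S1" "?f2 ` S2"] by linarith
  also have "\<dots> \<le> card S1 + card S2 + card S3"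
    using fin by (intro add_mono card_image_le) auto
  finally have "real (card ?A) \<le> real (card S1) + real (card S2) + real (card S3)" by simp
  also have "\<dots> \<le> 3 * e * n * D ^ 3" using 1 2 3 by (simp add: power2_eq_square power3_eq_cube algebra_simps)
  finally show ?thesis .
qed

text \<open>A leg at \<open>c\<close> is an inner vertex with its outer vertex. The conflict of
  \<open>a'\<close> with \<open>q\<close> is the listed one for the swapped pair of legs; tuples of
  legs are tested in both orders.\<close>

definition conflicting_legs :: "'a \<Rightarrow> (('a \<times> 'a) \<times> 'a \<times> 'a) set" where
  "conflicting_legs c = {((a, q), (a', q')). (c, a) \<in> E \<and> (c, a') \<in> E \<and> (q, a) \<in> E \<and> (q', a') \<in> E \<and>
      (conflict adj a a' \<or> conflict adj a q' \<or> conflict adj q q')}"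

text \<open>There are at most \<open>D\<^sup>2\<close> legs at \<open>c\<close>. The bound is shaped
  for \<open>card_compatible_PiE_ge\<close> with \<open>u = D\<^sup>2\<close> and
  \<open>b = 3 * e\<close>.\<close>

lemma card_conflicting_legs:
  fixes e :: real
  assumes few: "\<And>P Q. \<lbrakk>finite P; finite Q; real (card P) \<le> D; real (card Q) \<le> D\<rbrakk> \<Longrightarrow>
      real (card (conflict_pairs adj P Q)) \<le> e * D\<^sup>2"
    and "0 \<le> e"
  shows "finite (conflicting_legs c)" "real (card (conflicting_legs c)) \<le> 3 * e * (D\<^sup>2)\<^sup>2"
proof -
  let ?C = "conflict_pairs adj"
  let ?N = "E `` {c}"
  define S1 where "S1 = Sigma (?C ?N ?N) (\<lambda>(a, a'). (E\<inverse> `` {a}) \<times> (E\<inverse> `` {a'}))"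
  define S2 where "S2 = Sigma ?N (\<lambda>a'. Sigma (?C ?N (E\<inverse> `` {a'})) (\<lambda>(a, q'). E\<inverse> `` {a}))"
  define S3 where "S3 = Sigma (?N \<times> ?N) (\<lambda>(a, a'). ?C (E\<inverse> `` {a}) (E\<inverse> `` {a'}))"
  have fin: "finite S1" "finite S2" "finite S3"
    unfolding S1_def S2_def S3_def by (auto intro!: finite_SigmaI)
  have eD: "0 \<le> e * D\<^sup>2" "0 \<le> e * D\<^sup>2 * D" using assms D_pos by auto
  have sq: "real (card ((E\<inverse> `` {a}) \<times> (E\<inverse> `` {a'}))) \<le> D\<^sup>2" "real (card (?N \<times> ?N)) \<le> D\<^sup>2" for a a'
    using degree_left[of c] degree_right[of a] degree_right[of a'] D_pos
    by (auto simp: card_cartesian_product power2_eq_square intro!: mult_mono)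
  have 1: "real (card S1) \<le> e * D\<^sup>2 * D\<^sup>2"
  proof -
    have "real (card S1) \<le> real (card (?C ?N ?N)) * D\<^sup>2"
      unfolding S1_def using sq by (intro card_Sigma_le_real) auto
    also have "\<dots> \<le> e * D\<^sup>2 * D\<^sup>2" using few degree_left by (intro mult_right_mono) auto
    finally show ?thesis .
  qed
  have 2: "real (card S2) \<le> D * (e * D\<^sup>2 * D)"
  proof -
    have "real (card (Sigma (?C ?N (E\<inverse> `` {a'})) (\<lambda>(a, q'). E\<inverse> `` {a}))) \<le> e * D\<^sup>2 * D" for a'
    proof -
      have "real (card (Sigma (?C ?N (E\<inverse> `` {a'})) (\<lambda>(a, q'). E\<inverse> `` {a}))) \<le> real (card (?C ?N (E\<inverse> `` {a'}))) * D"
        using degree_right by (intro card_Sigma_le_real) auto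
      also have "\<dots> \<le> e * D\<^sup>2 * D" using few degree_left degree_right D_pos by (intro mult_right_mono) auto
      finally show ?thesis .
    qed
    then have "real (card S2) \<le> real (card ?N) * (e * D\<^sup>2 * D)"
      unfolding S2_def by (intro card_Sigma_le_real) (auto intro!: finite_SigmaI)
    also have "\<dots> \<le> D * (e * D\<^sup>2 * D)" using degree_left eD by (intro mult_right_mono) auto
    finally show ?thesis .
  qed
  have 3: "real (card S3) \<le> D\<^sup>2 * (e * D\<^sup>2)"
  proof -
    have "real (card S3) \<le> real (card (?N \<times> ?N)) * (e * D\<^sup>2)"
      unfolding S3_def using few degree_right by (intro card_Sigma_le_real) auto
    also have "\<dots> \<le> D\<^sup>2 * (e * D\<^sup>2)" using sq eD by (intro mult_right_mono) auto
    finally show ?thesis .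
  qed
  let ?f1 = "\<lambda>((a, a'), (q, q')). ((a, q), (a', q'))"
  let ?f2 = "\<lambda>(a', (a, q'), q). ((a, q), (a', q'))"
  have sub: "conflicting_legs c \<subseteq> ?f1 ` S1 \<union> ?f2 ` S2 \<union> ?f1 ` S3"
  proof
    fix t assume "t \<in> conflicting_legs c"
    then obtain a q a' q' where t: "t = ((a, q), (a', q'))" "(c, a) \<in> E" "(c, a') \<in> E" "(q, a) \<in> E" "(q', a') \<in> E"
      and "conflict adj a a' \<or> conflict adj a q' \<or> conflict adj q q'" unfolding conflicting_legs_def by auto
    then consider "conflict adj a a'" | "conflict adj a q'" | "conflict adj q q'" by blast
    then show "t \<in> ?f1 ` S1 \<union> ?f2 ` S2 \<union> ?f1 ` S3"
    proof cases
      case 1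
      then have "((a, a'), (q, q')) \<in> S1" unfolding S1_def using t by auto
      then show ?thesis using t(1) by force
    next
      case 2
      then have "(a', (a, q'), q) \<in> S2" unfolding S2_def using t by auto
      then show ?thesis using t(1) by force
    next
      case 3
      then have "((a, a'), (q, q')) \<in> S3" unfolding S3_def using t by auto
      then show ?thesis using t(1) by force
    qed
  qed
  then show "finite (conflicting_legs c)"
    using fin by (auto intro: finite_subset)
  from sub have "card (conflicting_legs c) \<le> card (?f1 ` S1 \<union> ?f2 ` S2 \<union> ?f1 ` S3)"
    using fin by (intro card_mono) auto
  also have "\<dots> \<le> card (?f1 ` S1) + card (?f2 ` S2) + card (?f1 ` S3)"
    using card_Un_le[of "?f1 ` S1 \<union> ?f2 ` S2" "?f1 ` S3"] card_Un_le[of "?f1 ` S1" "?f2 ` S2"] by linarith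
  also have "\<dots> \<le> card S1 + card S2 + card S3"
    using fin by (intro add_mono card_image_le) auto
  finally have "real (card (conflicting_legs c)) \<le> real (card S1) + real (card S2) + real (card S3)" by simp
  also have "\<dots> \<le> 3 * e * (D\<^sup>2)\<^sup>2" using 1 2 3 by (simp add: power2_eq_square algebra_simps)
  finally show "real (card (conflicting_legs c)) \<le> 3 * e * (D\<^sup>2)\<^sup>2" .
qed

section \<open>Spiders with prescribed leaves\<close>

text \<open>Extensionality leaves only one function for each choice of inner vertices, so that the
  cardinality counts spiders.\<close>

definition light_spiders :: "nat \<Rightarrow> nat \<Rightarrow> 'a \<Rightarrow> (nat \<Rightarrow> 'a) \<Rightarrow> ('a \<times> (nat \<Rightarrow> 'a)) set" where
  "light_spiders r N p g = {(c, a). (c, p) \<in> E \<and> a \<in> extensional {..<r} \<and>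
     (\<forall>j<r. (p, c, a j, g j) \<in> light_paths E N) \<and> induced_spider adj r p g c a}"

lemma finite_light_spiders: "finite (light_spiders r N p g)"
proof (rule finite_subset)
  show "light_spiders r N p g \<subseteq> X \<times> ({..<r} \<rightarrow>\<^sub>E Y)"
    using edges_parts unfolding light_spiders_def light_paths_def by (auto simp: PiE_def Pi_def)
qed (use finite_parts in \<open>auto intro!: finite_PiE\<close>)

text \<open>Each inner vertex is one of fewer than \<open>N\<close> common neighbours of
  \<open>c\<close> and the prescribed outer vertex.\<close>

lemma card_light_spiders_centre:
  "card {t \<in> light_spiders r N p g. fst t = c} \<le> N ^ r"
proof (cases "{t \<in> light_spiders r N p g. fst t = c} = {}")
  case True
  show ?thesis unfolding True by simp
next
  case False
  then have light: "card (E `` {c} \<inter> E `` {g j}) < N" if "j < r" for j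
    using that unfolding light_spiders_def light_paths_def by auto
  let ?P = "PiE {..<r} (\<lambda>j. E `` {c} \<inter> E `` {g j})"
  have "inj_on snd {t \<in> light_spiders r N p g. fst t = c}"
    by (auto simp: inj_on_def)
  moreover have "snd ` {t \<in> light_spiders r N p g. fst t = c} \<subseteq> ?P"
    unfolding light_spiders_def light_paths_def by (auto simp: PiE_def Pi_def)
  moreover have "finite ?P" by (auto intro!: finite_PiE)
  ultimately have "card {t \<in> light_spiders r N p g. fst t = c} \<le> card ?P"
    by (rule card_inj_on_le)
  also have "\<dots> = (\<Prod>j<r. card (E `` {c} \<inter> E `` {g j}))" by (simp add: card_PiE)
  also have "\<dots> \<le> (\<Prod>j<r. N)" using light by (intro prod_mono) (auto intro: less_imp_le)
  finally show ?thesis by simp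
qed

text \<open>The centre is one of fewer than \<open>N\<close> common neighbours of \<open>p\<close>
  and \<open>v\<close>, and each centre belongs to at most \<open>N ^ r\<close> spiders.\<close>

lemma card_light_spiders_inner:
  assumes "i < r"
  shows "card {t \<in> light_spiders r N p g. snd t i = v} \<le> N * N ^ r"
proof (cases "{t \<in> light_spiders r N p g. snd t i = v} = {}")
  case True
  show ?thesis unfolding True by simp
next
  case False
  let ?I = "E\<inverse> `` {p} \<inter> E\<inverse> `` {v}"
  have light: "card ?I < N"
    using assms False unfolding light_spiders_def light_paths_def by auto
  have "{t \<in> light_spiders r N p g. snd t i = v} \<subseteq> (\<Union>c\<in>?I. {t \<in> light_spiders r N p g. fst t = c})"
    using assms unfolding light_spiders_def light_paths_def by auto
  then have "card {t \<in> light_spiders r N p g. snd t i = v} \<le> card (\<Union>c\<in>?I. {t \<in> light_spiders r N p g. fst t = c})"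
    using finite_light_spiders by (intro card_mono) auto
  also have "\<dots> \<le> (\<Sum>c\<in>?I. card {t \<in> light_spiders r N p g. fst t = c})"
    by (rule card_UN_le) simp
  also have "\<dots> \<le> (\<Sum>c\<in>?I. N ^ r)" by (intro sum_mono card_light_spiders_centre)
  also have "\<dots> \<le> N * N ^ r" using light by simp
  finally show ?thesis .
qed

text \<open>By the two preceding bounds a spider meets boundedly many others off the leaves, so a
  greedy choice succeeds. The summand \<open>1\<close> keeps the degree bound positive, as
  \<open>independent_subset\<close> demands.\<close>

lemma disjoint_light_spiders:
  assumes "m * (N ^ r + r * r * (N * N ^ r) + 1) \<le> card (light_spiders r N p g)"
  obtains T where "T \<subseteq> light_spiders r N p g" "card T = m"
    "\<And>t t'. \<lbrakk>t \<in> T; t' \<in> T; t \<noteq> t'\<rbrakk> \<Longrightarrow> fst t \<noteq> fst t' \<and> (\<forall>i<r. \<forall>j<r. snd t i \<noteq> snd t' j)"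
proof -
  define K where "K = (\<lambda>(t :: 'a \<times> (nat \<Rightarrow> 'a)) t'. fst t = fst t' \<or> (\<exists>i<r. \<exists>j<r. snd t i = snd t' j))"
  let ?S = "light_spiders r N p g"
  have deg: "card {t' \<in> ?S. K t t'} \<le> N ^ r + r * r * (N * N ^ r) + 1" for t
  proof -
    let ?A = "{t' \<in> ?S. fst t' = fst t}"
    let ?B = "\<lambda>(i, j). {t' \<in> ?S. snd t' j = snd t i}"
    let ?R = "{..<r} \<times> {..<r}"
    have "card {t' \<in> ?S. K t t'} \<le> card (?A \<union> (\<Union>ij\<in>?R. ?B ij))"
      unfolding K_def using finite_light_spiders by (intro card_mono) auto
    also have "\<dots> \<le> card ?A + (\<Sum>ij\<in>?R. card (?B ij))"
      using card_Un_le[of ?A "\<Union>ij\<in>?R. ?B ij"] card_UN_le[of ?R ?B] by simp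
    also have "\<dots> \<le> N ^ r + (\<Sum>ij\<in>?R. N * N ^ r)"
      by (intro add_mono sum_mono card_light_spiders_centre) (auto intro: card_light_spiders_inner)
    also have "\<dots> = N ^ r + r * r * (N * N ^ r)" by (simp add: card_cartesian_product)
    finally show ?thesis by simp
  qed
  obtain T where T: "T \<subseteq> ?S" "card T = m" "\<And>z z'. \<lbrakk>z \<in> T; z' \<in> T; z \<noteq> z'\<rbrakk> \<Longrightarrow> \<not> K z z'"
  proof (rule independent_subset[of ?S K])
    show "K z z" for z unfolding K_def by simp
    show "K z z' \<Longrightarrow> K z' z" for z z' unfolding K_def by metis
  qed (use finite_light_spiders deg assms in auto)
  show ?thesis
  proof (rule that[OF T(1,2)])
    show "fst t \<noteq> fst t' \<and> (\<forall>i<r. \<forall>j<r. snd t i \<noteq> snd t' j)" if "t \<in> T" "t' \<in> T" "t \<noteq> t'" for t t'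
      using T(3)[OF that] unfolding K_def by blast
  qed
qed

text \<open>A spider is assembled from an edge \<open>(c, p)\<close> and \<open>r\<close> legs at
  \<open>c\<close>. Conflicts inside a path cost at most half of the light paths, after which a
  positive proportion of the edges carry at least \<open>\<beta> / 4 * D\<^sup>2\<close> legs each;
  conflicts between legs cost at most half of the \<open>r\<close>-tuples this guarantees. The
  spiders obtained are distributed over at most \<open>n * n ^ r\<close> tuples of leaves.\<close>

lemma many_light_spiders:
  fixes e \<beta> :: real
  assumes sym: "\<And>u v. adj u v \<Longrightarrow> adj v u"
    and few: "\<And>P Q. \<lbrakk>finite P; finite Q; real (card P) \<le> D; real (card Q) \<le> D\<rbrakk> \<Longrightarrow>
      real (card (conflict_pairs adj P Q)) \<le> e * D\<^sup>2"
    and e: "0 \<le> e" "6 * e \<le> \<beta>" "6 * (real r)\<^sup>2 * e \<le> (\<beta> / 4) ^ r" and "0 < \<beta>"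
    and paths: "\<beta> * n * D ^ 3 \<le> real (card (light_paths E N))"
    and large: "real (m + 1) * n ^ r \<le> \<beta> / 4 * ((\<beta> / 4) ^ r / 2) * D ^ (2 * r + 1)"
  obtains p g where "p \<in> Y" "\<forall>j<r. g j \<in> X" "m \<le> card (light_spiders r N p g)"
proof -
  define W where "W = (\<lambda>(c, p). {(a, q). (p, c, a, q) \<in> light_paths E N \<and>
      \<not> conflict adj p a \<and> \<not> conflict adj p q \<and> \<not> conflict adj c q})"
  define A where "A = {(p, c, a, q). (c, p) \<in> E \<and> (c, a) \<in> E \<and> (q, a) \<in> E \<and>
      (conflict adj p a \<or> conflict adj p q \<or> conflict adj c q)}"
  have A: "real (card A) \<le> 3 * e * n * D ^ 3"
    unfolding A_def using few e(1) by (rule card_conflict_paths)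
  define U where "U = (\<lambda>c. Sigma (E `` {c}) (\<lambda>a. E\<inverse> `` {a}))"
  have U: "finite (U c)" "real (card (U c)) \<le> D\<^sup>2" for c
  proof -
    have "real (card (U c)) \<le> real (card (E `` {c})) * D"
      unfolding U_def using degree_right by (intro card_Sigma_le_real) auto
    also have "\<dots> \<le> D * D" using degree_left D_pos by (intro mult_right_mono) auto
    finally show "real (card (U c)) \<le> D\<^sup>2" by (simp add: power2_eq_square)
    show "finite (U c)" unfolding U_def by auto
  qed
  have WU: "W (c, p) \<subseteq> U c" for c p
    unfolding W_def U_def light_paths_def by auto
  have W: "finite (W t)" "real (card (W t)) \<le> D\<^sup>2" for t
  proof -
    obtain c p where t: "t = (c, p)" by (cases t)
    show "finite (W t)" unfolding t using WU U finite_subset by blast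
    have "card (W t) \<le> card (U c)" unfolding t using WU U by (intro card_mono) auto
    then show "real (card (W t)) \<le> D\<^sup>2" using U(2)[of c] by linarith
  qed
  have nD3: "0 \<le> n * D ^ 3" using n_pos D_pos by simp
  have "light_paths E N \<subseteq> A \<union> (\<lambda>((c, p), (a, q)). (p, c, a, q)) ` Sigma E W"
  proof
    fix t assume t: "t \<in> light_paths E N"
    obtain p c a q where pc: "t = (p, c, a, q)" by (cases t) auto
    show "t \<in> A \<union> (\<lambda>((c, p), (a, q)). (p, c, a, q)) ` Sigma E W"
    proof (cases "t \<in> A")
      case False
      then have "((c, p), (a, q)) \<in> Sigma E W"
        using t unfolding pc A_def W_def light_paths_def by auto
      then show ?thesis unfolding pc by force
    qed simp
  qed
  moreover have "finite A"
    by (rule finite_subset[of _ "Y \<times> X \<times> Y \<times> X"]) (use finite_parts edges_parts in \<open>auto simp: A_def\<close>)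
  moreover have fEW: "finite (Sigma E W)" using finite_edges W by auto
  ultimately have "card (light_paths E N) \<le> card (A \<union> (\<lambda>((c, p), (a, q)). (p, c, a, q)) ` Sigma E W)"
    by (intro card_mono) auto
  also have "\<dots> \<le> card A + card ((\<lambda>((c, p), (a, q)). (p, c, a, q)) ` Sigma E W)"
    by (rule card_Un_le)
  also have "\<dots> \<le> card A + card (Sigma E W)"
    using fEW by (intro add_left_mono card_image_le)
  finally have "real (card (light_paths E N)) \<le> real (card A) + real (card (Sigma E W))" by simp
  moreover have "3 * e * n * D ^ 3 \<le> \<beta> / 2 * (n * D ^ 3)"
    using mult_right_mono[OF e(2) nD3] by simp
  ultimately have EW: "\<beta> / 2 * (n * D ^ 3) \<le> real (card (Sigma E W))"
    using A paths by (simp add: mult.assoc)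
  define F where "F = {t \<in> E. \<beta> / 4 * D\<^sup>2 \<le> real (card (W t))}"
  have F: "\<beta> / 4 * (n * D) \<le> real (card F)"
    unfolding F_def
  proof (rule many_large_fibres[where b = "D\<^sup>2"])
    have "real (card E) * (\<beta> / 4 * D\<^sup>2) \<le> n * D * (\<beta> / 4 * D\<^sup>2)"
      using card_edges \<open>0 < \<beta>\<close> by (intro mult_right_mono) auto
    then show "real (card E) * (\<beta> / 4 * D\<^sup>2) + \<beta> / 4 * (n * D) * D\<^sup>2 \<le> real (card (Sigma E W))"
      using EW by (simp add: power2_eq_square power3_eq_cube algebra_simps)
  qed (use finite_edges W D_pos \<open>0 < \<beta>\<close> in auto)
  have finF: "finite F" unfolding F_def using finite_edges by simp
  define Gd where "Gd = (\<lambda>(c, p). {f \<in> {..<r} \<rightarrow>\<^sub>E W (c, p). \<forall>i<r. \<forall>j<r. i \<noteq> j \<longrightarrow> (f i, f j) \<notin> conflicting_legs c})"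
  define \<gamma> where "\<gamma> = (\<beta> / 4) ^ r / 2"
  have finG: "finite (Gd t)" for t
  proof (rule finite_subset)
    show "Gd t \<subseteq> {..<r} \<rightarrow>\<^sub>E W t" unfolding Gd_def by (cases t) auto
  qed (intro finite_PiE finite_lessThan W(1))
  have G: "\<gamma> * D ^ (2 * r) \<le> real (card (Gd t))" if "t \<in> F" for t
  proof -
    obtain c p where t: "t = (c, p)" by (cases t)
    have "(\<beta> / 4 * D\<^sup>2) ^ r - (real r)\<^sup>2 * (3 * e) * (D\<^sup>2) ^ r \<le> real (card (Gd t))"
      unfolding Gd_def t split_conv
      using W card_conflicting_legs[OF few e(1)] e(1) that \<open>0 < \<beta>\<close>
      by (intro card_compatible_PiE_ge) (auto simp: F_def t)
    also have "(\<beta> / 4 * D\<^sup>2) ^ r - (real r)\<^sup>2 * (3 * e) * (D\<^sup>2) ^ r = ((\<beta> / 4) ^ r - 3 * (real r)\<^sup>2 * e) * D ^ (2 * r)"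
      unfolding power_mult_distrib[of "\<beta> / 4"] power_mult by (simp add: left_diff_distrib)
    finally have "((\<beta> / 4) ^ r - 3 * (real r)\<^sup>2 * e) * D ^ (2 * r) \<le> real (card (Gd t))" .
    moreover have "\<gamma> * D ^ (2 * r) \<le> ((\<beta> / 4) ^ r - 3 * (real r)\<^sup>2 * e) * D ^ (2 * r)"
      using e(3) D_pos unfolding \<gamma>_def by (intro mult_right_mono) auto
    ultimately show ?thesis by linarith
  qed
  have \<gamma>: "0 < \<gamma>" unfolding \<gamma>_def using \<open>0 < \<beta>\<close> by simp
  have "\<beta> / 4 * (n * D) * (\<gamma> * D ^ (2 * r)) \<le> real (card F) * (\<gamma> * D ^ (2 * r))"
    using F \<gamma> D_pos by (intro mult_right_mono) auto
  also have "\<dots> \<le> real (card (Sigma F Gd))"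
    using finF finG G by (intro card_Sigma_ge_real) auto
  finally have FG: "n * (\<beta> / 4 * \<gamma> * D ^ (2 * r + 1)) \<le> real (card (Sigma F Gd))"
    by (simp add: mult_ac)
  let ?L = "Y \<times> ({..<r} \<rightarrow>\<^sub>E X)"
  \<comment> \<open>\<open>h\<close> reads off the leaves of a configuration. On a fibre of
    \<open>h\<close> the map \<open>k\<close> below, which keeps the centre and the inner vertices,
    is injective and lands in \<open>light_spiders\<close>.\<close>
  define h where "h = (\<lambda>((c :: 'a, p :: 'a), f :: nat \<Rightarrow> 'a \<times> 'a). (p, \<lambda>j\<in>{..<r}. snd (f j)))"
  have fL: "finite ?L" using finite_parts by (auto intro!: finite_PiE)
  have hL: "h ` Sigma F Gd \<subseteq> ?L"
  proof
    fix z assume "z \<in> h ` Sigma F Gd"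
    then obtain c p f where z: "z = h ((c, p), f)" "(c, p) \<in> F" "f \<in> {..<r} \<rightarrow>\<^sub>E W (c, p)"
      unfolding Gd_def by auto
    have "snd (f j) \<in> X" if "j < r" for j
    proof -
      have "f j \<in> W (c, p)" using z(3) that by auto
      then have "f j \<in> U c" using WU by blast
      then show ?thesis unfolding U_def using edges_parts by auto
    qed
    moreover have "p \<in> Y" using z(2) edges_parts unfolding F_def by auto
    ultimately show "z \<in> ?L" unfolding z(1) h_def by auto
  qed
  \<comment> \<open>The surplus of \<open>m + 1\<close> over \<open>m\<close> in
    \<open>large\<close> supplies the strict inequality.\<close>
  have "card ?L * m < card (Sigma F Gd)"
  proof -
    have "real (card ?L * m) = real (card Y) * real (card X) ^ r * real m"
      by (simp add: card_cartesian_product card_PiE)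
    also have "\<dots> \<le> n * n ^ r * real m"
      using card_parts n_pos by (intro mult_right_mono mult_mono power_mono) auto
    also have "\<dots> < n * (real (m + 1) * n ^ r)"
      using n_pos by (simp add: algebra_simps)
    also have "\<dots> \<le> n * (\<beta> / 4 * \<gamma> * D ^ (2 * r + 1))"
      using large n_pos unfolding \<gamma>_def by (intro mult_left_mono) auto
    also have "\<dots> \<le> real (card (Sigma F Gd))" by (rule FG)
    finally show ?thesis by (simp only: of_nat_less_iff)
  qed
  then obtain z where z: "z \<in> ?L" "m < card {t \<in> Sigma F Gd. h t = z}"
    using pigeonhole_fibre[OF finite_SigmaI[OF finF finG] fL hL] by blast
  obtain p g where pg: "z = (p, g)" by (cases z)
  define k where "k = (\<lambda>((c :: 'a, p :: 'a), f :: nat \<Rightarrow> 'a \<times> 'a). (c, \<lambda>j\<in>{..<r}. fst (f j)))"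
  let ?T = "{t \<in> Sigma F Gd. h t = z}"
  have elem: "\<exists>c f. t = ((c, p), f) \<and> (c, p) \<in> E \<and> f \<in> {..<r} \<rightarrow>\<^sub>E W (c, p) \<and>
      (\<forall>i<r. \<forall>j<r. i \<noteq> j \<longrightarrow> (f i, f j) \<notin> conflicting_legs c) \<and> (\<forall>j<r. snd (f j) = g j)" if "t \<in> ?T" for t
  proof -
    obtain c p' f where t: "t = ((c, p'), f)" by (metis surj_pair)
    have "h t = (p, g)" using that pg by simp
    then have p': "p' = p" and g: "(\<lambda>j\<in>{..<r}. snd (f j)) = g" unfolding t h_def by auto
    have "snd (f j) = g j" if "j < r" for j using fun_cong[OF g, of j] that by simp
    then show ?thesis using that t unfolding p' F_def Gd_def by auto
  qed
  have "inj_on k ?T"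
  proof (rule inj_onI)
    fix t t' assume t: "t \<in> ?T" "t' \<in> ?T" and eq: "k t = k t'"
    obtain c f where t1: "t = ((c, p), f)" "f \<in> {..<r} \<rightarrow>\<^sub>E W (c, p)" "\<forall>j<r. snd (f j) = g j"
      using elem[OF t(1)] by blast
    obtain c' f' where t2: "t' = ((c', p), f')" "f' \<in> {..<r} \<rightarrow>\<^sub>E W (c', p)" "\<forall>j<r. snd (f' j) = g j"
      using elem[OF t(2)] by blast
    have c: "c = c'" and ff: "(\<lambda>j\<in>{..<r}. fst (f j)) = (\<lambda>j\<in>{..<r}. fst (f' j))"
      using eq unfolding k_def t1(1) t2(1) by auto
    have "f j = f' j" for j
    proof (cases "j < r")
      case True
      then have "fst (f j) = fst (f' j)" using fun_cong[OF ff, of j] by simp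
      then show ?thesis using t1(3) t2(3) True by (simp add: prod_eq_iff)
    next
      case False
      then show ?thesis using t1(2) t2(2) by (auto simp: PiE_def extensional_def)
    qed
    then show "t = t'" using t1 t2 c by auto
  qed
  moreover have "k ` ?T \<subseteq> light_spiders r N p g"
  proof
    fix y assume "y \<in> k ` ?T"
    then obtain t where t: "t \<in> ?T" "y = k t" by auto
    obtain c f where cf: "t = ((c, p), f)" "(c, p) \<in> E" "f \<in> {..<r} \<rightarrow>\<^sub>E W (c, p)"
      "\<forall>i<r. \<forall>j<r. i \<noteq> j \<longrightarrow> (f i, f j) \<notin> conflicting_legs c" "\<forall>j<r. snd (f j) = g j"
      using elem[OF t(1)] by blast
    define a where "a = (\<lambda>j\<in>{..<r}. fst (f j))"
    have fj: "f j = (a j, g j)" if "j < r" for j using cf(5) that unfolding a_def by (simp add: prod_eq_iff)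
    have path: "(p, c, a j, g j) \<in> light_paths E N" "\<not> conflict adj p (a j)" "\<not> conflict adj p (g j)" "\<not> conflict adj c (g j)"
      if "j < r" for j
    proof -
      have "f j \<in> W (c, p)" using cf(3) that by auto
      then have "(a j, g j) \<in> W (c, p)" using fj[OF that] by simp
      then show "(p, c, a j, g j) \<in> light_paths E N" "\<not> conflict adj p (a j)" "\<not> conflict adj p (g j)" "\<not> conflict adj c (g j)"
        unfolding W_def by auto
    qed
    have edge: "(c, a j) \<in> E" "(g j, a j) \<in> E" if "j < r" for j
      using path(1)[OF that] unfolding light_paths_def by auto
    have "\<not> conflict adj (a i) (a j) \<and> \<not> conflict adj (a i) (g j) \<and> \<not> conflict adj (g i) (g j)"
      if "i < r" "j < r" "i \<noteq> j" for i j
    proof -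
      have "((a i, g i), (a j, g j)) \<notin> conflicting_legs c"
        using cf(4) that fj[of i] fj[of j] by metis
      then show ?thesis
        using edge[of i] edge[of j] that unfolding conflicting_legs_def by auto
    qed
    then have "induced_spider adj r p g c a"
      unfolding induced_spider_def using cf(2) edge path(2-4) edges_adj sym[OF edges_adj] by simp
    then show "y \<in> light_spiders r N p g"
      unfolding light_spiders_def t(2) cf(1) k_def using cf(2) path(1) a_def by auto
  qed
  ultimately have "card ?T \<le> card (light_spiders r N p g)"
    using finite_light_spiders by (intro card_inj_on_le[of k])
  then have "m \<le> card (light_spiders r N p g)" using z(2) by linarith
  then show ?thesis using that[of p g] z(1) pg by (auto simp: PiE_def Pi_def)
qed

end

text \<open>The constants depend on one another as follows: \<open>M\<close> disjoint spiders
  contain the power, \<open>m\<close> light spiders on the same leaves contain \<open>M\<close>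
  disjoint ones, \<open>e\<close> makes the conflicts negligible against \<open>\<beta>\<close>, and
  \<open>C\<close> pays for \<open>m\<close> spiders per tuple of leaves.\<close>

lemma induced_power_of_light_paths:
  fixes \<beta> :: real
  assumes "0 < \<beta>"
  shows "\<exists>C D0 :: real. \<forall>(adj :: 'a \<Rightarrow> 'a \<Rightarrow> bool) X Y E n D. biclique_free s adj \<longrightarrow>
    bipartite_host adj X Y E n D \<longrightarrow> D0 \<le> D \<longrightarrow> C * n ^ r \<le> D ^ (2 * r + 1) \<longrightarrow>
    \<beta> * n * D ^ 3 \<le> real (card (light_paths E N)) \<longrightarrow> induced_power adj r l X Y"
proof -
  obtain M :: nat where M: "\<forall>(adj :: 'a \<Rightarrow> 'a \<Rightarrow> bool) X Y p ob T. biclique_free s adj \<longrightarrow> X \<inter> Y = {} \<longrightarrow>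
      p \<in> Y \<longrightarrow> (\<forall>j<r. ob j \<in> X) \<longrightarrow> finite T \<longrightarrow> M \<le> card T \<longrightarrow>
      (\<forall>(c, a)\<in>T. c \<in> X \<and> (\<forall>j<r. a j \<in> Y) \<and> induced_spider adj r p ob c a) \<longrightarrow>
      (\<forall>t\<in>T. \<forall>t'\<in>T. t \<noteq> t' \<longrightarrow> fst t \<noteq> fst t' \<and> (\<forall>i<r. \<forall>j<r. snd t i \<noteq> snd t' j)) \<longrightarrow>
      induced_power adj r l X Y"
    using induced_power_of_disjoint_spiders[of s r l] by (elim exE) (rule that)
  define m where "m = M * (N ^ r + r * r * (N * N ^ r) + 1)"
  define e where "e = min (\<beta> / 6) ((\<beta> / 4) ^ r / (6 * (real r)\<^sup>2 + 6))"
  have e0: "0 < e" unfolding e_def using assms by (auto intro!: divide_pos_pos add_nonneg_pos)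
  have e1: "6 * e \<le> \<beta>" unfolding e_def by simp
  have e2: "6 * (real r)\<^sup>2 * e \<le> (\<beta> / 4) ^ r"
  proof -
    have "0 < 6 * (real r)\<^sup>2 + 6" by (auto intro!: add_nonneg_pos)
    moreover have "e \<le> (\<beta> / 4) ^ r / (6 * (real r)\<^sup>2 + 6)" unfolding e_def by simp
    ultimately have "(6 * (real r)\<^sup>2 + 6) * e \<le> (\<beta> / 4) ^ r" by (simp only: pos_le_divide_eq mult.commute)
    then show ?thesis using e0 by (simp add: algebra_simps)
  qed
  obtain D0 :: real where D0: "\<forall>(adj :: 'a \<Rightarrow> 'a \<Rightarrow> bool) P Q D. biclique_free s adj \<longrightarrow> finite P \<longrightarrow> finite Q \<longrightarrow>
       real (card P) \<le> D \<longrightarrow> real (card Q) \<le> D \<longrightarrow> D0 \<le> D \<longrightarrow> real (card (conflict_pairs adj P Q)) \<le> e * D\<^sup>2"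
    using few_conflicts[OF e0, of s] by (elim exE) (rule that)
  define \<kappa> where "\<kappa> = \<beta> / 4 * ((\<beta> / 4) ^ r / 2)"
  have \<kappa>: "0 < \<kappa>" unfolding \<kappa>_def using assms by simp
  have main: "induced_power adj r l X Y"
    if free: "biclique_free s adj" and host: "bipartite_host adj X Y E n D" and D: "D0 \<le> D"
      and C: "real (m + 1) / \<kappa> * n ^ r \<le> D ^ (2 * r + 1)"
      and paths: "\<beta> * n * D ^ 3 \<le> real (card (light_paths E N))"
    for adj :: "'a \<Rightarrow> 'a \<Rightarrow> bool" and X Y E n D
  proof -
    interpret bipartite_host adj X Y E n D by fact
    have few: "real (card (conflict_pairs adj P Q)) \<le> e * D\<^sup>2"
      if "finite P" "finite Q" "real (card P) \<le> D" "real (card Q) \<le> D" for P Q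
      using D0 free D that by blast
    have large: "real (m + 1) * n ^ r \<le> \<beta> / 4 * ((\<beta> / 4) ^ r / 2) * D ^ (2 * r + 1)"
      using mult_left_mono[OF C, of \<kappa>] \<kappa> unfolding \<kappa>_def[symmetric] by simp
    obtain p g where pg: "p \<in> Y" "\<forall>j<r. g j \<in> X" "m \<le> card (light_spiders r N p g)"
      using many_light_spiders[OF biclique_freeD(1)[OF free] few less_imp_le[OF e0] e1 e2 assms paths large] by blast
    obtain T where T: "T \<subseteq> light_spiders r N p g" "card T = M"
      and disj: "\<And>t t'. \<lbrakk>t \<in> T; t' \<in> T; t \<noteq> t'\<rbrakk> \<Longrightarrow> fst t \<noteq> fst t' \<and> (\<forall>i<r. \<forall>j<r. snd t i \<noteq> snd t' j)"
      using disjoint_light_spiders[OF pg(3)[unfolded m_def]] by blast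
    have "finite T" using T(1) finite_light_spiders finite_subset by blast
    moreover have "\<forall>(c, a)\<in>T. c \<in> X \<and> (\<forall>j<r. a j \<in> Y) \<and> induced_spider adj r p g c a"
      using T(1) edges_parts unfolding light_spiders_def light_paths_def by auto
    ultimately show ?thesis
      using M[rule_format, OF free disjoint_parts pg(1), of g T] pg(2) T(2) disj by blast
  qed
  show ?thesis by (intro exI[of _ "real (m + 1) / \<kappa>"] exI[of _ D0] allI impI) (rule main)
qed

section \<open>Pairs with many common neighbours\<close>

text \<open>The crudest case of Hall's theorem: every single set is as large as the number of sets,
  so a greedy choice never gets stuck.\<close>

lemma distinct_representatives_greedy:
  assumes "finite T" "\<And>t. t \<in> T \<Longrightarrow> finite (A t)" "\<And>t. t \<in> T \<Longrightarrow> card T \<le> card (A t)"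
  shows "\<exists>f. inj_on f T \<and> (\<forall>t\<in>T. f t \<in> A t)"
  using assms
proof (induction T rule: finite_induct)
  case empty
  then show ?case by auto
next
  case (insert t T)
  have "card T \<le> card (A t')" if "t' \<in> T" for t'
    using insert.prems(2)[of t'] insert.hyps that by simp
  then obtain f where f: "inj_on f T" "\<forall>t\<in>T. f t \<in> A t"
    using insert.IH insert.prems(1) by auto
  have "card (f ` T) < card (A t)"
    using card_image_le[OF insert.hyps(1), of f] insert.prems(2)[of t] insert.hyps by simp
  then have "\<not> A t \<subseteq> f ` T"
    using insert.hyps(1) card_mono[of "f ` T" "A t"] by auto
  then obtain x where x: "x \<in> A t" "x \<notin> f ` T" by auto
  have "inj_on (f(t := x)) (insert t T)"
    using f(1) x(2) insert.hyps(2) by (auto simp: inj_on_def)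
  moreover have "\<forall>t'\<in>insert t T. (f(t := x)) t' \<in> A t'"
    using f(2) x(1) by auto
  ultimately show ?case by blast
qed

text \<open>Distinct inner vertices \<open>f (c, q)\<close> are chosen for all cells of the grid
  \<open>I \<times> Q\<close>. For a fixed centre \<open>c\<close>, Ramsey applied to the pairs
  \<open>(q, f (c, q))\<close> gives \<open>r\<close> columns whose legs have no edges between them.
  There are only \<open>2 ^ M2\<close> sets of columns, so more than \<open>M\<close> centres share
  the same one, and its elements serve as common outer vertices. A centre differs from every outer
  vertex because \<open>p\<close> is adjacent to the former only.\<close>

lemma induced_power_of_grid:
  shows "\<exists>M1 M2 :: nat. 0 < M1 \<and> 0 < M2 \<and> (\<forall>(adj :: 'a \<Rightarrow> 'a \<Rightarrow> bool) X Y p I Q A. biclique_free s adj \<longrightarrow> X \<inter> Y = {} \<longrightarrow>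
    p \<in> Y \<longrightarrow> I \<subseteq> X \<longrightarrow> Q \<subseteq> X \<longrightarrow> finite I \<longrightarrow> finite Q \<longrightarrow> card I = M1 \<longrightarrow> card Q = M2 \<longrightarrow>
    (\<forall>c\<in>I. adj p c) \<longrightarrow> (\<forall>q\<in>Q. \<not> adj p q) \<longrightarrow>
    (\<forall>c\<in>I. \<forall>q\<in>Q. \<not> adj c q \<and> finite (A c q) \<and> M1 * M2 \<le> card (A c q) \<and> A c q \<subseteq> Y \<and>
       (\<forall>a\<in>A c q. adj c a \<and> adj q a \<and> \<not> adj p a)) \<longrightarrow>
    induced_power adj r l X Y)"
proof -
  obtain M :: nat where M: "\<forall>(adj :: 'a \<Rightarrow> 'a \<Rightarrow> bool) X Y p ob T. biclique_free s adj \<longrightarrow> X \<inter> Y = {} \<longrightarrow>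
      p \<in> Y \<longrightarrow> (\<forall>j<r. ob j \<in> X) \<longrightarrow> finite T \<longrightarrow> M \<le> card T \<longrightarrow>
      (\<forall>(c, a)\<in>T. c \<in> X \<and> (\<forall>j<r. a j \<in> Y) \<and> induced_spider adj r p ob c a) \<longrightarrow>
      (\<forall>t\<in>T. \<forall>t'\<in>T. t \<noteq> t' \<longrightarrow> fst t \<noteq> fst t' \<and> (\<forall>i<r. \<forall>j<r. snd t i \<noteq> snd t' j)) \<longrightarrow>
      induced_power adj r l X Y"
    using induced_power_of_disjoint_spiders[of s r l] by (elim exE) (rule that)
  obtain M2' :: nat where M2': "\<forall>(adj :: 'a \<Rightarrow> 'a \<Rightarrow> bool) (v :: 'a \<Rightarrow> nat \<Rightarrow> 'a) T. biclique_free s adj \<longrightarrow>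
      finite T \<longrightarrow> M2' \<le> card T \<longrightarrow> (\<forall>k<2. inj_on (\<lambda>t. v t k) T) \<longrightarrow>
      (\<exists>T'\<subseteq>T. card T' = r \<and>
         (\<forall>t\<in>T'. \<forall>t'\<in>T'. t \<noteq> t' \<longrightarrow> (\<forall>k<2. \<forall>k'<2. \<not> adj (v t k) (v t' k'))))"
    using nonadjacent_tuples[of s 2 r] by (elim exE) (rule that)
  define M2 where "M2 = M2' + 1"
  define M1 where "M1 = 2 ^ M2 * M + 1"
  have main: "induced_power adj r l X Y"
    if free: "biclique_free s adj" and XY: "X \<inter> Y = {}" and p: "p \<in> Y" and IX: "I \<subseteq> X" and QX: "Q \<subseteq> X"
      and fin: "finite I" "finite Q" and cI: "card I = M1" and cQ: "card Q = M2"
      and pc: "\<forall>c\<in>I. adj p c" and pq: "\<forall>q\<in>Q. \<not> adj p q"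
      and A: "\<forall>c\<in>I. \<forall>q\<in>Q. \<not> adj c q \<and> finite (A c q) \<and> M1 * M2 \<le> card (A c q) \<and> A c q \<subseteq> Y \<and>
       (\<forall>a\<in>A c q. adj c a \<and> adj q a \<and> \<not> adj p a)"
    for adj :: "'a \<Rightarrow> 'a \<Rightarrow> bool" and X Y p I Q A
  proof -
    note sym = biclique_freeD(1)[OF free]
    have "\<exists>f. inj_on f (I \<times> Q) \<and> (\<forall>t\<in>I \<times> Q. f t \<in> (case t of (c, q) \<Rightarrow> A c q))"
      using fin A cI cQ by (intro distinct_representatives_greedy) (auto simp: card_cartesian_product)
    then obtain f where f: "inj_on f (I \<times> Q)" "\<And>c q. c \<in> I \<Longrightarrow> q \<in> Q \<Longrightarrow> f (c, q) \<in> A c q"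
      by fastforce
    have fp: "f (c, q) \<in> Y" "adj c (f (c, q))" "adj q (f (c, q))" "\<not> adj p (f (c, q))" "\<not> adj c q"
      if "c \<in> I" "q \<in> Q" for c q
      using A f(2)[OF that] that by blast+
    have fne: "f (c, q) \<noteq> f (c', q')" if "c \<in> I" "q \<in> Q" "c' \<in> I" "q' \<in> Q" "(c, q) \<noteq> (c', q')" for c q c' q'
      using inj_onD[OF f(1), of "(c, q)" "(c', q')"] that by auto
    define v where "v = (\<lambda>c q (k :: nat). if k = 0 then q else f (c, q))"
    have "\<exists>J\<subseteq>Q. card J = r \<and> (\<forall>t\<in>J. \<forall>t'\<in>J. t \<noteq> t' \<longrightarrow> (\<forall>k<2. \<forall>k'<2. \<not> adj (v c t k) (v c t' k')))"
      if "c \<in> I" for c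
    proof -
      have "\<forall>k<2. inj_on (\<lambda>t. v c t k) Q"
      proof (intro allI impI inj_onI)
        fix k :: nat and q q' assume "q \<in> Q" "q' \<in> Q" "v c q k = v c q' k"
        then show "q = q'" using fne[OF that, of q c q'] that unfolding v_def by (cases "k = 0") auto
      qed
      then show ?thesis using M2'[rule_format, OF free fin(2), of "v c"] cQ unfolding M2_def by simp
    qed
    then obtain J where J: "\<And>c. c \<in> I \<Longrightarrow> J c \<subseteq> Q" "\<And>c. c \<in> I \<Longrightarrow> card (J c) = r"
      and Jn: "\<And>c t t' k k'. \<lbrakk>c \<in> I; t \<in> J c; t' \<in> J c; t \<noteq> t'; k < 2; k' < 2\<rbrakk> \<Longrightarrow> \<not> adj (v c t k) (v c t' k')"
      by metis
    have "card (Pow Q) * M < card I" using fin cI cQ unfolding M1_def by (simp add: card_Pow)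
    moreover have "J ` I \<subseteq> Pow Q" using J by auto
    ultimately obtain J0 where J0: "M < card {c \<in> I. J c = J0}"
      using pigeonhole_fibre[of I "Pow Q" J M] fin by blast
    define I0 where "I0 = {c \<in> I. J c = J0}"
    have I0: "finite I0" "I0 \<subseteq> I" "M \<le> card I0" "\<And>c. c \<in> I0 \<Longrightarrow> J c = J0"
      using fin J0 unfolding I0_def by auto
    have "I0 \<noteq> {}" using J0 unfolding I0_def by (intro notI) simp
    then have J0Q: "J0 \<subseteq> Q" "card J0 = r" using J I0 by blast+
    then obtain h where h: "bij_betw h {0..<r} J0"
      using ex_bij_betw_nat_finite fin finite_subset by metis
    have hJ: "h j \<in> J0" "h j \<in> Q" if "j < r" for j using h that J0Q unfolding bij_betw_def by auto
    have hne: "h i \<noteq> h j" if "i < r" "j < r" "i \<noteq> j" for i j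
      using h that unfolding bij_betw_def inj_on_def by auto
    define T where "T = (\<lambda>c. (c, \<lambda>j. f (c, h j))) ` I0"
    have "card T = card I0" unfolding T_def by (intro card_image) (auto simp: inj_on_def)
    have spider: "induced_spider adj r p h c (\<lambda>j. f (c, h j))" if c0: "c \<in> I0" for c
      unfolding induced_spider_def
    proof (intro conjI allI impI)
      have c: "c \<in> I" using c0 I0 by auto
      show "adj p c" using pc c by blast
      fix j assume j: "j < r"
      note F = fp[OF c hJ(2)[OF j]]
      show "adj c (f (c, h j))" by (rule F)
      show "adj (f (c, h j)) (h j)" using F(3) sym by blast
      have "p \<noteq> f (c, h j)" using F(3) sym[of "h j" p] pq hJ(2)[OF j] by auto
      then show "\<not> conflict adj p (f (c, h j))" using F(4) unfolding conflict_def by simp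
      have "p \<noteq> h j" using p hJ(2)[OF j] QX XY by auto
      then show "\<not> conflict adj p (h j)" using pq hJ(2)[OF j] unfolding conflict_def by simp
      have "c \<noteq> h j" using pc pq c hJ(2)[OF j] by auto
      then show "\<not> conflict adj c (h j)" using F(5) unfolding conflict_def by simp
    next
      fix i j assume ij: "i < r" "j < r" "i \<noteq> j"
      have c: "c \<in> I" using c0 I0 by auto
      have nn: "\<not> adj (v c (h i) k) (v c (h j) k')" if "k < 2" "k' < 2" for k k'
        using Jn[OF c _ _ hne[OF ij] that] hJ(1) ij I0(4)[OF c0] by simp
      have "f (c, h i) \<noteq> f (c, h j)" using fne[OF c hJ(2)[OF ij(1)] c hJ(2)[OF ij(2)]] hne[OF ij] by simp
      then show "\<not> conflict adj (f (c, h i)) (f (c, h j))"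
        using nn[of 1 1] unfolding conflict_def v_def by simp
      have "f (c, h i) \<noteq> h j" using fp(1)[OF c hJ(2)[OF ij(1)]] hJ(2)[OF ij(2)] QX XY by auto
      then show "\<not> conflict adj (f (c, h i)) (h j)"
        using nn[of 1 0] unfolding conflict_def v_def by simp
      show "\<not> conflict adj (h i) (h j)"
        using nn[of 0 0] hne[OF ij] unfolding conflict_def v_def by simp
    qed
    have "\<forall>(c, a)\<in>T. c \<in> X \<and> (\<forall>j<r. a j \<in> Y) \<and> induced_spider adj r p h c a"
      unfolding T_def using spider I0(2) IX fp(1) hJ(2) by auto
    moreover have "\<forall>t\<in>T. \<forall>t'\<in>T. t \<noteq> t' \<longrightarrow> fst t \<noteq> fst t' \<and> (\<forall>i<r. \<forall>j<r. snd t i \<noteq> snd t' j)"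
    proof (intro ballI impI)
      fix t t' assume "t \<in> T" "t' \<in> T" "t \<noteq> t'"
      then obtain c c' where cc: "t = (c, \<lambda>j. f (c, h j))" "t' = (c', \<lambda>j. f (c', h j))" "c \<in> I" "c' \<in> I" "c \<noteq> c'"
        unfolding T_def using I0(2) by auto
      then show "fst t \<noteq> fst t' \<and> (\<forall>i<r. \<forall>j<r. snd t i \<noteq> snd t' j)"
        using fne[OF cc(3) hJ(2) cc(4) hJ(2)] by simp
    qed
    moreover have "\<forall>j<r. h j \<in> X" using hJ QX by auto
    moreover have "finite T" unfolding T_def using I0 by simp
    moreover have "M \<le> card T" using I0(3) \<open>card T = card I0\<close> by simp
    ultimately show ?thesis
      using M[rule_format, OF free XY p, of h T] by blast
  qed
  have "0 < M1" "0 < M2" unfolding M1_def M2_def by simp_all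
  then show ?thesis by (intro exI[of _ M1] exI[of _ M2] conjI allI impI) (assumption | rule main)+
qed

text \<open>If \<open>(x, y)\<close> is an edge and \<open>x\<close> has degree at least
  \<open>k\<close>, then \<open>x\<close> itself belongs to the set.\<close>

definition heavy_nbrs :: "('a \<times> 'a) set \<Rightarrow> nat \<Rightarrow> 'a \<Rightarrow> 'a \<Rightarrow> 'a set" where
  "heavy_nbrs E k x y = {x' \<in> E\<inverse> `` {y}. k \<le> card (E `` {x} \<inter> E `` {x'})}"

text \<open>For \<open>y' \<notin> bad y x\<close> most heavy partners \<open>x'\<close> of \<open>x\<close> in \<open>N(y)\<close> are not adjacent to \<open>y'\<close>, and at
  least half of \<open>k\<close> chosen common neighbours of \<open>x\<close> and \<open>x'\<close> are not adjacent to \<open>y'\<close> either. This is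
  what makes a grid with pendant vertex \<open>y'\<close> induced.\<close>

lemma few_heavy_common_nbrs:
  fixes d :: real
  assumes "0 < d"
  shows "\<exists>(k :: nat) (n1 :: nat) (n2 :: nat) (D0 :: real). \<forall>(adj :: 'a \<Rightarrow> 'a \<Rightarrow> bool) X Y E n D.
    biclique_free s adj \<longrightarrow> bipartite_host adj X Y E n D \<longrightarrow> D0 \<le> D \<longrightarrow> \<not> induced_power adj r l X Y \<longrightarrow>
    (\<exists>bad. (\<forall>y x. finite (bad y x) \<and> card (bad y x) \<le> n2) \<and>
      (\<forall>y y'. y \<noteq> y' \<longrightarrow>
        card {x. (x, y) \<in> E \<and> (x, y') \<in> E \<and> d * D \<le> real (card (heavy_nbrs E k x y)) \<and> y' \<notin> bad y x} < n1))"
proof -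
  obtain M1 M2 :: nat where M12: "0 < M1" "0 < M2" and grid: "\<forall>(adj :: 'a \<Rightarrow> 'a \<Rightarrow> bool) X Y p I Q A. biclique_free s adj \<longrightarrow> X \<inter> Y = {} \<longrightarrow>
    p \<in> Y \<longrightarrow> I \<subseteq> X \<longrightarrow> Q \<subseteq> X \<longrightarrow> finite I \<longrightarrow> finite Q \<longrightarrow> card I = M1 \<longrightarrow> card Q = M2 \<longrightarrow>
    (\<forall>c\<in>I. adj p c) \<longrightarrow> (\<forall>q\<in>Q. \<not> adj p q) \<longrightarrow>
    (\<forall>c\<in>I. \<forall>q\<in>Q. \<not> adj c q \<and> finite (A c q) \<and> M1 * M2 \<le> card (A c q) \<and> A c q \<subseteq> Y \<and>
       (\<forall>a\<in>A c q. adj c a \<and> adj q a \<and> \<not> adj p a)) \<longrightarrow>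
    induced_power adj r l X Y"
    using induced_power_of_grid[of s r l] by (elim exE conjE) (rule that)
  have d4: "0 < d / 4" using assms by simp
  have half: "(0::real) < 1 / 2" by simp
  \<comment> \<open>\<open>K4\<close> is used at the constant scale \<open>k\<close>, inside the
    \<open>k\<close> chosen common neighbours of two vertices; the other three are used at the scale
    \<open>D\<close>, inside neighbourhoods. \<open>K6\<close> asks for a single column met by
    \<open>k4\<close> rows, which are the rows that \<open>K4\<close> takes as input.\<close>
  obtain k4 :: nat and D4 :: real where K4:
    "\<forall>(R :: 'a \<Rightarrow> 'a \<Rightarrow> bool) I Q D.
       finite I \<longrightarrow> finite Q \<longrightarrow> k4 \<le> card I \<longrightarrow> real (card Q) \<le> D \<longrightarrow> D4 \<le> D \<longrightarrow>
       (\<forall>x\<in>I. 1 / 2 * D \<le> real (card {q \<in> Q. R x q})) \<longrightarrow>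
       (\<exists>I' Q'. I' \<subseteq> I \<and> Q' \<subseteq> Q \<and> card I' = s \<and> card Q' = s \<and> (\<forall>x\<in>I'. \<forall>q\<in>Q'. R x q))"
    using dense_rows_biclique[OF half, of s s] by (elim exE) (rule that)
  obtain k5 :: nat and D5 :: real where K5:
    "\<forall>(R :: 'a \<Rightarrow> 'a \<Rightarrow> bool) I Q D.
       finite I \<longrightarrow> finite Q \<longrightarrow> k5 \<le> card I \<longrightarrow> real (card Q) \<le> D \<longrightarrow> D5 \<le> D \<longrightarrow>
       (\<forall>x\<in>I. d / 4 * D \<le> real (card {q \<in> Q. R x q})) \<longrightarrow>
       (\<exists>I' Q'. I' \<subseteq> I \<and> Q' \<subseteq> Q \<and> card I' = s \<and> card Q' = s \<and> (\<forall>x\<in>I'. \<forall>q\<in>Q'. R x q))"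
    using dense_rows_biclique[OF d4, of s s] by (elim exE) (rule that)
  obtain k6 :: nat and D6 :: real where K6:
    "\<forall>(R :: 'a \<Rightarrow> 'a \<Rightarrow> bool) I Q D.
       finite I \<longrightarrow> finite Q \<longrightarrow> k6 \<le> card I \<longrightarrow> real (card Q) \<le> D \<longrightarrow> D6 \<le> D \<longrightarrow>
       (\<forall>x\<in>I. d / 4 * D \<le> real (card {q \<in> Q. R x q})) \<longrightarrow>
       (\<exists>I' Q'. I' \<subseteq> I \<and> Q' \<subseteq> Q \<and> card I' = k4 \<and> card Q' = 1 \<and> (\<forall>x\<in>I'. \<forall>q\<in>Q'. R x q))"
    using dense_rows_biclique[OF d4, of k4 1] by (elim exE) (rule that)
  obtain k7 :: nat and D7 :: real where K7:
    "\<forall>(R :: 'a \<Rightarrow> 'a \<Rightarrow> bool) I Q D.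
       finite I \<longrightarrow> finite Q \<longrightarrow> k7 \<le> card I \<longrightarrow> real (card Q) \<le> D \<longrightarrow> D7 \<le> D \<longrightarrow>
       (\<forall>x\<in>I. d / 4 * D \<le> real (card {q \<in> Q. R x q})) \<longrightarrow>
       (\<exists>I' Q'. I' \<subseteq> I \<and> Q' \<subseteq> Q \<and> card I' = M1 \<and> card Q' = M2 \<and> (\<forall>x\<in>I'. \<forall>q\<in>Q'. R x q))"
    using dense_rows_biclique[OF d4, of M1 M2] by (elim exE) (rule that)
  \<comment> \<open>Large enough for \<open>K4\<close>, and such that half of \<open>k\<close>
    common neighbours still provide the \<open>M1 * M2\<close> that a cell of the grid
    requires.\<close>
  define k where "k = nat \<lceil>D4\<rceil> + 2 * (M1 * M2) + 1"
  have k: "D4 \<le> real k" "2 * (M1 * M2) \<le> k" "0 < k" unfolding k_def by linarith+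
  define D0 where "D0 = max D5 (max D6 D7)"
  \<comment> \<open>Fewer than \<open>k5\<close> vertices are lost to edges inside \<open>X\<close>
    (the set \<open>B\<close> below), which leaves the \<open>k7\<close> rows from which
    \<open>K7\<close> extracts the grid.\<close>
  define n1 where "n1 = k5 + k7 + 1"
  have main: "\<exists>bad. (\<forall>y x. finite (bad y x) \<and> card (bad y x) \<le> k5 + k6) \<and>
      (\<forall>y y'. y \<noteq> y' \<longrightarrow>
        card {x. (x, y) \<in> E \<and> (x, y') \<in> E \<and> d * D \<le> real (card (heavy_nbrs E k x y)) \<and> y' \<notin> bad y x} < n1)"
    if free: "biclique_free s adj" and host: "bipartite_host adj X Y E n D" and D: "D0 \<le> D"
      and noH: "\<not> induced_power adj r l X Y"
    for adj :: "'a \<Rightarrow> 'a \<Rightarrow> bool" and X Y E n D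
  proof -
    interpret bipartite_host adj X Y E n D by fact
    note sym = biclique_freeD(1)[OF free]
    have Ds: "D5 \<le> D" "D6 \<le> D" "D7 \<le> D" using D unfolding D0_def by auto
    let ?H = "heavy_nbrs E k"
    have H: "?H x y \<subseteq> E\<inverse> `` {y}" "finite (?H x y)" "real (card (?H x y)) \<le> D" for x y
    proof -
      show sub: "?H x y \<subseteq> E\<inverse> `` {y}" unfolding heavy_nbrs_def by auto
      then show "finite (?H x y)" by (rule finite_subset) simp
      have "card (?H x y) \<le> card (E\<inverse> `` {y})" using sub by (intro card_mono) auto
      then show "real (card (?H x y)) \<le> D" using degree_right[of y] by linarith
    qed
    have "\<exists>A. k \<le> card (E `` {x} \<inter> E `` {x'}) \<longrightarrow> A \<subseteq> E `` {x} \<inter> E `` {x'} \<and> card A = k" for x x'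
      using obtain_subset_with_card_n by metis
    then obtain A where A: "\<And>x x'. k \<le> card (E `` {x} \<inter> E `` {x'}) \<Longrightarrow> A x x' \<subseteq> E `` {x} \<inter> E `` {x'} \<and> card (A x x') = k"
      by metis
    have AH: "A x x' \<subseteq> E `` {x} \<inter> E `` {x'}" "card (A x x') = k" "finite (A x x')" if "x' \<in> ?H x y" for x x' y
    proof -
      have *: "k \<le> card (E `` {x} \<inter> E `` {x'})" using that unfolding heavy_nbrs_def by auto
      show "A x x' \<subseteq> E `` {x} \<inter> E `` {x'}" "card (A x x') = k" using A[OF *] by auto
      then show "finite (A x x')" by (meson finite_Int finite_nbrs(1) finite_subset)
    qed
    define R2 where "R2 = (\<lambda>x y' x'. real k / 2 \<le> real (card {a \<in> A x x'. adj y' a}))"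
    define bad1 where "bad1 = (\<lambda>y x. {y' \<in> Y. d / 4 * D \<le> real (card {x' \<in> ?H x y. adj y' x'})})"
    define bad2 where "bad2 = (\<lambda>y x. {y' \<in> Y. d / 4 * D \<le> real (card {x' \<in> ?H x y. R2 x y' x'})})"
    have b1: "finite (bad1 y x)" "card (bad1 y x) < k5" for y x
    proof -
      show f: "finite (bad1 y x)" unfolding bad1_def using finite_parts by simp
      show "card (bad1 y x) < k5"
      proof (rule ccontr)
        assume "\<not> ?thesis"
        then obtain I' Q' where "card I' = s" "card Q' = s" "\<forall>x\<in>I'. \<forall>q\<in>Q'. adj x q"
          using K5[rule_format, of "bad1 y x" "?H x y" D adj] f H Ds unfolding bad1_def by auto
        then show False using biclique_freeD(3)[OF free] by blast
      qed
    qed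
    have b2: "finite (bad2 y x)" "card (bad2 y x) < k6" for y x
    proof -
      show f: "finite (bad2 y x)" unfolding bad2_def using finite_parts by simp
      \<comment> \<open>If there were \<open>k6\<close> such vertices, \<open>k4\<close> of them
        would share one partner \<open>x'\<close> and would each be adjacent to half of the same
        \<open>k\<close> vertices \<open>A x x'\<close>, which forces a biclique.\<close>
      show "card (bad2 y x) < k6"
      proof (rule ccontr)
        assume "\<not> ?thesis"
        then obtain I' Q' where I': "I' \<subseteq> bad2 y x" "Q' \<subseteq> ?H x y" "card I' = k4" "card Q' = 1" "\<forall>z\<in>I'. \<forall>q\<in>Q'. R2 x z q"
          using K6[rule_format, of "bad2 y x" "?H x y" D "R2 x"] f H Ds unfolding bad2_def by auto
        then obtain x' where x': "Q' = {x'}" by (auto simp: card_1_singleton_iff)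
        have A': "card (A x x') = k" "finite (A x x')" using AH I' x' by auto
        have "finite I'" using I'(1) f finite_subset by blast
        then obtain I'' Q'' where "card I'' = s" "card Q'' = s" "\<forall>z\<in>I''. \<forall>q\<in>Q''. adj z q"
          using K4[rule_format, of I' "A x x'" "real k" adj] A' I' k x' unfolding R2_def by auto
        then show False using biclique_freeD(3)[OF free] by blast
      qed
    qed
    define bad where "bad = (\<lambda>y x. bad1 y x \<union> bad2 y x)"
    have "finite (bad y x) \<and> card (bad y x) \<le> k5 + k6" for y x
      unfolding bad_def using b1[of y x] b2[of y x] card_Un_le[of "bad1 y x" "bad2 y x"] by auto
    moreover have "card {x. (x, y) \<in> E \<and> (x, y') \<in> E \<and> d * D \<le> real (card (?H x y)) \<and> y' \<notin> bad y x} < n1"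
      if "y \<noteq> y'" for y y'
    proof (rule ccontr)
      let ?I = "{x. (x, y) \<in> E \<and> (x, y') \<in> E \<and> d * D \<le> real (card (?H x y)) \<and> y' \<notin> bad y x}"
      assume "\<not> card ?I < n1"
      then have big: "n1 \<le> card ?I" by simp
      have "?I \<subseteq> E\<inverse> `` {y}" by auto
      then have fI: "finite ?I" by (rule finite_subset) simp
      have BI: "{x \<in> ?I. P x} \<subseteq> ?I" "finite {x \<in> ?I. P x}" for P using fI by (auto intro: finite_subset[OF _ fI])
      define B where "B = {x \<in> ?I. d / 4 * D \<le> real (card {q \<in> E\<inverse> `` {y}. adj x q})}"
      have "card B < k5"
      proof (rule ccontr)
        assume "\<not> ?thesis"
        moreover have "finite B" unfolding B_def by (rule BI)
        ultimately obtain I' Q' where "card I' = s" "card Q' = s" "\<forall>x\<in>I'. \<forall>q\<in>Q'. adj x q"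
          using K5[rule_format, of B "E\<inverse> `` {y}" D adj] Ds degree_right unfolding B_def by auto
        then show False using biclique_freeD(3)[OF free] by blast
      qed
      moreover have "card (?I - B) = card ?I - card B"
        unfolding B_def by (intro card_Diff_subset BI)
      ultimately have cIB: "k7 \<le> card (?I - B)" using big unfolding n1_def by linarith
      define R where "R = (\<lambda>x x'. x' \<in> ?H x y \<and> \<not> adj y' x' \<and> \<not> R2 x y' x' \<and> \<not> adj x x')"
      \<comment> \<open>Of at least \<open>d * D\<close> heavy partners of \<open>x\<close>, those
        adjacent to \<open>y'\<close>, those most of whose links to \<open>x\<close> may be spoiled
        by \<open>y'\<close>, and those adjacent to \<open>x\<close> each number less than
        \<open>d / 4 * D\<close>.\<close>
      have row: "d / 4 * D \<le> real (card {q \<in> E\<inverse> `` {y}. R x q})" if x: "x \<in> ?I - B" for x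
      proof -
        have y': "y' \<in> Y" using x edges_parts by auto
        let ?S1 = "{x' \<in> ?H x y. adj y' x'}" and ?S2 = "{x' \<in> ?H x y. R2 x y' x'}"
          and ?S3 = "{q \<in> E\<inverse> `` {y}. adj x q}" and ?S = "{q \<in> E\<inverse> `` {y}. R x q}"
        have fN: "finite {q \<in> E\<inverse> `` {y}. P q}" for P
          by (rule finite_subset[OF _ finite_nbrs(2)[of y]]) blast
        have fH: "finite {q \<in> ?H x y. P q}" for P using H(2) by simp
        have "?H x y \<subseteq> ?S1 \<union> ?S2 \<union> ?S3 \<union> ?S" unfolding R_def using H(1) by auto
        then have "card (?H x y) \<le> card (?S1 \<union> ?S2 \<union> ?S3 \<union> ?S)"
          by (intro card_mono finite_UnI fN fH)
        also have "\<dots> \<le> card ?S1 + card ?S2 + card ?S3 + card ?S"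
          using card_Un_le[of "?S1 \<union> ?S2 \<union> ?S3" ?S] card_Un_le[of "?S1 \<union> ?S2" ?S3] card_Un_le[of ?S1 ?S2] by linarith
        finally have "real (card (?H x y)) \<le> real (card ?S1) + real (card ?S2) + real (card ?S3) + real (card ?S)" by linarith
        moreover have "real (card ?S1) < d / 4 * D" "real (card ?S2) < d / 4 * D" "real (card ?S3) < d / 4 * D"
          "d * D \<le> real (card (?H x y))"
          using x y' unfolding bad_def bad1_def bad2_def B_def by auto
        ultimately show ?thesis by linarith
      qed
      obtain I' Q' where IQ: "I' \<subseteq> ?I - B" "Q' \<subseteq> E\<inverse> `` {y}" "card I' = M1" "card Q' = M2" "\<forall>x\<in>I'. \<forall>q\<in>Q'. R x q"
        using K7[rule_format, of "?I - B" "E\<inverse> `` {y}" D R] fI cIB Ds degree_right row by auto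
      show False
      proof -
        have ne: "I' \<noteq> {}" using IQ(3) M12 by auto
        define A' where "A' = (\<lambda>c q. {a \<in> A c q. \<not> adj y' a})"
        have A': "\<not> adj c q \<and> finite (A' c q) \<and> M1 * M2 \<le> card (A' c q) \<and> A' c q \<subseteq> Y \<and>
           (\<forall>a\<in>A' c q. adj c a \<and> adj q a \<and> \<not> adj y' a)" if c: "c \<in> I'" "q \<in> Q'" for c q
        proof -
          have R: "q \<in> ?H c y" "\<not> adj y' q" "\<not> R2 c y' q" "\<not> adj c q"
            using IQ(5) c unfolding R_def by auto
          have eq: "A c q = A' c q \<union> {a \<in> A c q. adj y' a}" unfolding A'_def by auto
          have "card (A c q) \<le> card (A' c q) + card {a \<in> A c q. adj y' a}"
            by (subst eq) (rule card_Un_le)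
          then have "real k \<le> real (card (A' c q)) + real (card {a \<in> A c q. adj y' a})"
            using AH(2)[OF R(1)] by linarith
          then have "real k / 2 \<le> real (card (A' c q))" using R(3) unfolding R2_def by linarith
          moreover have "real (2 * (M1 * M2)) \<le> real k" using k(2) by (rule of_nat_mono)
          ultimately have "real (M1 * M2) \<le> real (card (A' c q))" by simp
          then have "M1 * M2 \<le> card (A' c q)" by (simp only: of_nat_le_iff)
          moreover have "A' c q \<subseteq> E `` {c} \<inter> E `` {q}" "finite (A' c q)"
            using AH(1,3)[OF R(1)] unfolding A'_def by auto
          ultimately show ?thesis
            using R(4) edges_parts edges_adj unfolding A'_def by auto
        qed
        have "induced_power adj r l X Y"
        proof (rule grid[rule_format, OF free disjoint_parts, of y' I' Q' A'])
          show "y' \<in> Y" using IQ(1) ne edges_parts by auto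
          show "I' \<subseteq> X" "Q' \<subseteq> X" using IQ(1,2) edges_parts by auto
          show "finite I'" using IQ(1) fI finite_subset by blast
          show "finite Q'" using IQ(2) finite_nbrs(2) finite_subset by blast
          show "adj y' c" if "c \<in> I'" for c
            using IQ(1) that edges_adj sym by blast
          show "\<not> adj y' q" if "q \<in> Q'" for q
            using IQ(5) that ne unfolding R_def by blast
        qed (use IQ(3,4) A' in auto)
        then show False using noH by simp
      qed
    qed
    ultimately show ?thesis by (intro exI[of _ bad]) simp
  qed
  show ?thesis by (intro exI[of _ k] exI[of _ n1] exI[of _ "k5 + k6"] exI[of _ D0] allI impI) (rule main)
qed

section \<open>Light paths in graphs with few four-cycles\<close>

lemma light_paths_mono: "N \<le> N' \<Longrightarrow> light_paths E N \<subseteq> light_paths E N'"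
  unfolding light_paths_def by auto

text \<open>The paths \<open>p c a q\<close> are enumerated by their middle edge
  \<open>(c, a)\<close>, which carries at least \<open>t\<^sup>2\<close> choices of the two
  ends.\<close>

lemma card_paths_through_edges:
  fixes t :: real
  assumes "finite S" "finite T" "0 \<le> t"
    and L: "\<And>c a. (c, a) \<in> S \<Longrightarrow> finite (L c a) \<and> t \<le> real (card (L c a))"
    and R: "\<And>c a. (c, a) \<in> S \<Longrightarrow> finite (R c a) \<and> t \<le> real (card (R c a))"
    and T: "\<And>c a p q. \<lbrakk>(c, a) \<in> S; p \<in> L c a; q \<in> R c a\<rbrakk> \<Longrightarrow> (p, c, a, q) \<in> T"
  shows "real (card S) * t\<^sup>2 \<le> real (card T)"
proof -
  let ?B = "\<lambda>(c, a). L c a \<times> R c a"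
  have "t\<^sup>2 \<le> real (card (?B z))" if "z \<in> S" for z
  proof -
    obtain c a where z: "z = (c, a)" by (cases z)
    have "t * t \<le> real (card (L c a)) * real (card (R c a))"
      using L[of c a] R[of c a] that z assms(3) by (intro mult_mono) auto
    then show ?thesis unfolding z by (simp add: card_cartesian_product power2_eq_square)
  qed
  then have "real (card S) * t\<^sup>2 \<le> real (card (Sigma S ?B))"
    using assms(1) L R by (intro card_Sigma_ge_real) auto
  also have "card (Sigma S ?B) \<le> card T"
  proof (rule card_inj_on_le[of "\<lambda>((c, a), (p, q)). (p, c, a, q)"])
    show "inj_on (\<lambda>((c, a), (p, q)). (p, c, a, q)) (Sigma S ?B)" by (auto simp: inj_on_def)
    show "(\<lambda>((c, a), (p, q)). (p, c, a, q)) ` Sigma S ?B \<subseteq> T" using T by auto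
  qed (rule assms)
  finally show ?thesis by simp
qed

text \<open>Closed walks of length four, including the degenerate ones.\<close>

definition four_cycles :: "('a \<times> 'a) set \<Rightarrow> ('a \<times> 'a \<times> 'a \<times> 'a) set" where
  "four_cycles E = {(x, x', y, y'). (x, y) \<in> E \<and> (x, y') \<in> E \<and> (x', y) \<in> E \<and> (x', y') \<in> E}"

lemma card_four_cycles_converse: "card (four_cycles (E\<inverse>)) = card (four_cycles E)"
proof -
  have "four_cycles (E\<inverse>) = (\<lambda>(x, x', y, y'). (y, y', x, x')) ` four_cycles E"
    unfolding four_cycles_def by (auto simp: image_iff)
  then show ?thesis by (simp add: card_image inj_on_def case_prod_unfold prod_eq_iff)
qed

context bipartite_host
begin

lemma finite_four_cycles: "finite (four_cycles E)"
  by (rule finite_subset[of _ "X \<times> X \<times> Y \<times> Y"]) (use finite_parts edges_parts in \<open>auto simp: four_cycles_def\<close>)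

text \<open>On either side the vertices of degree below \<open>t\<close> carry at most
  \<open>n * t\<close> edges in total; this accounts for the loss of
  \<open>2 * n * t\<close>.\<close>

lemma card_high_degree_edges:
  fixes t :: real
  assumes "0 \<le> t" "S \<subseteq> E"
  shows "real (card S) - 2 * n * t \<le> real (card {(x, y) \<in> S. t \<le> real (card (E `` {x})) \<and> t \<le> real (card (E\<inverse> `` {y}))})"
    (is "_ \<le> real (card ?G)")
proof -
  let ?X = "{x \<in> X. real (card (E `` {x})) < t}" and ?Y = "{y \<in> Y. real (card (E\<inverse> `` {y})) < t}"
  let ?A = "Sigma ?X (\<lambda>x. E `` {x})" and ?B = "Sigma ?Y (\<lambda>y. E\<inverse> `` {y})"
  have fin: "finite ?X" "finite ?Y" using finite_parts by auto
  have "real (card ?A) \<le> real (card ?X) * t"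
    using fin by (intro card_Sigma_le_real) auto
  also have "\<dots> \<le> n * t"
    using card_mono[of X ?X] finite_parts card_parts assms(1) by (intro mult_right_mono) auto
  finally have A: "real (card ?A) \<le> n * t" .
  have "real (card ?B) \<le> real (card ?Y) * t"
    using fin by (intro card_Sigma_le_real) auto
  also have "\<dots> \<le> n * t"
    using card_mono[of Y ?Y] finite_parts card_parts assms(1) by (intro mult_right_mono) auto
  finally have B: "real (card ?B) \<le> n * t" .
  have fS: "finite S" using assms(2) finite_edges finite_subset by blast
  have fG: "finite ?G" by (rule finite_subset[OF _ fS]) auto
  have fAB: "finite ?A" "finite ?B" using fin by auto
  have "S \<subseteq> ?G \<union> (?A \<union> prod.swap ` ?B)"
  proof
    fix z assume z: "z \<in> S"
    obtain x y where xy: "z = (x, y)" by (cases z)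
    have e: "(x, y) \<in> E" "x \<in> X" "y \<in> Y" using z xy assms(2) edges_parts by auto
    consider "t \<le> real (card (E `` {x}))" "t \<le> real (card (E\<inverse> `` {y}))"
      | "real (card (E `` {x})) < t" | "real (card (E\<inverse> `` {y})) < t" by linarith
    then show "z \<in> ?G \<union> (?A \<union> prod.swap ` ?B)"
    proof cases
      case 1
      then show ?thesis using z xy by simp
    next
      case 2
      then show ?thesis using e xy by simp
    next
      case 3
      then have "(y, x) \<in> ?B" using e by simp
      then have "prod.swap (y, x) \<in> prod.swap ` ?B" by (rule imageI)
      then show ?thesis using xy by simp
    qed
  qed
  then have "card S \<le> card (?G \<union> (?A \<union> prod.swap ` ?B))"
    using fG fAB by (intro card_mono finite_UnI finite_imageI)
  also have "\<dots> \<le> card ?G + (card ?A + card (prod.swap ` ?B))"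
    using card_Un_le[of ?G "?A \<union> prod.swap ` ?B"] card_Un_le[of ?A "prod.swap ` ?B"] by linarith
  also have "\<dots> \<le> card ?G + (card ?A + card ?B)"
    using card_image_le[OF fAB(2), of prod.swap] by linarith
  finally have "real (card S) \<le> real (card ?G) + (real (card ?A) + real (card ?B))" by linarith
  then show ?thesis using A B by linarith
qed

text \<open>A triple \<open>c a b\<close> whose ends have at least \<open>N\<close> common
  neighbours extends to at least \<open>N\<close> members of \<open>four_cycles E\<close>, so
  \<open>N\<close> times the number of such triples is at most \<open>q * n * D\<^sup>2\<close>. The
  further end \<open>p\<close> costs a factor \<open>D\<close>.\<close>

lemma card_heavy_paths_le:
  fixes q :: real
  assumes "real (card (four_cycles E)) \<le> q * n * D\<^sup>2" "0 < N"
  shows "real N * real (card {(p, c, a, b). (c, p) \<in> E \<and> (c, a) \<in> E \<and> (b, a) \<in> E \<and> N \<le> card (E `` {c} \<inter> E `` {b})})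
     \<le> q * n * D ^ 3"
proof -
  define H where "H = {(c, a, b). (c, a) \<in> E \<and> (b, a) \<in> E \<and> N \<le> card (E `` {c} \<inter> E `` {b})}"
  have fH: "finite H"
    by (rule finite_subset[of _ "X \<times> Y \<times> X"]) (use finite_parts edges_parts in \<open>auto simp: H_def\<close>)
  let ?C = "\<lambda>(c, a, b). E `` {c} \<inter> E `` {b}"
  have "real (card H) * real N \<le> real (card (Sigma H ?C))"
    using fH by (intro card_Sigma_ge_real) (auto simp: H_def)
  also have "card (Sigma H ?C) \<le> card (four_cycles E)"
  proof (rule card_inj_on_le[of "\<lambda>((c, a, b), y). (c, b, a, y)"])
    show "inj_on (\<lambda>((c, a, b), y). (c, b, a, y)) (Sigma H ?C)" by (auto simp: inj_on_def)
    show "(\<lambda>((c, a, b), y). (c, b, a, y)) ` Sigma H ?C \<subseteq> four_cycles E"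
      unfolding H_def four_cycles_def by auto
  qed (rule finite_four_cycles)
  finally have 1: "real (card H) * real N \<le> q * n * D\<^sup>2" using assms(1) by linarith
  let ?P = "{(p, c, a, b). (c, p) \<in> E \<and> (c, a) \<in> E \<and> (b, a) \<in> E \<and> N \<le> card (E `` {c} \<inter> E `` {b})}"
  let ?D = "\<lambda>(c, a, b). E `` {c}"
  have fS: "finite (Sigma H ?D)" using fH by auto
  have "?P \<subseteq> (\<lambda>((c, a, b), p). (p, c, a, b)) ` Sigma H ?D"
  proof
    fix z assume "z \<in> ?P"
    then obtain p c a b where "z = (p, c, a, b)" "((c, a, b), p) \<in> Sigma H ?D" unfolding H_def by auto
    then show "z \<in> (\<lambda>((c, a, b), p). (p, c, a, b)) ` Sigma H ?D" by force
  qed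
  moreover have "real (card (Sigma H ?D)) \<le> real (card H) * D"
    using fH degree_left by (intro card_Sigma_le_real) auto
  ultimately have "real (card ?P) \<le> real (card H) * D"
    using card_le_of_image[OF fS] by blast
  then have "real N * real (card ?P) \<le> real N * (real (card H) * D)"
    by (intro mult_left_mono) auto
  also have "\<dots> = (real (card H) * real N) * D" by simp
  also have "\<dots> \<le> (q * n * D\<^sup>2) * D" using 1 D_pos by (intro mult_right_mono) auto
  finally show ?thesis by (simp add: power2_eq_square power3_eq_cube mult.assoc)
qed

text \<open>Middle edges with both degrees at least \<open>\<kappa> / 4 * D\<close> give
  \<open>\<kappa> ^ 3 / 32 * n * D ^ 3\<close> paths. The condition on \<open>N\<close> limits the
  paths with a heavy pair of either kind to \<open>\<kappa> ^ 3 / 128 * n * D ^ 3\<close>, so at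
  least half of that number remain.\<close>

lemma card_light_paths_ge:
  fixes q \<kappa> :: real
  assumes C4: "real (card (four_cycles E)) \<le> q * n * D\<^sup>2" and N: "0 < N" "128 * q \<le> \<kappa> ^ 3 * real N"
    and E: "\<kappa> * n * D \<le> real (card E)" and "0 < \<kappa>"
  shows "\<kappa> ^ 3 / 64 * n * D ^ 3 \<le> real (card (light_paths E N))"
proof -
  let ?T = "{(p, c, a, b). (c, p) \<in> E \<and> (c, a) \<in> E \<and> (b, a) \<in> E}"
  let ?H1 = "{(p, c, a, b). (c, p) \<in> E \<and> (c, a) \<in> E \<and> (b, a) \<in> E \<and> N \<le> card (E `` {c} \<inter> E `` {b})}"
  \<comment> \<open>The tuples are written from the other end, so that this is the set
    \<open>?H1\<close> of the converse relation.\<close>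
  let ?H2 = "{(b, a, c, p). (c, p) \<in> E \<and> (c, a) \<in> E \<and> (b, a) \<in> E \<and> N \<le> card (E\<inverse> `` {p} \<inter> E\<inverse> `` {a})}"
  have fT: "finite ?T"
    by (rule finite_subset[of _ "Y \<times> X \<times> Y \<times> X"]) (use finite_parts edges_parts in auto)
  have fH1: "finite ?H1" by (rule finite_subset[OF _ fT]) auto
  have fH2: "finite ?H2"
    by (rule finite_subset[of _ "X \<times> Y \<times> X \<times> Y"]) (use finite_parts edges_parts in auto)
  define t where "t = \<kappa> / 4 * D"
  have t: "0 \<le> t" unfolding t_def using assms D_pos by simp
  let ?G = "{(x, y) \<in> E. t \<le> real (card (E `` {x})) \<and> t \<le> real (card (E\<inverse> `` {y}))}"
  have fG: "finite ?G" by (rule finite_subset[OF _ finite_edges]) auto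
  have "real (card E) - 2 * n * t \<le> real (card ?G)"
    using t by (rule card_high_degree_edges) simp
  then have G: "\<kappa> / 2 * n * D \<le> real (card ?G)" using E unfolding t_def by (simp add: algebra_simps)
  have "real (card ?G) * t\<^sup>2 \<le> real (card ?T)"
    by (rule card_paths_through_edges[where L = "\<lambda>c a. E `` {c}" and R = "\<lambda>c a. E\<inverse> `` {a}"])
      (use fG fT t in auto)
  moreover have "\<kappa> / 2 * n * D * t\<^sup>2 \<le> real (card ?G) * t\<^sup>2"
    using G by (intro mult_right_mono) auto
  moreover have "\<kappa> / 2 * n * D * t\<^sup>2 = \<kappa> ^ 3 / 32 * n * D ^ 3"
    unfolding t_def by (simp add: power2_eq_square power3_eq_cube)
  ultimately have T: "\<kappa> ^ 3 / 32 * n * D ^ 3 \<le> real (card ?T)" by linarith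
  have H1: "real N * real (card ?H1) \<le> q * n * D ^ 3"
    using C4 N(1) by (rule card_heavy_paths_le)
  have H2: "real N * real (card ?H2) \<le> q * n * D ^ 3"
  proof -
    interpret conv: bipartite_host "\<lambda>u v. adj v u" Y X "E\<inverse>" n D
      using finite_parts disjoint_parts edges_parts edges_adj card_parts n_pos D_pos degree_left degree_right
      by unfold_locales auto
    have "?H2 = {(p, c, a, b). (c, p) \<in> E\<inverse> \<and> (c, a) \<in> E\<inverse> \<and> (b, a) \<in> E\<inverse> \<and> N \<le> card (E\<inverse> `` {c} \<inter> E\<inverse> `` {b})}"
      by (auto simp: Int_commute)
    then show ?thesis
      using conv.card_heavy_paths_le[of q N] C4 N(1) by (simp add: card_four_cycles_converse)
  qed
  let ?s = "\<lambda>(b, a, c, p). (p, c, a, b)"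
  have fL: "finite (light_paths E N)"
    by (rule finite_subset[OF _ fT]) (auto simp: light_paths_def)
  have "?T \<subseteq> light_paths E N \<union> (?H1 \<union> ?s ` ?H2)"
  proof
    fix z assume "z \<in> ?T"
    then obtain p c a b where z: "z = (p, c, a, b)" "(c, p) \<in> E" "(c, a) \<in> E" "(b, a) \<in> E" by auto
    consider "N \<le> card (E `` {c} \<inter> E `` {b})" | "N \<le> card (E\<inverse> `` {p} \<inter> E\<inverse> `` {a})"
      | "card (E `` {c} \<inter> E `` {b}) < N" "card (E\<inverse> `` {p} \<inter> E\<inverse> `` {a}) < N" by linarith
    then show "z \<in> light_paths E N \<union> (?H1 \<union> ?s ` ?H2)"
    proof cases
      case 1
      then have "z \<in> ?H1" using z by simp
      then show ?thesis by blast
    next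
      case 2
      then have "(b, a, c, p) \<in> ?H2" using z by simp
      then have "?s (b, a, c, p) \<in> ?s ` ?H2" by (rule imageI)
      then show ?thesis using z by simp
    next
      case 3
      then have "z \<in> light_paths E N" using z by (simp add: light_paths_def)
      then show ?thesis by blast
    qed
  qed
  then have "card ?T \<le> card (light_paths E N \<union> (?H1 \<union> ?s ` ?H2))"
    using fL fH1 fH2 by (intro card_mono finite_UnI finite_imageI)
  also have "\<dots> \<le> card (light_paths E N) + (card ?H1 + card (?s ` ?H2))"
    using card_Un_le[of "light_paths E N" "?H1 \<union> ?s ` ?H2"] card_Un_le[of ?H1 "?s ` ?H2"] by linarith
  also have "\<dots> \<le> card (light_paths E N) + (card ?H1 + card ?H2)"
    using card_image_le[OF fH2, of ?s] by linarith
  finally have "real (card ?T) \<le> real (card (light_paths E N)) + (real (card ?H1) + real (card ?H2))" by linarith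
  moreover have small: "real c \<le> \<kappa> ^ 3 / 128 * (n * D ^ 3)" if "real N * real c \<le> q * n * D ^ 3" for c
  proof -
    have "128 * q * (n * D ^ 3) \<le> \<kappa> ^ 3 * real N * (n * D ^ 3)"
      using N(2) n_pos D_pos by (intro mult_right_mono) auto
    then have "real N * real c \<le> real N * (\<kappa> ^ 3 / 128 * (n * D ^ 3))"
      using that by (simp add: algebra_simps)
    then show ?thesis using N(1) by simp
  qed
  ultimately show ?thesis using T small[OF H1] small[OF H2] by (simp add: algebra_simps)
qed

text \<open>There are at most \<open>n * D\<^sup>2\<close> walks of length two centred on either
  side. A closed walk with \<open>y = y'\<close> is one centred at \<open>y\<close>; one with
  \<open>y' \<in> bad y x\<close> is such a walk with at most \<open>n2\<close> choices of
  \<open>y'\<close>; any other is a walk \<open>y x' y'\<close> with at most \<open>n1\<close>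
  choices of \<open>x\<close>.\<close>

lemma card_four_cycles_le:
  assumes bad: "\<And>y x. finite (bad y x) \<and> card (bad y x) \<le> n2"
    and few: "\<And>y y'. y \<noteq> y' \<Longrightarrow> card {x. (x, y) \<in> E \<and> (x, y') \<in> E \<and> y' \<notin> bad y x} \<le> n1"
  shows "real (card (four_cycles E)) \<le> real (n1 + n2 + 1) * n * D\<^sup>2"
proof -
  define W where "W = Sigma X (\<lambda>x. E `` {x} \<times> E `` {x})"
  define V where "V = Sigma Y (\<lambda>y. E\<inverse> `` {y} \<times> E\<inverse> `` {y})"
  have fWV: "finite W" "finite V" unfolding W_def V_def using finite_parts by auto
  have "real (card W) \<le> real (card X) * D\<^sup>2"
    unfolding W_def using finite_parts degree_left D_pos
    by (intro card_Sigma_le_real) (auto simp: card_cartesian_product power2_eq_square intro!: mult_mono)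
  also have "\<dots> \<le> n * D\<^sup>2" using card_parts by (intro mult_right_mono) auto
  finally have W: "real (card W) \<le> n * D\<^sup>2" .
  have "real (card V) \<le> real (card Y) * D\<^sup>2"
    unfolding V_def using finite_parts degree_right D_pos
    by (intro card_Sigma_le_real) (auto simp: card_cartesian_product power2_eq_square intro!: mult_mono)
  also have "\<dots> \<le> n * D\<^sup>2" using card_parts by (intro mult_right_mono) auto
  finally have V: "real (card V) \<le> n * D\<^sup>2" .
  define B where "B = (\<lambda>(x' :: 'a, y, y'). if y = y' then {} else {x. (x, y) \<in> E \<and> (x, y') \<in> E \<and> y' \<notin> bad y x})"
  have fB: "finite (B z)" and cB: "real (card (B z)) \<le> real n1" for z
  proof -
    obtain x' y y' where z: "z = (x', y, y')" by (cases z) auto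
    have "B z \<subseteq> E\<inverse> `` {y}" unfolding B_def z by auto
    then show "finite (B z)" by (rule finite_subset) simp
    show "real (card (B z)) \<le> real n1" using few[of y y'] unfolding B_def z by simp
  qed
  let ?bd = "\<lambda>(y, x, x' :: 'a). bad y x"
  let ?f1 = "\<lambda>(y, x, x'). (x, x', y, y)" and ?f2 = "\<lambda>((x', y, y'), x). (x, x', y, y')"
    and ?f3 = "\<lambda>((y, x, x'), y'). (x, x', y, y')"
  have fin: "finite (Sigma W B)" "finite (Sigma V ?bd)" using fWV fB bad by auto
  have "four_cycles E \<subseteq> ?f1 ` V \<union> (?f2 ` Sigma W B \<union> ?f3 ` Sigma V ?bd)"
  proof
    fix z assume "z \<in> four_cycles E"
    then obtain x x' y y' where z: "z = (x, x', y, y')" "(x, y) \<in> E" "(x, y') \<in> E" "(x', y) \<in> E" "(x', y') \<in> E"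
      unfolding four_cycles_def by auto
    have XY: "x' \<in> X" "y \<in> Y" using z edges_parts by auto
    consider "y = y'" | "y' \<in> bad y x" | "y \<noteq> y'" "y' \<notin> bad y x" by blast
    then show "z \<in> ?f1 ` V \<union> (?f2 ` Sigma W B \<union> ?f3 ` Sigma V ?bd)"
    proof cases
      case 1
      have "(y, x, x') \<in> V" unfolding V_def using z XY by simp
      then have "?f1 (y, x, x') \<in> ?f1 ` V" by (rule imageI)
      then show ?thesis using 1 z by simp
    next
      case 2
      have "((y, x, x'), y') \<in> Sigma V ?bd" unfolding V_def using 2 z XY by simp
      then have "?f3 ((y, x, x'), y') \<in> ?f3 ` Sigma V ?bd" by (rule imageI)
      then show ?thesis using z by simp
    next
      case 3
      have "((x', y, y'), x) \<in> Sigma W B" unfolding W_def B_def using 3 z XY by simp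
      then have "?f2 ((x', y, y'), x) \<in> ?f2 ` Sigma W B" by (rule imageI)
      then show ?thesis using z by simp
    qed
  qed
  then have "card (four_cycles E) \<le> card (?f1 ` V \<union> (?f2 ` Sigma W B \<union> ?f3 ` Sigma V ?bd))"
    using fin fWV by (intro card_mono finite_UnI finite_imageI)
  also have "\<dots> \<le> card (?f1 ` V) + (card (?f2 ` Sigma W B) + card (?f3 ` Sigma V ?bd))"
    using card_Un_le[of "?f1 ` V" "?f2 ` Sigma W B \<union> ?f3 ` Sigma V ?bd"]
      card_Un_le[of "?f2 ` Sigma W B" "?f3 ` Sigma V ?bd"] by linarith
  also have "\<dots> \<le> card V + (card (Sigma W B) + card (Sigma V ?bd))"
    using fin fWV by (intro add_mono card_image_le)
  finally have "real (card (four_cycles E)) \<le> real (card V) + (real (card (Sigma W B)) + real (card (Sigma V ?bd)))" by linarith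
  moreover have "real (card (Sigma W B)) \<le> n * D\<^sup>2 * real n1"
  proof -
    have "real (card (Sigma W B)) \<le> real (card W) * real n1"
      using fWV fB cB by (intro card_Sigma_le_real) auto
    also have "\<dots> \<le> n * D\<^sup>2 * real n1" using W by (intro mult_right_mono) auto
    finally show ?thesis .
  qed
  moreover have "real (card (Sigma V ?bd)) \<le> n * D\<^sup>2 * real n2"
  proof -
    have "real (card (Sigma V ?bd)) \<le> real (card V) * real n2"
      using fWV bad by (intro card_Sigma_le_real) auto
    also have "\<dots> \<le> n * D\<^sup>2 * real n2" using V by (intro mult_right_mono) auto
    finally show ?thesis .
  qed
  ultimately show ?thesis using V by (simp add: algebra_simps)
qed

end

section \<open>The dichotomy between light paths and heavy edges\<close>

lemma induced_power_of_almost_regular: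
  fixes \<kappa> :: real
  assumes "0 < \<kappa>"
  shows "\<exists>C D0 :: real. \<forall>(adj :: 'a \<Rightarrow> 'a \<Rightarrow> bool) X Y E n D. biclique_free s adj \<longrightarrow>
    bipartite_host adj X Y E n D \<longrightarrow> D0 \<le> D \<longrightarrow> C * n ^ r \<le> D ^ (2 * r + 1) \<longrightarrow>
    \<kappa> * n * D \<le> real (card E) \<longrightarrow> induced_power adj r l X Y \<or> induced_power adj r l Y X"
proof -
  \<comment> \<open>Half of the degree threshold \<open>\<kappa> / 16\<close> imposed on middle
    edges below, so that discarding fewer than \<open>d * D\<close> heavy partners leaves
    \<open>\<kappa> / 32 * D\<close> candidates for each end.\<close>
  define d where "d = \<kappa> / 32"
  have d: "0 < d" unfolding d_def using assms by simp
  obtain k n1 n2 :: nat and D1 :: real where heavy: "\<forall>(adj :: 'a \<Rightarrow> 'a \<Rightarrow> bool) X Y E n D.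
    biclique_free s adj \<longrightarrow> bipartite_host adj X Y E n D \<longrightarrow> D1 \<le> D \<longrightarrow> \<not> induced_power adj r l X Y \<longrightarrow>
    (\<exists>bad. (\<forall>y x. finite (bad y x) \<and> card (bad y x) \<le> n2) \<and>
      (\<forall>y y'. y \<noteq> y' \<longrightarrow>
        card {x. (x, y) \<in> E \<and> (x, y') \<in> E \<and> d * D \<le> real (card (heavy_nbrs E k x y)) \<and> y' \<notin> bad y x} < n1))"
    using few_heavy_common_nbrs[OF d, of s r l] by (elim exE) (rule that)
  define \<kappa>1 where "\<kappa>1 = \<kappa> / 4"
  have \<kappa>1: "0 < \<kappa>1" unfolding \<kappa>1_def using assms by simp
  define q where "q = real (n1 + n2 + 1)"
  \<comment> \<open>One \<open>N\<close> serves both cases: \<open>N \<ge> k\<close> is used when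
    heavy edges are rare, and the last summand is what \<open>card_light_paths_ge\<close> requires
    of a graph with few four-cycles.\<close>
  define N where "N = k + 1 + nat \<lceil>128 * q / \<kappa>1 ^ 3\<rceil>"
  have N: "k \<le> N" "0 < N" unfolding N_def by simp_all
  have Nq: "128 * q \<le> \<kappa>1 ^ 3 * real N"
  proof -
    have "128 * q / \<kappa>1 ^ 3 \<le> real N" unfolding N_def by linarith
    then show ?thesis using \<kappa>1 by (simp add: field_simps)
  qed
  \<comment> \<open>The densities of light paths obtained in the two cases; the second is
    \<open>\<kappa> / 4 * (\<kappa> / 32)\<^sup>2\<close>.\<close>
  define \<beta> where "\<beta> = min (\<kappa>1 ^ 3 / 64) (\<kappa> ^ 3 / 4096)"
  have \<beta>: "0 < \<beta>" "\<beta> \<le> \<kappa>1 ^ 3 / 64" "\<beta> \<le> \<kappa> ^ 3 / 4096" unfolding \<beta>_def using assms \<kappa>1 by simp_all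
  obtain C D2 :: real where light: "\<forall>(adj :: 'a \<Rightarrow> 'a \<Rightarrow> bool) X Y E n D. biclique_free s adj \<longrightarrow>
    bipartite_host adj X Y E n D \<longrightarrow> D2 \<le> D \<longrightarrow> C * n ^ r \<le> D ^ (2 * r + 1) \<longrightarrow>
    \<beta> * n * D ^ 3 \<le> real (card (light_paths E N)) \<longrightarrow> induced_power adj r l X Y"
    using induced_power_of_light_paths[OF \<beta>(1), of s r N l] by (elim exE) (rule that)
  define D0 where "D0 = max D1 D2"
  have scale: "\<beta> * n * D ^ 3 \<le> b * n * D ^ 3" if "bipartite_host adj X Y E n D" "\<beta> \<le> b"
    for adj :: "'a \<Rightarrow> 'a \<Rightarrow> bool" and X Y E n D b
  proof -
    interpret bipartite_host adj X Y E n D by fact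
    show ?thesis using that(2) n_pos D_pos by (intro mult_right_mono) auto
  qed
  have good: "induced_power adj r l X Y"
    if free: "biclique_free s adj" and host: "bipartite_host adj X Y E n D" and D: "D0 \<le> D"
      and C: "C * n ^ r \<le> D ^ (2 * r + 1)"
      and big: "\<kappa>1 * n * D \<le> real (card {(x, y) \<in> E. d * D \<le> real (card (heavy_nbrs E k x y))})"
    for adj :: "'a \<Rightarrow> 'a \<Rightarrow> bool" and X Y E n D
  proof (rule ccontr)
    assume noH: "\<not> ?thesis"
    \<comment> \<open>Heaviness is measured in \<open>E\<close>, but four-cycles and light paths are
      counted in \<open>E1\<close>, which is a host with the same \<open>n\<close> and
      \<open>D\<close>.\<close>
    define E1 where "E1 = {(x, y) \<in> E. d * D \<le> real (card (heavy_nbrs E k x y))}"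
    have host1: "bipartite_host adj X Y E1 n D"
      using host by (rule bipartite_host_subset) (auto simp: E1_def)
    interpret bipartite_host adj X Y E n D by fact
    interpret h1: bipartite_host adj X Y E1 n D by fact
    have D12: "D1 \<le> D" "D2 \<le> D" using D unfolding D0_def by auto
    obtain bad where bad: "\<forall>y x. finite (bad y x) \<and> card (bad y x) \<le> n2" and few: "\<forall>y y'. y \<noteq> y' \<longrightarrow>
        card {x. (x, y) \<in> E \<and> (x, y') \<in> E \<and> d * D \<le> real (card (heavy_nbrs E k x y)) \<and> y' \<notin> bad y x} < n1"
      using heavy[rule_format, OF free host D12(1) noH] by (elim exE conjE) (rule that)
    have "card {x. (x, y) \<in> E1 \<and> (x, y') \<in> E1 \<and> y' \<notin> bad y x} \<le> n1" if "y \<noteq> y'" for y y'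
    proof -
      let ?A = "{x. (x, y) \<in> E \<and> (x, y') \<in> E \<and> d * D \<le> real (card (heavy_nbrs E k x y)) \<and> y' \<notin> bad y x}"
      have "?A \<subseteq> E\<inverse> `` {y}" by auto
      then have "finite ?A" by (rule finite_subset) simp
      moreover have "{x. (x, y) \<in> E1 \<and> (x, y') \<in> E1 \<and> y' \<notin> bad y x} \<subseteq> ?A"
        unfolding E1_def by auto
      ultimately have "card {x. (x, y) \<in> E1 \<and> (x, y') \<in> E1 \<and> y' \<notin> bad y x} \<le> card ?A"
        by (rule card_mono)
      then show ?thesis using few that by (meson le_less_trans less_imp_le)
    qed
    then have "real (card (four_cycles E1)) \<le> q * n * D\<^sup>2"
      unfolding q_def using bad by (intro h1.card_four_cycles_le[of bad n2 n1]) auto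
    then have "\<kappa>1 ^ 3 / 64 * n * D ^ 3 \<le> real (card (light_paths E1 N))"
      using N(2) Nq big[folded E1_def] \<kappa>1 by (rule h1.card_light_paths_ge)
    then have "\<beta> * n * D ^ 3 \<le> real (card (light_paths E1 N))"
      using scale[OF host1 \<beta>(2)] by linarith
    then show False using light[rule_format, OF free host1 D12(2) C] noH by simp
  qed
  have main: "induced_power adj r l X Y \<or> induced_power adj r l Y X"
    if free: "biclique_free s adj" and host: "bipartite_host adj X Y E n D" and D: "D0 \<le> D"
      and C: "C * n ^ r \<le> D ^ (2 * r + 1)" and E: "\<kappa> * n * D \<le> real (card E)"
    for adj :: "'a \<Rightarrow> 'a \<Rightarrow> bool" and X Y E n D
  proof (rule ccontr)
    assume no: "\<not> ?thesis"
    interpret bipartite_host adj X Y E n D by fact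
    have host': "bipartite_host adj Y X (E\<inverse>) n D" using host free by (rule bipartite_host_converse)
    define EY where "EY = {(x, y) \<in> E. d * D \<le> real (card (heavy_nbrs E k x y))}"
    \<comment> \<open>The same notion with the sides exchanged; if \<open>EC\<close> were dense, the
      power would appear with its centres in \<open>Y\<close>.\<close>
    define EC where "EC = {(y, x) \<in> E\<inverse>. d * D \<le> real (card (heavy_nbrs (E\<inverse>) k y x))}"
    have EY: "real (card EY) < \<kappa>1 * n * D"
      using good[OF free host D C] no unfolding EY_def by force
    have EC: "real (card EC) < \<kappa>1 * n * D"
      using good[OF free host' D C] no unfolding EC_def by force
    define S where "S = E - EY - EC\<inverse>"
    have fin: "finite EY" "finite EC" "finite S"
      unfolding EY_def EC_def S_def using finite_edges by (auto intro: finite_subset[of _ E] finite_subset[of _ "E\<inverse>"])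
    have "card E \<le> card (S \<union> (EY \<union> EC\<inverse>))"
      using fin by (intro card_mono) (auto simp: S_def)
    also have "\<dots> \<le> card S + (card EY + card (EC\<inverse>))"
      using card_Un_le[of S "EY \<union> EC\<inverse>"] card_Un_le[of EY "EC\<inverse>"] by linarith
    finally have "real (card E) \<le> real (card S) + (real (card EY) + real (card EC))"
      by simp
    then have S: "\<kappa> / 2 * n * D \<le> real (card S)" using E EC EY unfolding \<kappa>1_def by (simp add: algebra_simps)
    define t where "t = \<kappa> / 16 * D"
    have t: "0 \<le> t" unfolding t_def using assms D_pos by simp
    define G where "G = {(x, y) \<in> S. t \<le> real (card (E `` {x})) \<and> t \<le> real (card (E\<inverse> `` {y}))}"
    have fG: "finite G" by (rule finite_subset[OF _ fin(3)]) (auto simp: G_def)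
    have "real (card S) - 2 * n * t \<le> real (card G)"
      unfolding G_def using t by (rule card_high_degree_edges) (auto simp: S_def)
    moreover have "\<kappa> / 4 * n * D \<le> \<kappa> / 2 * n * D - 2 * n * t"
      unfolding t_def using assms n_pos D_pos by (simp add: algebra_simps)
    ultimately have G: "\<kappa> / 4 * n * D \<le> real (card G)" using S by linarith
    define u where "u = \<kappa> / 32 * D"
    have u: "0 \<le> u" "t - d * D = u" unfolding u_def t_def d_def using assms D_pos by (simp_all add: algebra_simps)
    \<comment> \<open>For a middle edge \<open>(c, a)\<close> outside both kinds of heavy edges,
      \<open>p\<close> avoids the heavy partners of \<open>a\<close> and the other end avoids those
      of \<open>c\<close>. These are the two lightness conditions.\<close>
    have "real (card G) * u\<^sup>2 \<le> real (card (light_paths E k))"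
    proof (rule card_paths_through_edges[where L = "\<lambda>c a. E `` {c} - heavy_nbrs (E\<inverse>) k a c"
          and R = "\<lambda>c a. E\<inverse> `` {a} - heavy_nbrs E k c a"])
      show "finite (light_paths E k)"
        by (rule finite_subset[of _ "Y \<times> X \<times> Y \<times> X"]) (use finite_parts edges_parts in \<open>auto simp: light_paths_def\<close>)
      have diff: "u \<le> real (card (A - B))" if "finite A" "B \<subseteq> A" "t \<le> real (card A)" "real (card B) < d * D" for A B :: "'a set"
      proof -
        have "card A \<le> card (A - B) + card B"
          using card_Un_le[of "A - B" B] that(2) by (simp add: Un_absorb2)
        then show ?thesis using that(3,4) u(2) by linarith
      qed
      fix c a assume ca: "(c, a) \<in> G"
      then have e: "(c, a) \<in> E" "(c, a) \<notin> EY" "(a, c) \<notin> EC"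
        unfolding G_def S_def by auto
      show "finite (E `` {c} - heavy_nbrs (E\<inverse>) k a c) \<and> u \<le> real (card (E `` {c} - heavy_nbrs (E\<inverse>) k a c))"
        using ca e unfolding G_def EC_def by (intro conjI diff) (auto simp: heavy_nbrs_def)
      show "finite (E\<inverse> `` {a} - heavy_nbrs E k c a) \<and> u \<le> real (card (E\<inverse> `` {a} - heavy_nbrs E k c a))"
        using ca e unfolding G_def EY_def by (intro conjI diff) (auto simp: heavy_nbrs_def)
      fix p b assume "p \<in> E `` {c} - heavy_nbrs (E\<inverse>) k a c" "b \<in> E\<inverse> `` {a} - heavy_nbrs E k c a"
      then show "(p, c, a, b) \<in> light_paths E k"
        using e(1) unfolding light_paths_def heavy_nbrs_def by (auto simp: Int_commute not_le)
    qed (use fG u in auto)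
    moreover have "\<kappa> / 4 * n * D * u\<^sup>2 \<le> real (card G) * u\<^sup>2"
      using G by (intro mult_right_mono) auto
    moreover have "\<kappa> / 4 * n * D * u\<^sup>2 = \<kappa> ^ 3 / 4096 * n * D ^ 3"
      unfolding u_def by (simp add: power2_eq_square power3_eq_cube)
    moreover have "card (light_paths E k) \<le> card (light_paths E N)"
    proof (rule card_mono[OF _ light_paths_mono[OF N(1)]])
      show "finite (light_paths E N)"
        by (rule finite_subset[of _ "Y \<times> X \<times> Y \<times> X"]) (use finite_parts edges_parts in \<open>auto simp: light_paths_def\<close>)
    qed
    ultimately have "\<beta> * n * D ^ 3 \<le> real (card (light_paths E N))"
      using scale[OF host \<beta>(3)] by linarith
    moreover have "D2 \<le> D" using D unfolding D0_def by simp
    ultimately show False using light[rule_format, OF free host _ C] no by simp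
  qed
  show ?thesis by (intro exI[of _ C] exI[of _ D0] allI impI) (rule main)
qed

section \<open>Passing to an almost regular subgraph\<close>

text \<open>Downward induction on \<open>k\<close>: dropping an element of least weight does not
  lower the average weight.\<close>

lemma heaviest_subset:
  fixes g :: "'a \<Rightarrow> nat"
  assumes "finite W" "k \<le> card W"
  obtains U where "U \<subseteq> W" "card U = k" "k * sum g W \<le> card W * sum g U"
proof -
  have "\<exists>U. U \<subseteq> W \<and> card U = k \<and> k * sum g W \<le> card W * sum g U"
    using assms
  proof (induction "card W - k" arbitrary: k)
    case 0
    then have "card W = k" by simp
    then show ?case by (intro exI[of _ W]) simp
  next
    case (Suc j)
    then have "j = card W - Suc k" "Suc k \<le> card W" by auto
    then obtain U where U: "U \<subseteq> W" "card U = Suc k" "Suc k * sum g W \<le> card W * sum g U"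
      using Suc.hyps(1)[of "Suc k"] Suc.prems by blast
    have fU: "finite U" "U \<noteq> {}" using U(2) by (auto intro: card_ge_0_finite)
    define u where "u = arg_min_on g U"
    have u: "u \<in> U" "\<And>v. v \<in> U \<Longrightarrow> g u \<le> g v"
      unfolding u_def using arg_min_if_finite[OF fU, of g] arg_min_least[OF fU] by auto
    have "Suc k * g u \<le> sum g U"
      using sum_mono[of U "\<lambda>_. g u" g] u(2) U(2) by simp
    moreover have split: "sum g U = g u + sum g (U - {u})" using fU u(1) by (simp add: sum.remove)
    ultimately have "k * g u \<le> sum g (U - {u})" by simp
    then have "k * sum g U \<le> Suc k * sum g (U - {u})" unfolding split by (simp add: algebra_simps)
    then have le: "card W * (k * sum g U) \<le> card W * (Suc k * sum g (U - {u}))" by (rule mult_le_mono2)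
    have "Suc k * (k * sum g W) = k * (Suc k * sum g W)" by (rule mult.left_commute)
    also have "\<dots> \<le> k * (card W * sum g U)" using U(3) by (rule mult_le_mono2)
    also have "\<dots> = card W * (k * sum g U)" by (rule mult.left_commute)
    also note le
    also have "card W * (Suc k * sum g (U - {u})) = Suc k * (card W * sum g (U - {u}))" by (rule mult.left_commute)
    finally have "Suc k * (k * sum g W) \<le> Suc k * (card W * sum g (U - {u}))" .
    then have "k * sum g W \<le> card W * sum g (U - {u})" by (simp only: mult_le_cancel1)
    moreover have "U - {u} \<subseteq> W" "card (U - {u}) = k" using U u(1) fU by auto
    ultimately show ?case by blast
  qed
  then show ?thesis using that by blast
qed

text \<open>\<open>W\<close> maximises the number of spanned edges divided by
  \<open>card W powr (1 + \<alpha>)\<close>. Its vertices of degree above \<open>T * e / m\<close>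
  form a set \<open>A\<close> of at most \<open>2 * m / T\<close> vertices. If they met half of the
  edges, averaging would give a similarly small set \<open>U\<close> such that
  \<open>A \<union> U\<close> spans more edges than maximality permits; so deleting all edges at
  \<open>A\<close> keeps more than half. The size of \<open>W\<close> is not controlled, but the
  density bound is relative to \<open>card W\<close>.\<close>

lemma almost_regular_subgraph:
  fixes \<alpha> :: real
  assumes "0 < \<alpha>" "\<alpha> < 1"
  shows "\<exists>T::real. 1 \<le> T \<and> (\<forall>(V :: 'a set) E C. finite V \<longrightarrow> E \<subseteq> V \<times> V \<longrightarrow> E \<noteq> {} \<longrightarrow> T \<le> C \<longrightarrow>
    C * real (card V) powr (1 + \<alpha>) \<le> real (card E) \<longrightarrow>
    (\<exists>W E'. W \<subseteq> V \<and> W \<noteq> {} \<and> E' \<subseteq> E \<inter> W \<times> W \<and> C / 2 * real (card W) powr (1 + \<alpha>) \<le> real (card E') \<and>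
      (\<forall>x. real (card (E' `` {x})) \<le> 2 * T * real (card E') / real (card W)) \<and>
      (\<forall>y. real (card (E'\<inverse> `` {y})) \<le> 2 * T * real (card E') / real (card W))))"
proof -
  \<comment> \<open>Maximality will be contradicted through
    \<open>1 / 4 \<le> (8 / T) powr \<alpha>\<close>; this \<open>T\<close> makes the right-hand
    side equal to \<open>1 / 5\<close>.\<close>
  define T where "T = 8 * 5 powr (1 / \<alpha>)"
  have T8: "8 \<le> T" unfolding T_def using assms by (simp add: ge_one_powr_ge_zero)
  have T\<alpha>: "(8 / T) powr \<alpha> = 1 / 5"
  proof -
    have "(5 powr (1 / \<alpha>)) powr \<alpha> = (5::real)" using assms by (simp add: powr_powr)
    moreover have "8 / T = 1 / 5 powr (1 / \<alpha>)" unfolding T_def by simp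
    ultimately show ?thesis by (simp add: powr_divide)
  qed
  have main: "\<exists>W E'. W \<subseteq> V \<and> W \<noteq> {} \<and> E' \<subseteq> E \<inter> W \<times> W \<and> C / 2 * real (card W) powr (1 + \<alpha>) \<le> real (card E') \<and>
      (\<forall>x. real (card (E' `` {x})) \<le> 2 * T * real (card E') / real (card W)) \<and>
      (\<forall>y. real (card (E'\<inverse> `` {y})) \<le> 2 * T * real (card E') / real (card W))"
    if V: "finite V" and EV: "E \<subseteq> V \<times> V" and E0: "E \<noteq> {}" and C: "T \<le> C"
      and CE: "C * real (card V) powr (1 + \<alpha>) \<le> real (card E)" for V :: "'a set" and E C
  proof -
    have V0: "V \<noteq> {}" using EV E0 by auto
    have fE: "finite E" using EV V finite_subset by blast
    define ew where "ew = (\<lambda>W. real (card (E \<inter> W \<times> W)))"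
    define \<rho> where "\<rho> = (\<lambda>W. ew W / real (card W) powr (1 + \<alpha>))"
    let ?S = "Pow V - {{}}"
    have fS: "finite ?S" "?S \<noteq> {}" using V V0 by auto
    have "Max (\<rho> ` ?S) \<in> \<rho> ` ?S" using fS by (intro Max_in) auto
    then obtain W where "Max (\<rho> ` ?S) = \<rho> W" and WS: "W \<in> ?S" by (rule imageE)
    then have Wmax: "\<rho> W' \<le> \<rho> W" if "W' \<in> ?S" for W'
      using Max_ge[of "\<rho> ` ?S" "\<rho> W'"] fS that by simp
    have W: "W \<subseteq> V" "W \<noteq> {}" "finite W" using WS V finite_subset by auto
    define m where "m = real (card W)"
    have m0: "0 < m" unfolding m_def using W by (simp add: card_gt_0_iff)
    have m1: "1 \<le> m" using m0 unfolding m_def by (simp add: Suc_le_eq)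
    define F where "F = E \<inter> W \<times> W"
    have fF: "finite F" unfolding F_def using fE by simp
    define e where "e = real (card F)"
    have \<rho>W: "\<rho> W = e / m powr (1 + \<alpha>)" unfolding \<rho>_def ew_def e_def F_def m_def by simp
    have "C \<le> \<rho> V"
    proof -
      have "E \<inter> V \<times> V = E" using EV by auto
      then show ?thesis using CE V V0 unfolding \<rho>_def ew_def by (simp add: field_simps card_gt_0_iff)
    qed
    also have "\<dots> \<le> \<rho> W" using Wmax V0 by auto
    finally have Ce: "C * m powr (1 + \<alpha>) \<le> e" using m0 unfolding \<rho>W by (simp add: field_simps)
    have C8: "8 \<le> C" using C T8 by simp
    have e0: "0 < e"
    proof -
      have "0 < C * m powr (1 + \<alpha>)" using C8 m0 by simp
      then show ?thesis using Ce by linarith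
    qed
    \<comment> \<open>Since \<open>W\<close> spans at most \<open>m * m\<close> pairs, its density
      forces \<open>m \<ge> C \<ge> T\<close>. This absorbs the rounding in \<open>k\<close>
      below.\<close>
    have mT: "T \<le> m"
    proof -
      have "card F \<le> card (W \<times> W)" unfolding F_def using W by (intro card_mono) auto
      then have "e \<le> m * m" unfolding e_def m_def by (simp add: card_cartesian_product flip: of_nat_mult)
      then have "C * m powr (1 + \<alpha>) \<le> m * m" using Ce by linarith
      moreover have "m powr (1 + \<alpha>) = m * m powr \<alpha>" using m0 by (simp add: powr_add)
      ultimately have "m * (C * m powr \<alpha>) \<le> m * m" by (simp add: mult_ac)
      then have "C * m powr \<alpha> \<le> m" using m0 by simp
      moreover have "C * 1 \<le> C * m powr \<alpha>" using m1 assms C8 by (intro mult_left_mono ge_one_powr_ge_zero) auto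
      ultimately show ?thesis using C by linarith
    qed
    define deg where "deg = (\<lambda>v. card (F `` {v}) + card (F\<inverse> `` {v}))"
    have fim [simp]: "finite (F `` {v})" "finite (F\<inverse> `` {v})" for v using fF by (auto intro: finite_Image)
    have "F = Sigma W (\<lambda>v. F `` {v})" unfolding F_def by auto
    then have s1: "card F = (\<Sum>v\<in>W. card (F `` {v}))" using card_SigmaI[of W "\<lambda>v. F `` {v}"] W by simp
    have "F\<inverse> = Sigma W (\<lambda>v. F\<inverse> `` {v})" unfolding F_def by auto
    then have s2: "card (F\<inverse>) = (\<Sum>v\<in>W. card (F\<inverse> `` {v}))" using card_SigmaI[of W "\<lambda>v. F\<inverse> `` {v}"] W by simp
    have sdeg: "(\<Sum>v\<in>W. deg v) = 2 * card F" unfolding deg_def sum.distrib using s1 s2 by simp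
    define A where "A = {v \<in> W. T * e / m < real (deg v)}"
    have fA: "finite A" "A \<subseteq> W" unfolding A_def using W by auto
    have cA: "real (card A) \<le> 2 * m / T"
    proof -
      have "real (card A) * (T * e / m) = (\<Sum>v\<in>A. T * e / m)" by simp
      also have "\<dots> \<le> (\<Sum>v\<in>A. real (deg v))" unfolding A_def by (intro sum_mono) auto
      also have "\<dots> \<le> (\<Sum>v\<in>W. real (deg v))" using fA W by (intro sum_mono2) auto
      also have "\<dots> = 2 * e" unfolding e_def by (simp flip: of_nat_sum add: sdeg)
      finally show ?thesis using e0 m0 T8 by (simp add: field_simps)
    qed
    define FA where "FA = {(x, y) \<in> F. x \<in> A \<or> y \<in> A}"
    have fFA: "finite FA" by (rule finite_subset[OF _ fF]) (auto simp: FA_def)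
    have small: "real (card FA) < e / 2"
    proof (rule ccontr)
      assume "\<not> ?thesis"
      then have big: "e / 2 \<le> real (card FA)" by simp
      define k where "k = nat \<lceil>2 * m / T\<rceil>"
      have k1: "2 * m / T \<le> real k" unfolding k_def by linarith
      have pos: "0 < 2 * m / T" using m0 T8 by simp
      have k2: "real k < 2 * m / T + 1" unfolding k_def using pos by linarith
      have k3: "real k \<le> 4 * m / T"
      proof -
        have "1 \<le> m / T" using mT T8 by simp
        then show ?thesis using k2 by simp
      qed
      have k0: "0 < real k" using pos k1 by linarith
      have kW: "k \<le> card W"
      proof -
        have "2 * m / T \<le> m" using T8 m0 by (simp add: field_simps)
        then have "2 * m / T \<le> real (card W)" unfolding m_def .
        then show ?thesis unfolding k_def by linarith
      qed
      \<comment> \<open>Every edge at \<open>A\<close> is charged to an endpoint whose partner lies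
        in \<open>A\<close>. The \<open>k\<close> most charged vertices receive at least a
        \<open>k / m\<close> share of these edges, all of which are spanned by
        \<open>A \<union> U\<close>.\<close>
      define h where "h = (\<lambda>(x, y). if x \<in> A then y else x)"
      define g where "g = (\<lambda>u. card {z \<in> FA. h z = u})"
      have hW: "h z \<in> W" if "z \<in> FA" for z using that unfolding FA_def F_def h_def by auto
      have part: "card {z \<in> FA. h z \<in> U} = sum g U" if "finite U" for U
      proof -
        have "{z \<in> FA. h z \<in> U} = (\<Union>u\<in>U. {z \<in> FA. h z = u})" by auto
        also have "card \<dots> = (\<Sum>u\<in>U. card {z \<in> FA. h z = u})"
          using that fFA by (intro card_UN_disjoint) auto
        finally show ?thesis unfolding g_def .
      qed
      obtain U where U: "U \<subseteq> W" "card U = k" "k * sum g W \<le> card W * sum g U"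
        using heaviest_subset[OF W(3) kW] by blast
      have fU: "finite U" using U W finite_subset by blast
      have "{z \<in> FA. h z \<in> W} = FA" using hW by auto
      then have gW: "sum g W = card FA" using part[OF W(3)] by simp
      have "{z \<in> FA. h z \<in> U} \<subseteq> E \<inter> (A \<union> U) \<times> (A \<union> U)"
        unfolding FA_def F_def h_def by (auto split: if_splits)
      then have "card {z \<in> FA. h z \<in> U} \<le> card (E \<inter> (A \<union> U) \<times> (A \<union> U))"
        using fE by (intro card_mono) auto
      then have gU: "real (sum g U) \<le> ew (A \<union> U)" unfolding ew_def part[OF fU] by (simp only: of_nat_le_iff)
      have AU: "A \<union> U \<in> ?S" using fA U W k0 by auto
      have cAU: "real (card (A \<union> U)) \<le> 2 * real k"
        using card_Un_le[of A U] U(2) cA k1 by linarith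
      have cAU0: "0 < real (card (A \<union> U))" using AU fA fU by (simp add: card_gt_0_iff)
      have "ew (A \<union> U) \<le> e / m powr (1 + \<alpha>) * real (card (A \<union> U)) powr (1 + \<alpha>)"
        using Wmax[OF AU] cAU0 unfolding \<rho>W unfolding \<rho>_def by (simp add: field_simps)
      also have "\<dots> \<le> e / m powr (1 + \<alpha>) * (2 * real k) powr (1 + \<alpha>)"
        using cAU cAU0 e0 assms by (intro mult_left_mono powr_mono2) auto
      also have "\<dots> = e * (2 * real k / m) powr (1 + \<alpha>)"
        using k0 m0 by (simp add: powr_divide)
      finally have up: "ew (A \<union> U) \<le> e * (2 * real k / m) powr (1 + \<alpha>)" .
      have "real k * real (card FA) \<le> m * real (sum g U)"
        using U(3) unfolding gW m_def by (simp only: of_nat_le_iff flip: of_nat_mult)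
      moreover have "real k * (e / 2) \<le> real k * real (card FA)"
        using big by (intro mult_left_mono) auto
      moreover have "m * real (sum g U) \<le> m * (e * (2 * real k / m) powr (1 + \<alpha>))"
        using gU up m0 by (intro mult_left_mono) auto
      ultimately have "real k * (e / 2) \<le> m * (e * (2 * real k / m) powr (1 + \<alpha>))" by linarith
      then have "e * (real k / 2) \<le> e * (m * (2 * real k / m) powr (1 + \<alpha>))" by (simp add: mult_ac)
      then have "real k / 2 \<le> m * (2 * real k / m) powr (1 + \<alpha>)" using e0 by simp
      also have "\<dots> = m * ((2 * real k / m) * (2 * real k / m) powr \<alpha>)"
        using k0 m0 by (simp add: powr_add)
      also have "\<dots> = 2 * real k * (2 * real k / m) powr \<alpha>" using m0 by simp
      finally have "1 / 4 \<le> (2 * real k / m) powr \<alpha>" using k0 by (simp add: field_simps)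
      also have "\<dots> \<le> (8 / T) powr \<alpha>"
        using k3 k0 m0 T8 assms by (intro powr_mono2) (auto simp: field_simps)
      finally show False unfolding T\<alpha> by simp
    qed
    define E' where "E' = F - FA"
    have fE': "finite E'" unfolding E'_def using fF by simp
    have "card E' = card F - card FA"
      unfolding E'_def using fFA by (intro card_Diff_subset) (auto simp: FA_def)
    then have e': "e / 2 \<le> real (card E')" using small unfolding e_def by linarith
    have dd: "T * e / m \<le> 2 * T * real (card E') / m"
      using e' m0 T8 by (simp add: field_simps)
    have deg': "real (card (E' `` {v})) \<le> T * e / m \<and> real (card (E'\<inverse> `` {v})) \<le> T * e / m" for v
    proof (cases "v \<in> W \<and> v \<notin> A")
      case True
      then have "real (deg v) \<le> T * e / m" unfolding A_def by auto
      moreover have "card (E' `` {v}) \<le> card (F `` {v})" "card (E'\<inverse> `` {v}) \<le> card (F\<inverse> `` {v})"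
        unfolding E'_def by (intro card_mono; auto)+
      ultimately show ?thesis unfolding deg_def by linarith
    next
      case False
      then have "E' `` {v} = {}" "E'\<inverse> `` {v} = {}" unfolding E'_def FA_def F_def by auto
      then show ?thesis using T8 e0 m0 by simp
    qed
    have "C / 2 * m powr (1 + \<alpha>) \<le> real (card E')" using Ce e' by simp
    moreover have "E' \<subseteq> E \<inter> W \<times> W" unfolding E'_def F_def by auto
    ultimately show ?thesis
      using W(1,2) deg' dd unfolding m_def by (intro exI[of _ W] exI[of _ E']) (meson order_trans)
  qed
  show ?thesis using T8 by (intro exI[of _ T] conjI allI impI) (linarith, rule main)
qed

lemma induced_power_mono:
  assumes "induced_power adj r l X' Y'" "X' \<subseteq> X" "Y' \<subseteq> Y"
  shows "induced_power adj r l X Y"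
proof -
  obtain p ob c a where "p \<in> Y'" "\<forall>j<r. ob j \<in> X'"
    "\<forall>i<l. c i \<in> X' \<and> (\<forall>j<r. a i j \<in> Y') \<and> induced_spider adj r p ob (c i) (a i)"
    and non: "\<forall>i<l. \<forall>i'<l. i \<noteq> i' \<longrightarrow> \<not> conflict adj (c i) (c i') \<and>
        (\<forall>j<r. \<not> conflict adj (c i) (a i' j)) \<and>
        (\<forall>j<r. \<forall>j'<r. \<not> conflict adj (a i j) (a i' j'))"
    using assms(1) unfolding induced_power_def by (elim exE conjE) (rule that)
  then have "p \<in> Y" "\<forall>j<r. ob j \<in> X"
    "\<forall>i<l. c i \<in> X \<and> (\<forall>j<r. a i j \<in> Y) \<and> induced_spider adj r p ob (c i) (a i)"
    using assms(2,3) by auto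
  with non show ?thesis
    unfolding induced_power_def
    by (intro exI[of _ p] exI[of _ ob] exI[of _ c] exI[of _ a] conjI)
qed

lemma between_commute: "between G X Y = between G Y X"
  unfolding between_def by (auto simp: insert_commute)

text \<open>For \<alpha> = r/(2r+1) the power \<open>(m powr \<alpha>) ^ (2 * r + 1)\<close> is
  \<open>m ^ r\<close>, so \<open>D \<ge> C * m powr \<alpha>\<close> meets the threshold for
  spiders. As \<open>m \<ge> 1\<close>, it also gives \<open>D \<ge> C \<ge> D0\<close> whatever the
  size of \<open>W\<close>, which is why the bound holds for every \<open>n\<close> and not just
  eventually.\<close>

lemma ex_bip_bound_spider_power:
  assumes r: "r \<ge> 1" and l: "l \<ge> 1"
  shows "\<exists>C::real. \<forall>n. ex_bip_bound n (rooted_power (spider_plus r) (leaves (spider_plus r)) l) s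
    (nat \<lfloor>C * real n powr (1 + real r / (2 * real r + 1))\<rfloor>)"
proof -
  define \<alpha> where "\<alpha> = real r / (2 * real r + 1)"
  have \<alpha>: "0 < \<alpha>" "\<alpha> < 1" unfolding \<alpha>_def using r by (auto simp: field_simps)
  obtain T :: real where T1: "1 \<le> T" and T: "\<forall>(V :: nat set) E C. finite V \<longrightarrow> E \<subseteq> V \<times> V \<longrightarrow> E \<noteq> {} \<longrightarrow> T \<le> C \<longrightarrow>
    C * real (card V) powr (1 + \<alpha>) \<le> real (card E) \<longrightarrow>
    (\<exists>W E'. W \<subseteq> V \<and> W \<noteq> {} \<and> E' \<subseteq> E \<inter> W \<times> W \<and> C / 2 * real (card W) powr (1 + \<alpha>) \<le> real (card E') \<and>
      (\<forall>x. real (card (E' `` {x})) \<le> 2 * T * real (card E') / real (card W)) \<and>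
      (\<forall>y. real (card (E'\<inverse> `` {y})) \<le> 2 * T * real (card E') / real (card W)))"
    using almost_regular_subgraph[OF \<alpha>] by (elim exE conjE) (rule that)
  \<comment> \<open>With \<open>D\<close> defined below as the degree bound of the almost regular
    subgraph, \<open>\<kappa> * m * D\<close> is exactly its number of edges.\<close>
  define \<kappa> where "\<kappa> = 1 / (2 * T)"
  have \<kappa>: "0 < \<kappa>" unfolding \<kappa>_def using T1 by simp
  obtain C1 D0 :: real where reg: "\<forall>(adj :: nat \<Rightarrow> nat \<Rightarrow> bool) X Y E n D. biclique_free s adj \<longrightarrow>
    bipartite_host adj X Y E n D \<longrightarrow> D0 \<le> D \<longrightarrow> C1 * n ^ r \<le> D ^ (2 * r + 1) \<longrightarrow>
    \<kappa> * n * D \<le> real (card E) \<longrightarrow> induced_power adj r l X Y \<or> induced_power adj r l Y X"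
    using induced_power_of_almost_regular[OF \<kappa>, of s r l] by (elim exE) (rule that)
  define C where "C = max T (max D0 (max C1 1))"
  have C: "T \<le> C" "D0 \<le> C" "C1 \<le> C" "1 \<le> C" unfolding C_def by auto
  let ?H = "rooted_power (spider_plus r) (leaves (spider_plus r)) l"
  have "ex_bip_bound n ?H s (nat \<lfloor>C * real n powr (1 + \<alpha>)\<rfloor>)" for n
    unfolding ex_bip_bound_def
  proof (intro allI impI, elim conjE)
    fix G :: "nat graph" and X Y
    assume G: "simple_graph G" and n: "card (verts G) = n" and K: "Kss_free s G"
      and XY: "X \<union> Y = verts G" "X \<inter> Y = {}"
      and big: "nat \<lfloor>C * real n powr (1 + \<alpha>)\<rfloor> < card (edges (between G X Y))"
    define adj where "adj = (\<lambda>u v. {u, v} \<in> edges G)"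
    have free: "biclique_free s adj" unfolding adj_def using G K by (rule biclique_free_of_Kss_free)
    have fV: "finite (verts G)" using G unfolding simple_graph_def by simp
    define E where "E = {(x, y). x \<in> X \<and> y \<in> Y \<and> adj x y}"
    have EV: "E \<subseteq> verts G \<times> verts G" unfolding E_def using XY by auto
    then have fE: "finite E" using fV finite_subset by blast
    have "edges (between G X Y) \<subseteq> (\<lambda>(x, y). {x, y}) ` E"
      unfolding between_def E_def adj_def by auto
    then have cE: "card (edges (between G X Y)) \<le> card E"
      using fE surj_card_le by blast
    have CE: "C * real (card (verts G)) powr (1 + \<alpha>) \<le> real (card E)"
    proof -
      have "0 \<le> C * real n powr (1 + \<alpha>)" using C by simp
      then show ?thesis using big cE unfolding n by linarith
    qed
    have E0: "E \<noteq> {}" using big cE by auto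
    obtain W E' where W: "W \<subseteq> verts G" "W \<noteq> {}" "E' \<subseteq> E \<inter> W \<times> W"
      and cE': "C / 2 * real (card W) powr (1 + \<alpha>) \<le> real (card E')"
      and deg: "\<forall>x. real (card (E' `` {x})) \<le> 2 * T * real (card E') / real (card W)"
        "\<forall>y. real (card (E'\<inverse> `` {y})) \<le> 2 * T * real (card E') / real (card W)"
      using T[rule_format, OF fV EV E0 C(1) CE] by (elim exE conjE) (rule that)
    have fW: "finite W" using W fV finite_subset by blast
    define m where "m = real (card W)"
    have m0: "0 < m" unfolding m_def using W fW by (simp add: card_gt_0_iff)
    have m1: "1 \<le> m" using m0 unfolding m_def by (simp add: Suc_le_eq)
    define D where "D = 2 * T * real (card E') / m"
    have Dm: "C * m powr \<alpha> \<le> D"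
    proof -
      have "C / 2 * (m * m powr \<alpha>) \<le> real (card E')" using cE' m0 unfolding m_def[symmetric] by (simp add: powr_add)
      then have "C * m powr \<alpha> \<le> 2 * real (card E') / m" using m0 by (simp add: field_simps)
      also have "\<dots> \<le> D" unfolding D_def using mult_right_mono[OF T1, of "real (card E')"] m0 by (simp add: field_simps)
      finally show ?thesis .
    qed
    have m\<alpha>: "1 \<le> m powr \<alpha>" using m1 \<alpha> by (simp add: ge_one_powr_ge_zero)
    have "C * 1 \<le> C * m powr \<alpha>" using m\<alpha> C(4) by (intro mult_left_mono) auto
    then have DC: "C \<le> D" using Dm by linarith
    have "bipartite_host adj (X \<inter> W) (Y \<inter> W) E' m D"
    proof
      show "finite (X \<inter> W)" "finite (Y \<inter> W)" using fW by auto
      show "X \<inter> W \<inter> (Y \<inter> W) = {}" using XY by auto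
      show "E' \<subseteq> (X \<inter> W) \<times> (Y \<inter> W)" using W(3) unfolding E_def by auto
      show "adj x y" if "(x, y) \<in> E'" for x y using that W(3) unfolding E_def by auto
      show "real (card (X \<inter> W)) \<le> m" "real (card (Y \<inter> W)) \<le> m"
        unfolding m_def using fW by (auto intro!: card_mono)
      show "0 < D" using DC C(4) by linarith
    qed (use m0 deg in \<open>auto simp: D_def m_def\<close>)
    moreover have "C1 * m ^ r \<le> D ^ (2 * r + 1)"
    proof -
      have "(m powr \<alpha>) ^ (2 * r + 1) = (m powr \<alpha>) powr real (2 * r + 1)"
        using m0 by (intro powr_realpow[symmetric]) simp
      also have "\<dots> = m powr (\<alpha> * real (2 * r + 1))" by (rule powr_powr)
      also have "\<alpha> * real (2 * r + 1) = real r" unfolding \<alpha>_def by (simp add: field_simps)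
      finally have "(m powr \<alpha>) ^ (2 * r + 1) = m ^ r" using m0 by (simp add: powr_realpow)
      then have "C ^ (2 * r + 1) * m ^ r = (C * m powr \<alpha>) ^ (2 * r + 1)" by (simp only: power_mult_distrib)
      also have "\<dots> \<le> D ^ (2 * r + 1)" using Dm C(4) by (intro power_mono) auto
      finally have "C ^ (2 * r + 1) * m ^ r \<le> D ^ (2 * r + 1)" .
      moreover have "C1 \<le> C ^ (2 * r + 1)" using C(3) self_le_power[OF C(4), of "2 * r + 1"] by linarith
      then have "C1 * m ^ r \<le> C ^ (2 * r + 1) * m ^ r" using m0 by (intro mult_right_mono) auto
      ultimately show ?thesis by linarith
    qed
    moreover have "\<kappa> * m * D \<le> real (card E')" unfolding \<kappa>_def D_def using T1 m0 by simp
    moreover have "D0 \<le> D" using C(2) DC by linarith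
    ultimately have "induced_power adj r l (X \<inter> W) (Y \<inter> W) \<or> induced_power adj r l (Y \<inter> W) (X \<inter> W)"
      using reg free by blast
    then have "induced_power adj r l X Y \<or> induced_power adj r l Y X"
      using induced_power_mono by (metis Int_lower1)
    then show "\<exists>S. subgraph S (between G X Y) \<and> isomorphic S ?H \<and> induced_subgraph S G"
      using induced_power_copy[OF G XY r l] induced_power_copy[OF G _ _ r l, of Y X] XY
      unfolding adj_def between_commute[of G Y X] by (auto simp: Un_commute Int_commute)
  qed
  then show ?thesis unfolding \<alpha>_def by blast
qed

theorem theorem2p3:
  fixes r l s :: nat
  assumes "r \<ge> 1" and "l \<ge> 2" and "s \<ge> 2"
  shows "(\<lambda>n. real (ex_bip_star n
            (rooted_power (spider_plus r) (leaves (spider_plus r)) l) s))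
         \<in> O(\<lambda>n. real n powr (2 - (real r + 1) / (2 * real r + 1)))"
proof -
  let ?H = "rooted_power (spider_plus r) (leaves (spider_plus r)) l"
  have "l \<ge> 1" using assms(2) by simp
  then obtain C :: real where C: "\<And>n. ex_bip_bound n ?H s (nat \<lfloor>C * real n powr (1 + real r / (2 * real r + 1))\<rfloor>)"
    using ex_bip_bound_spider_power[OF assms(1)] by blast
  have exponent: "1 + real r / (2 * real r + 1) = 2 - (real r + 1) / (2 * real r + 1)"
    by (simp add: field_simps)
  \<comment> \<open>The sign of \<open>C\<close> is not recorded in the existence statement, hence
    the absolute value.\<close>
  have "real (ex_bip_star n ?H s) \<le> \<bar>C\<bar> * real n powr (2 - (real r + 1) / (2 * real r + 1))" for n
  proof -
    let ?p = "real n powr (2 - (real r + 1) / (2 * real r + 1))"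
    have "ex_bip_star n ?H s \<le> nat \<lfloor>C * ?p\<rfloor>"
      unfolding ex_bip_star_def using C[of n] unfolding exponent by (rule Least_le)
    moreover have "real (nat \<lfloor>C * ?p\<rfloor>) \<le> \<bar>C * ?p\<bar>" by linarith
    ultimately show ?thesis by (simp add: abs_mult)
  qed
  then show ?thesis by (intro bigoI[of _ "\<bar>C\<bar>"] always_eventually) simp
qed

end
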